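(* The following problem is NP-complete, even when restricted to undirected graphs with all edge weights equal to $1$: given a graph $G$ with positive edge weights $w\colon E(G)\to\mathbb{R}_{+}$, vertices $s,t\in V(G)$, and $k\in\mathbb{N}$, decide whether there exists an anti-forcing set $S\subseteq E(G)$ for shortest $s$-$t$ paths in $(G,w)$ with $|S|\le k$.
   Context: A set $S\subseteq E(G)$ is an anti-forcing set for shortest $s$-$t$ paths in $(G,w)$ if there is exactly one shortest $s$-$t$ path $P$ in $(G,w)$ with $S\cap E(P)=\varnothing$ (equivalently, $S\cap E(P)=\varnothing$ for some shortest $s$-$t$ path $P$, and every other shortest $s$-$t$ path $P'\neq P$ satisfies $S\cap E(P')\neq\varnothing$).
   Formalization: Arbitrary positive real edge weights have no finite encoding as input of a decision problem, so in the general problem the weights are positive rationals, given as fractions in binary; the case of all weights equal to 1 is unaffected. *)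

theory Defs
  imports Complex_Main "HOL-Computational_Algebra.Polynomial"
begin

section \<open>Shortest paths and anti-forcing sets\<close>

text \<open>
  Graphs are finite and simple, and either directed (edges are ordered pairs) or undirected
  (edges are two-element sets).
\<close>

datatype 'v edge = Arc 'v 'v | Link "'v set"

record 'v graph =
  is_directed :: bool
  verts :: "'v set"
  edges :: "'v edge set"

definition edge_of :: "'v graph \<Rightarrow> 'v \<Rightarrow> 'v \<Rightarrow> 'v edge" where
  "edge_of G u v = (if is_directed G then Arc u v else Link {u, v})"

definition wf_graph :: "'v graph \<Rightarrow> bool" where
  "wf_graph G \<longleftrightarrow> finite (verts G) \<and>
     edges G \<subseteq> {edge_of G u v | u v. u \<in> verts G \<and> v \<in> verts G \<and> u \<noteq> v}"

text \<open>Since the graphs are simple, a path is determined by its sequence of vertices.\<close>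

definition path_edges :: "'v graph \<Rightarrow> 'v list \<Rightarrow> 'v edge set" where
  "path_edges G P = {edge_of G (P ! i) (P ! Suc i) | i. Suc i < length P}"

definition st_path :: "'v graph \<Rightarrow> 'v \<Rightarrow> 'v \<Rightarrow> 'v list \<Rightarrow> bool" where
  "st_path G s t P \<longleftrightarrow> P \<noteq> [] \<and> hd P = s \<and> last P = t \<and>
     distinct P \<and> set P \<subseteq> verts G \<and> path_edges G P \<subseteq> edges G"

definition path_weight :: "'v graph \<Rightarrow> ('v edge \<Rightarrow> real) \<Rightarrow> 'v list \<Rightarrow> real" where
  "path_weight G w P = (\<Sum>e\<in>path_edges G P. w e)"

definition shortest_path ::
  "'v graph \<Rightarrow> ('v edge \<Rightarrow> real) \<Rightarrow> 'v \<Rightarrow> 'v \<Rightarrow> 'v list \<Rightarrow> bool" where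
  "shortest_path G w s t P \<longleftrightarrow> st_path G s t P \<and>
     (\<forall>P'. st_path G s t P' \<longrightarrow> path_weight G w P \<le> path_weight G w P')"

definition anti_forcing_set ::
  "'v graph \<Rightarrow> ('v edge \<Rightarrow> real) \<Rightarrow> 'v \<Rightarrow> 'v \<Rightarrow> 'v edge set \<Rightarrow> bool" where
  "anti_forcing_set G w s t S \<longleftrightarrow> S \<subseteq> edges G \<and>
     (\<exists>!P. shortest_path G w s t P \<and> S \<inter> path_edges G P = {})"

definition valid_instance ::
  "'v graph \<Rightarrow> ('v edge \<Rightarrow> real) \<Rightarrow> 'v \<Rightarrow> 'v \<Rightarrow> bool" where
  "valid_instance G w s t \<longleftrightarrow> wf_graph G \<and> (\<forall>e\<in>edges G. w e > 0) \<and> s \<in> verts G \<and> t \<in> verts G"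


section \<open>Multi-tape Turing machines and NP-completeness\<close>

text \<open>
  A tape is two-way infinite and consists of its contents and the position of its head.
  Symbol 0 is the blank, symbols 1 and 2 are the input and output bits.
  The start state is 0 and the halting state is the number of (proper) states.
  The transition function maps a state and the symbols read, one per tape, to a new state
  and, for each tape, the symbol to write and the head movement.
\<close>

type_synonym tape = "(int \<Rightarrow> nat) \<times> int"

datatype move = Move_Left | Stay | Move_Right

record tm =
  num_tapes :: nat
  num_states :: nat
  num_symbols :: nat
  trans :: "nat \<Rightarrow> nat list \<Rightarrow> nat \<times> (nat \<times> move) list"

definition wf_tm :: "tm \<Rightarrow> bool" where
  "wf_tm M \<longleftrightarrow> num_tapes M \<ge> 1 \<and> num_states M \<ge> 1 \<and> num_symbols M \<ge> 3 \<and>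
     (\<forall>q syms. q < num_states M \<and> length syms = num_tapes M \<and> set syms \<subseteq> {..<num_symbols M} \<longrightarrow>
        (case trans M q syms of (q', acts) \<Rightarrow>
           q' \<le> num_states M \<and> length acts = num_tapes M \<and> fst ` set acts \<subseteq> {..<num_symbols M}))"

fun head_shift :: "move \<Rightarrow> int" where
  "head_shift Move_Left = - 1"
| "head_shift Stay = 0"
| "head_shift Move_Right = 1"

fun read_sym :: "tape \<Rightarrow> nat" where
  "read_sym (c, h) = c h"

fun act_tape :: "nat \<times> move \<Rightarrow> tape \<Rightarrow> tape" where
  "act_tape (a, m) (c, h) = (c(h := a), h + head_shift m)"

type_synonym config = "nat \<times> tape list"

fun tm_step :: "tm \<Rightarrow> config \<Rightarrow> config" where
  "tm_step M (q, tps) =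
     (if q \<ge> num_states M then (q, tps)
      else case trans M q (map read_sym tps) of (q', acts) \<Rightarrow> (q', map2 act_tape acts tps))"

fun bit_sym :: "bool \<Rightarrow> nat" where
  "bit_sym False = 1"
| "bit_sym True = 2"

definition input_tape :: "bool list \<Rightarrow> tape" where
  "input_tape x = (\<lambda>i. if 0 \<le> i \<and> i < int (length x) then bit_sym (x ! nat i) else 0, 0)"

definition init_config :: "tm \<Rightarrow> bool list \<Rightarrow> config" where
  "init_config M x = (0, input_tape x # replicate (num_tapes M - 1) (\<lambda>_. 0, 0))"

text \<open>The output is read from cell 0 up to the first blank; the head may be anywhere.\<close>

definition tape_output :: "tape \<Rightarrow> bool list \<Rightarrow> bool" where
  "tape_output tp y \<longleftrightarrow>
     (\<forall>i<length y. fst tp (int i) = bit_sym (y ! i)) \<and> fst tp (int (length y)) = 0"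

text \<open>
  The last tape is the output tape. Halting configurations are fixed points of the step function,
  so being in the halting state after the given number of steps means halting within that bound.
\<close>

definition poly_time_computable :: "(bool list \<Rightarrow> bool list) \<Rightarrow> bool" where
  "poly_time_computable f \<longleftrightarrow>
     (\<exists>M (p :: nat poly). wf_tm M \<and>
        (\<forall>x. case (tm_step M ^^ poly p (length x)) (init_config M x) of (q, tps) \<Rightarrow>
               q = num_states M \<and> tape_output (last tps) (f x)))"

type_synonym language = "bool list set"

definition in_P :: "language \<Rightarrow> bool" where
  "in_P L \<longleftrightarrow> poly_time_computable (\<lambda>x. [x \<in> L])"

text \<open>Self-delimiting strings: each bit is preceded by True, and a final False ends the string.\<close>

definition self_delim :: "bool list \<Rightarrow> bool list" where
  "self_delim x = concat (map (\<lambda>b. [True, b]) x) @ [False]"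

definition pair_str :: "bool list \<Rightarrow> bool list \<Rightarrow> bool list" where
  "pair_str x u = self_delim x @ u"

definition in_NP :: "language \<Rightarrow> bool" where
  "in_NP L \<longleftrightarrow>
     (\<exists>V (p :: nat poly). in_P V \<and>
        (\<forall>x. x \<in> L \<longleftrightarrow> (\<exists>u. length u \<le> poly p (length x) \<and> pair_str x u \<in> V)))"

definition poly_time_reducible :: "language \<Rightarrow> language \<Rightarrow> bool" where
  "poly_time_reducible L L' \<longleftrightarrow>
     (\<exists>f. poly_time_computable f \<and> (\<forall>x. x \<in> L \<longleftrightarrow> f x \<in> L'))"

definition NP_hard :: "language \<Rightarrow> bool" where
  "NP_hard L \<longleftrightarrow> (\<forall>L'. in_NP L' \<longrightarrow> poly_time_reducible L' L)"

definition NP_complete :: "language \<Rightarrow> bool" where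
  "NP_complete L \<longleftrightarrow> in_NP L \<and> NP_hard L"


section \<open>Encoding of the instances\<close>

text \<open>Binary representation, least significant bit first.\<close>

fun binary :: "nat \<Rightarrow> bool list" where
  "binary n = (if n = 0 then [] else odd n # binary (n div 2))"

declare binary.simps [simp del]

definition enc_nat :: "nat \<Rightarrow> bool list" where
  "enc_nat n = self_delim (binary n)"

definition enc_list :: "('a \<Rightarrow> bool list) \<Rightarrow> 'a list \<Rightarrow> bool list" where
  "enc_list f xs = concat (map (\<lambda>x. True # f x) xs) @ [False]"

text \<open>
  An entry \<open>(u, v, a, b)\<close> of the edge list stands for an edge from \<open>u\<close> to \<open>v\<close> of weight \<open>a / b\<close>.
\<close>

type_synonym edge_entry = "nat \<times> nat \<times> nat \<times> nat"

fun enc_entry :: "edge_entry \<Rightarrow> bool list" where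
  "enc_entry (u, v, a, b) = enc_nat u @ enc_nat v @ enc_nat a @ enc_nat b"

text \<open>
  The number of vertices is written in unary, so that the input is at least as long as the number
  of vertices; all other numbers, in particular the weights, are written in binary.
\<close>

definition enc_data ::
  "bool \<Rightarrow> nat \<Rightarrow> edge_entry list \<Rightarrow> nat \<Rightarrow> nat \<Rightarrow> nat \<Rightarrow> bool list" where
  "enc_data d n es s t k =
     d # replicate n True @ [False] @ enc_list enc_entry es @ enc_nat s @ enc_nat t @ enc_nat k"

text \<open>
  Instances with finite encodings: the vertices are \<open>0, \<dots>, n - 1\<close> and the weights are rational.
\<close>

definition encodes_instance ::
  "bool list \<Rightarrow> nat graph \<Rightarrow> (nat edge \<Rightarrow> real) \<Rightarrow> nat \<Rightarrow> nat \<Rightarrow> nat \<Rightarrow> bool" where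
  "encodes_instance x G w s t k \<longleftrightarrow>
     (\<exists>n es. x = enc_data (is_directed G) n es s t k \<and>
        verts G = {..<n} \<and>
        edges G = (\<lambda>(u, v, a, b). edge_of G u v) ` set es \<and>
        distinct (map (\<lambda>(u, v, a, b). edge_of G u v) es) \<and>
        (\<forall>(u, v, a, b) \<in> set es. b \<noteq> 0 \<and> w (edge_of G u v) = real a / real b))"

definition ANTI_FORCING :: language where
  "ANTI_FORCING =
     {x. \<exists>G w s t k. encodes_instance x G w s t k \<and> valid_instance G w s t \<and>
           (\<exists>S. anti_forcing_set G w s t S \<and> card S \<le> k)}"

definition ANTI_FORCING_undirected_unit :: language where
  "ANTI_FORCING_undirected_unit =
     {x. \<exists>G w s t k. encodes_instance x G w s t k \<and> valid_instance G w s t \<and>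
           \<not> is_directed G \<and> (\<forall>e\<in>edges G. w e = 1) \<and>
           (\<exists>S. anti_forcing_set G w s t S \<and> card S \<le> k)}"


subsection \<open>A string encodes at most one instance\<close>

lemma self_delim_append_inject:
  "self_delim x @ r = self_delim y @ r' \<longleftrightarrow> x = y \<and> r = r'"
proof (induction x arbitrary: y)
  case Nil
  show ?case by (cases y) (auto simp: self_delim_def)
next
  case (Cons b x)
  then show ?case by (cases y) (auto simp: self_delim_def)
qed

lemma binary_inject: "binary m = binary n \<longleftrightarrow> m = n"
proof
  show "binary m = binary n \<Longrightarrow> m = n"
  proof (induction m arbitrary: n rule: less_induct)
    case (less m)
    show ?case
    proof (cases "m = 0 \<or> n = 0")
      case True
      then show ?thesis using less.prems
        by (auto simp: binary.simps[of m] binary.simps[of n] split: if_splits)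
    next
      case False
      then have "odd m = odd n" "binary (m div 2) = binary (n div 2)"
        using less.prems by (simp_all add: binary.simps[of m] binary.simps[of n])
      moreover from this have "m div 2 = n div 2" using less.IH[of "m div 2"] False by simp
      ultimately show ?thesis by presburger
    qed
  qed
qed simp

lemma enc_nat_append_inject: "enc_nat m @ r = enc_nat n @ r' \<longleftrightarrow> m = n \<and> r = r'"
  by (simp add: enc_nat_def self_delim_append_inject binary_inject)

lemma enc_entry_append_inject: "enc_entry e @ r = enc_entry e' @ r' \<longleftrightarrow> e = e' \<and> r = r'"
  by (cases e; cases e') (auto simp: enc_nat_append_inject)

lemma enc_list_append_inject:
  assumes "\<And>e e' r r'. f e @ r = f e' @ r' \<longleftrightarrow> e = e' \<and> r = r'"
  shows "enc_list f xs @ r = enc_list f ys @ r' \<longleftrightarrow> xs = ys \<and> r = r'"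
proof (induction xs arbitrary: ys)
  case Nil
  show ?case by (cases ys) (auto simp: enc_list_def)
next
  case (Cons x xs)
  then show ?case by (cases ys) (auto simp: enc_list_def assms)
qed

lemma unary_append_inject:
  "replicate m True @ False # r = replicate n True @ False # r' \<longleftrightarrow> m = n \<and> r = r'"
proof (induction m arbitrary: n)
  case 0
  show ?case by (cases n) auto
next
  case (Suc m)
  then show ?case by (cases n) auto
qed

lemma enc_data_inject:
  "enc_data d n es s t k = enc_data d' n' es' s' t' k' \<longleftrightarrow>
     d = d' \<and> n = n' \<and> es = es' \<and> s = s' \<and> t = t' \<and> k = k'"
  using enc_nat_append_inject[of k "[]" k' "[]"]
  by (auto simp: enc_data_def unary_append_inject enc_nat_append_inject
      enc_list_append_inject[OF enc_entry_append_inject])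

lemma encodes_instance_unique:
  assumes "encodes_instance x G w s t k" "encodes_instance x G' w' s' t' k'"
  shows "G = G' \<and> (\<forall>e\<in>edges G. w e = w' e) \<and> s = s' \<and> t = t' \<and> k = k'"
proof -
  obtain n es where A: "x = enc_data (is_directed G) n es s t k" "verts G = {..<n}"
    "edges G = (\<lambda>(u, v, a, b). edge_of G u v) ` set es"
    "\<forall>(u, v, a, b) \<in> set es. b \<noteq> 0 \<and> w (edge_of G u v) = real a / real b"
    using assms(1) unfolding encodes_instance_def by blast
  obtain n' es' where B: "x = enc_data (is_directed G') n' es' s' t' k'" "verts G' = {..<n'}"
    "edges G' = (\<lambda>(u, v, a, b). edge_of G' u v) ` set es'"
    "\<forall>(u, v, a, b) \<in> set es'. b \<noteq> 0 \<and> w' (edge_of G' u v) = real a / real b"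
    using assms(2) unfolding encodes_instance_def by blast
  have eq: "is_directed G = is_directed G'" "n = n'" "es = es'" "s = s'" "t = t'" "k = k'"
    using A(1) B(1) by (auto simp: enc_data_inject)
  have edge: "edge_of G u v = edge_of G' u v" for u v
    by (simp add: edge_of_def eq(1))
  have "G = G'" using A(2,3) B(2,3) eq edge by simp
  moreover have "\<forall>e\<in>edges G. w e = w' e" using A(3,4) B(4) eq edge by fastforce
  ultimately show ?thesis using eq by simp
qed

end

theory Submission
  imports Defs
begin

text \<open>
  Polynomial time: programs over bit stacks compile to multi-tape machines, and the functions they
  compute in polynomial time on codes of binary trees are closed under composition, pairing, case
  distinction and loops whose intermediate results are polynomially bounded. Since all data types
  are coded as trees, polynomial-time computability becomes a matter of syntax.

  Hardness: an accepting computation is a solution of a binary constraint satisfaction problem with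
  one variable per tape cell and time step. Such a problem is a layered graph in which the preserved
  shortest path selects a value for every variable, all unselected values are cut at cost one each,
  and a conflict between two selected values creates more disjoint detours than the budget allows
  to cut.

  Membership: by duality, feasible potentials certify the shortest paths as the paths made of tight
  edges. Uniqueness of the path avoiding \<open>S\<close> is certified by the set of vertices that can still
  reach \<open>t\<close> by tight edges outside \<open>S\<close>: the path must never be able to branch into this set.
\<close>

section \<open>A stack language with exact step counts, compiled to six-tape machines\<close>

section \<open>Programs over bit stacks\<close>

text \<open>Uniqueness shapes both directions. For membership, the competing shortest paths can be
  exponentially many; but weights are positive, so tight edges strictly increase the potential,
  every tight walk is already a path, and uniqueness turns into a reachability question. Rational
  weights are scaled by the product of all denominators, which has only linearly many bits, so
  potentials are naturals of polynomial length. For hardness, uniqueness is what a conflict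
  destroys: the budget is \<open>N * m\<close>, an ear has \<open>N * m + 2\<close> arc-disjoint
  copies, so at least two copies survive every admissible cut. Ears respect the layers and are
  therefore as short as the direct route. The possible values of a tableau cell depend on the
  machine only, not on the input; hence a constraint between two given values is a constant built
  into the program, and only the arithmetic of times and positions has to be computed. One reduction
  serves both languages, because its graphs are undirected with unit weights.\<close>

datatype com =
    Skip
  | Push nat bool
  | Pop nat
  | Out bool
  | Seq com com (infixr ";;" 60)
  | Cond nat "nat set" com com
  | While nat "nat set" com

definition sym_at :: "bool list \<Rightarrow> nat \<Rightarrow> nat" where
  "sym_at xs i = (if i < length xs then bit_sym (xs ! i) else 0)"

abbreviation top_sym :: "bool list \<Rightarrow> nat" where
  "top_sym xs \<equiv> sym_at xs 0"

lemma top_sym_simps [simp]: "top_sym [] = 0" "top_sym (b # xs) = bit_sym b"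
  by (simp_all add: sym_at_def)

type_synonym store = "nat \<Rightarrow> bool list"

text \<open>
  Register 5 is the output: it is only ever extended at its end. The step counts are exactly those
  of the compiled machine.
\<close>

inductive exec :: "com \<Rightarrow> store \<Rightarrow> nat \<Rightarrow> store \<Rightarrow> bool" where
  Skip: "exec Skip s 0 s"
| Push: "exec (Push r b) s 2 (s(r := b # s r))"
| Pop: "exec (Pop r) s 1 (s(r := tl (s r)))"
| Out: "exec (Out b) s 1 (s(5 := s 5 @ [b]))"
| Seq: "exec c1 s t1 s1 \<Longrightarrow> exec c2 s1 t2 s2 \<Longrightarrow> exec (c1 ;; c2) s (t1 + t2) s2"
| CondT: "top_sym (s r) \<in> A \<Longrightarrow> exec c1 s t s1 \<Longrightarrow> exec (Cond r A c1 c2) s (t + 2) s1"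
| CondF: "top_sym (s r) \<notin> A \<Longrightarrow> exec c2 s t s1 \<Longrightarrow> exec (Cond r A c1 c2) s (t + 1) s1"
| WhileF: "top_sym (s r) \<notin> A \<Longrightarrow> exec (While r A c) s 1 s"
| WhileT: "top_sym (s r) \<in> A \<Longrightarrow> exec c s t s1 \<Longrightarrow> exec (While r A c) s1 u s2 \<Longrightarrow>
    exec (While r A c) s (t + 2 + u) s2"

text \<open>Register 5 holds the output, which \<open>Out\<close> alone may touch; stack operations
  and tests are confined to the registers below it.\<close>

fun wfc :: "com \<Rightarrow> bool" where
  "wfc Skip = True"
| "wfc (Push r b) = (r < 5)"
| "wfc (Pop r) = (r < 5)"
| "wfc (Out b) = True"
| "wfc (c1 ;; c2) = (wfc c1 \<and> wfc c2)"
| "wfc (Cond r A c1 c2) = (r < 5 \<and> wfc c1 \<and> wfc c2)"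
| "wfc (While r A c) = (r < 5 \<and> wfc c)"

subsection \<open>Compilation to Turing machines\<close>

type_synonym instr = "nat \<times> (nat \<Rightarrow> nat \<times> move \<times> nat)"

fun csize :: "com \<Rightarrow> nat" where
  "csize Skip = 0"
| "csize (Push r b) = 2"
| "csize (Pop r) = 1"
| "csize (Out b) = 1"
| "csize (c1 ;; c2) = csize c1 + csize c2"
| "csize (Cond r A c1 c2) = 2 + csize c1 + csize c2"
| "csize (While r A c) = 2 + csize c"

text \<open>Each instruction inspects and changes a single tape. Stacks grow to the left, so a push
  is a move followed by a write, and the input tape with its head on cell 0 already is a stack with
  the first bit on top. \<open>Pop\<close> stays put on a blank, matching \<open>tl []\<close>. The
  unconditional jumps rewrite the symbol read on tape 0.\<close>

fun compile :: "com \<Rightarrow> nat \<Rightarrow> instr list" where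
  "compile Skip i = []"
| "compile (Push r b) i = [(r, \<lambda>a. (a, Move_Left, Suc i)), (r, \<lambda>a. (bit_sym b, Stay, i + 2))]"
| "compile (Pop r) i = [(r, \<lambda>a. (a, if a = 0 then Stay else Move_Right, Suc i))]"
| "compile (Out b) i = [(5, \<lambda>a. (bit_sym b, Move_Right, Suc i))]"
| "compile (c1 ;; c2) i = compile c1 i @ compile c2 (i + csize c1)"
| "compile (Cond r A c1 c2) i =
     (r, \<lambda>a. (a, Stay, if a \<in> A then Suc i else i + 2 + csize c1)) #
     compile c1 (Suc i) @ (0, \<lambda>a. (a, Stay, i + 2 + csize c1 + csize c2)) #
     compile c2 (i + 2 + csize c1)"
| "compile (While r A c) i =
     (r, \<lambda>a. (a, Stay, if a \<in> A then Suc i else i + 2 + csize c)) #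
     compile c (Suc i) @ [(0, \<lambda>a. (a, Stay, i))]"

lemma length_compile [simp]: "length (compile c i) = csize c"
  by (induction c arbitrary: i) auto

definition tm_of :: "instr list \<Rightarrow> tm" where
  "tm_of I = \<lparr>num_tapes = 6, num_states = length I, num_symbols = 3,
     trans = (\<lambda>q syms. case I ! q of (r, f) \<Rightarrow> case f (syms ! r) of (a, m, q') \<Rightarrow>
       (q', map (\<lambda>j. if j = r then (a, m) else (syms ! j, Stay)) [0..<6]))\<rparr>"

lemma compile_instr:
  "wfc c \<Longrightarrow> (r, f) \<in> set (compile c i) \<Longrightarrow>
     r < 6 \<and> (\<forall>a<3. fst (f a) < 3 \<and> snd (snd (f a)) \<le> i + csize c)"
proof (induction c arbitrary: i)
  case (Push r b)
  then show ?case by (cases b) auto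
next
  case (Out b)
  then show ?case by (cases b) auto
next
  case (Seq c1 c2)
  then show ?case by fastforce
next
  case (Cond r' A c1 c2)
  from Cond.prems(2) consider "(r, f) = (r', \<lambda>a. (a, Stay, if a \<in> A then Suc i else i + 2 + csize c1))"
    | "(r, f) \<in> set (compile c1 (Suc i))" | "(r, f) = (0, \<lambda>a. (a, Stay, i + 2 + csize c1 + csize c2))"
    | "(r, f) \<in> set (compile c2 (i + 2 + csize c1))" by auto
  then show ?case
  proof cases
    case 2
    then show ?thesis using Cond.IH(1)[of "Suc i"] Cond.prems(1) by fastforce
  next
    case 4
    then show ?thesis using Cond.IH(2)[of "i + 2 + csize c1"] Cond.prems(1) by fastforce
  qed (use Cond.prems in auto)
next
  case (While r' A c)
  from While.prems(2) consider "(r, f) = (r', \<lambda>a. (a, Stay, if a \<in> A then Suc i else i + 2 + csize c))"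
    | "(r, f) \<in> set (compile c (Suc i))" | "(r, f) = (0, \<lambda>a. (a, Stay, i))" by auto
  then show ?case
  proof cases
    case 2
    then show ?thesis using While.IH[of "Suc i"] While.prems(1) by fastforce
  qed (use While.prems in auto)
qed auto

lemma wf_tm_of:
  assumes "wfc c" "csize c \<ge> 1"
  shows "wf_tm (tm_of (compile c 0))"
proof -
  have "case trans (tm_of (compile c 0)) q syms of (q', acts) \<Rightarrow>
      q' \<le> csize c \<and> length acts = 6 \<and> fst ` set acts \<subseteq> {..<3}"
    if q: "q < csize c" and syms: "length syms = 6" "set syms \<subseteq> {..<3}" for q and syms :: "nat list"
  proof -
    obtain r f where rf: "compile c 0 ! q = (r, f)" by fastforce
    then have "(r, f) \<in> set (compile c 0)" using q by (metis length_compile nth_mem)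
    then have 1: "r < 6" "\<forall>a<3. fst (f a) < 3 \<and> snd (snd (f a)) \<le> csize c"
      using compile_instr[OF assms(1), of r f 0] by auto
    have sy: "syms ! j < 3" if "j < 6" for j using syms that by (metis lessThan_iff nth_mem subsetD)
    obtain a m q' where f: "f (syms ! r) = (a, m, q')" by (metis prod_cases3)
    have "a < 3" "q' \<le> csize c" using 1 sy f by force+
    then show ?thesis using sy by (auto simp: tm_of_def rf f)
  qed
  then show ?thesis using assms(2) by (simp add: wf_tm_def) (simp add: tm_of_def)
qed

text \<open>Only the cells from the head to the right count. What \<open>Pop\<close> leaves on the
  left is garbage that later pushes overwrite.\<close>

fun stack_tape :: "bool list \<Rightarrow> tape \<Rightarrow> bool" where
  "stack_tape xs (c, h) \<longleftrightarrow> (\<forall>i. c (h + int i) = sym_at xs i)"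

fun out_tape :: "bool list \<Rightarrow> tape \<Rightarrow> bool" where
  "out_tape xs (c, h) \<longleftrightarrow> h = int (length xs) \<and> (\<forall>i. c (int i) = sym_at xs i)"

definition rel :: "store \<Rightarrow> tape list \<Rightarrow> bool" where
  "rel s tps \<longleftrightarrow> length tps = 6 \<and> (\<forall>r<5. stack_tape (s r) (tps ! r)) \<and> out_tape (s 5) (tps ! 5)"

lemma rel_update:
  assumes "rel s tps" "r < 5" "stack_tape xs tp"
  shows "rel (s(r := xs)) (tps[r := tp])"
  using assms by (auto simp: rel_def nth_list_update)

lemma rel_read: "rel s tps \<Longrightarrow> r < 5 \<Longrightarrow> read_sym (tps ! r) = top_sym (s r)"
proof -
  assume a: "rel s tps" "r < 5"
  obtain c h where ch: "tps ! r = (c, h)" by fastforce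
  then have "stack_tape (s r) (c, h)" using a by (metis rel_def)
  then have "c (h + int 0) = top_sym (s r)" unfolding stack_tape.simps by blast
  then show ?thesis by (simp add: ch)
qed

definition runs :: "instr list \<Rightarrow> config \<Rightarrow> nat \<Rightarrow> config \<Rightarrow> bool" where
  "runs I c t c' \<longleftrightarrow> (tm_step (tm_of I) ^^ t) c = c'"

lemma runs_trans: "runs I c t c' \<Longrightarrow> runs I c' u c'' \<Longrightarrow> runs I c (t + u) c''"
  by (simp add: runs_def add.commute[of t u] funpow_add)

lemma runs_step:
  assumes "length tps = 6" "q < length I" "I ! q = (r, f)" "r < 6" "f (read_sym (tps ! r)) = (a, m, q')"
  shows "runs I (q, tps) 1 (q', tps[r := act_tape (a, m) (tps ! r)])"
proof -
  have *: "act_tape (read_sym tp, Stay) tp = tp" for tp by (cases tp) simp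
  have "map2 act_tape (map (\<lambda>j. if j = r then (a, m) else (map read_sym tps ! j, Stay)) [0..<6]) tps
      = tps[r := act_tape (a, m) (tps ! r)]"
    by (rule nth_equalityI) (use assms in \<open>auto simp: nth_list_update *\<close>)
  then show ?thesis using assms by (simp add: runs_def tm_of_def)
qed

lemma runs_stay:
  assumes "length tps = 6" "q < length I" "I ! q = (r, \<lambda>a. (a, Stay, f a))" "r < 6"
  shows "runs I (q, tps) 1 (f (read_sym (tps ! r)), tps)"
proof -
  have "act_tape (read_sym (tps ! r), Stay) (tps ! r) = tps ! r" by (cases "tps ! r") simp
  then show ?thesis using runs_step[OF assms(1,2,3,4) refl] by simp
qed

definition code_at :: "instr list \<Rightarrow> nat \<Rightarrow> instr list \<Rightarrow> bool" where
  "code_at I i p \<longleftrightarrow> (\<exists>pre post. I = pre @ p @ post \<and> length pre = i)"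

lemma code_at_append: "code_at I i (p @ q) \<Longrightarrow> code_at I i p \<and> code_at I (i + length p) q"
  unfolding code_at_def by (metis append.assoc length_append)

lemma code_at_Cons:
  assumes "code_at I i (x # p)"
  shows "i < length I" "I ! i = x" "code_at I (Suc i) p"
proof -
  obtain pre post where *: "I = pre @ (x # p) @ post" "length pre = i"
    using assms unfolding code_at_def by blast
  then show "i < length I" "I ! i = x" by (auto simp: nth_append)
  have "I = (pre @ [x]) @ p @ post \<and> length (pre @ [x]) = Suc i" using * by simp
  then show "code_at I (Suc i) p" unfolding code_at_def by blast
qed

lemma stack_push:
  assumes "stack_tape xs (c, h)"
  shows "stack_tape (b # xs) (c(h - 1 := bit_sym b), h - 1)"
  unfolding stack_tape.simps
proof
  fix i
  have "c (h + int (i - 1)) = sym_at xs (i - 1)" using assms by simp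
  then show "(c(h - 1 := bit_sym b)) (h - 1 + int i) = sym_at (b # xs) i"
    by (cases i) (auto simp: sym_at_def)
qed

lemma stack_pop:
  assumes "stack_tape xs (c, h)" "xs \<noteq> []"
  shows "stack_tape (tl xs) (c, h + 1)"
  unfolding stack_tape.simps
proof
  fix i
  have "c (h + int (Suc i)) = sym_at xs (Suc i)" using assms(1) unfolding stack_tape.simps by blast
  then show "c (h + 1 + int i) = sym_at (tl xs) i"
    using assms(2) by (cases xs) (auto simp: sym_at_def algebra_simps)
qed

lemma bit_sym_pos [simp]: "bit_sym b \<noteq> 0" by (cases b) auto

text \<open>Induction over the execution rather than the program, since loops unfold. The code is
  located at an absolute offset of the whole instruction list because jump targets are
  absolute.\<close>

lemma compile_correct:
  "exec c s t s' \<Longrightarrow> wfc c \<Longrightarrow> rel s tps \<Longrightarrow> code_at I i (compile c i) \<Longrightarrow>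
     \<exists>tps'. rel s' tps' \<and> runs I (i, tps) t (i + csize c, tps')"
proof (induction arbitrary: i tps rule: exec.induct)
  case (Skip s)
  then show ?case by (auto simp: runs_def)
next
  case (Push r b s)
  obtain c h where ch: "tps ! r = (c, h)" by fastforce
  have len: "length tps = 6" using Push by (simp add: rel_def)
  note cd = code_at_Cons[OF Push(3)[unfolded compile.simps]]
  let ?tps = "tps[r := (c, h - 1)]"
  have 1: "runs I (i, tps) 1 (Suc i, ?tps)"
    using runs_step[OF len cd(1,2) _ refl] Push(1) ch by simp
  note cd2 = code_at_Cons[OF cd(3)]
  have 2: "runs I (Suc i, ?tps) 1 (i + 2, ?tps[r := (c(h - 1 := bit_sym b), h - 1)])"
    using runs_step[OF _ cd2(1,2) _ refl, of ?tps] Push(1) len by simp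
  have "stack_tape (s r) (c, h)" using Push ch by (metis rel_def wfc.simps(2))
  from rel_update[OF Push(2) _ stack_push[OF this]]
  have "rel (s(r := b # s r)) (?tps[r := (c(h - 1 := bit_sym b), h - 1)])" using Push(1) by simp
  moreover have "runs I (i, tps) 2 (i + csize (Push r b), ?tps[r := (c(h - 1 := bit_sym b), h - 1)])"
    using runs_trans[OF 1 2] by (simp add: numeral_2_eq_2)
  ultimately show ?case by blast
next
  case (Pop r s)
  obtain c h where ch: "tps ! r = (c, h)" by fastforce
  have len: "length tps = 6" using Pop by (simp add: rel_def)
  note cd = code_at_Cons[OF Pop(3)[unfolded compile.simps]]
  have st: "stack_tape (s r) (c, h)" using Pop ch by (metis rel_def wfc.simps(3))
  then have rd: "c h = top_sym (s r)" by (metis add.right_neutral of_nat_0 stack_tape.simps)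
  let ?tps = "tps[r := (c, h + head_shift (if c h = 0 then Stay else Move_Right))]"
  have 1: "runs I (i, tps) 1 (Suc i, ?tps)"
    using runs_step[OF len cd(1,2) _ refl] Pop(1) ch by simp
  have "stack_tape (tl (s r)) (c, h + head_shift (if c h = 0 then Stay else Move_Right))"
  proof (cases "s r")
    case Nil
    then show ?thesis using st rd by simp
  next
    case (Cons b bs)
    then show ?thesis using stack_pop[OF st] rd by simp
  qed
  then have "rel (s(r := tl (s r))) ?tps" using rel_update[OF Pop(2)] Pop(1) by simp
  moreover have "runs I (i, tps) 1 (i + csize (Pop r), ?tps)" using 1 by simp
  ultimately show ?case by blast
next
  case (Out b s)
  obtain c h where ch: "tps ! 5 = (c, h)" by fastforce
  have len: "length tps = 6" using Out by (simp add: rel_def)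
  note cd = code_at_Cons[OF Out(3)[unfolded compile.simps]]
  have st: "out_tape (s 5) (c, h)" using Out ch by (simp add: rel_def)
  let ?tp = "(c(h := bit_sym b), h + 1)"
  have 1: "runs I (i, tps) 1 (Suc i, tps[5 := ?tp])"
    using runs_step[OF len cd(1,2) _ refl] ch by simp
  have "out_tape (s 5 @ [b]) ?tp" using st by (auto simp: sym_at_def nth_append)
  then have "rel (s(5 := s 5 @ [b])) (tps[5 := ?tp])" using Out(2) by (auto simp: rel_def simp del: out_tape.simps)
  moreover have "runs I (i, tps) 1 (i + csize (Out b), tps[5 := ?tp])" using 1 by simp
  ultimately show ?case by blast
next
  case (Seq c1 s t1 s1 c2 t2 s2)
  have cd: "code_at I i (compile c1 i)" "code_at I (i + csize c1) (compile c2 (i + csize c1))"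
    using code_at_append Seq.prems(3) by fastforce+
  obtain tps1 where 1: "rel s1 tps1" "runs I (i, tps) t1 (i + csize c1, tps1)"
    using Seq.IH(1)[OF _ Seq.prems(2) cd(1)] Seq.prems(1) by auto
  obtain tps2 where "rel s2 tps2" "runs I (i + csize c1, tps1) t2 (i + csize c1 + csize c2, tps2)"
    using Seq.IH(2)[OF _ 1(1) cd(2)] Seq.prems(1) by auto
  then show ?case using runs_trans[OF 1(2)] by (auto simp: add.assoc)
next
  case (CondT s r A c1 t s1 c2)
  have len: "length tps = 6" using CondT by (simp add: rel_def)
  note cd = code_at_Cons[OF CondT.prems(3)[unfolded compile.simps]]
  note cd1 = code_at_append[OF cd(3)]
  note cd2 = code_at_Cons[OF conjunct2[OF cd1]]
  have 1: "runs I (i, tps) 1 (Suc i, tps)"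
    using runs_stay[OF len cd(1,2)] CondT rel_read[OF CondT.prems(2)] by simp
  obtain tps1 where 2: "rel s1 tps1" "runs I (Suc i, tps) t (Suc i + csize c1, tps1)"
    using CondT.IH[OF _ CondT.prems(2) conjunct1[OF cd1]] CondT.prems(1) by auto
  have "length tps1 = 6" using 2 by (simp add: rel_def)
  from runs_stay[OF this cd2(1,2)]
  have 3: "runs I (Suc i + csize c1, tps1) 1 (i + csize (Cond r A c1 c2), tps1)"
    by (simp add: add.assoc)
  show ?case using runs_trans[OF runs_trans[OF 1 2(2)] 3] 2(1) by auto
next
  case (CondF s r A c2 t s1 c1)
  have len: "length tps = 6" using CondF by (simp add: rel_def)
  note cd = code_at_Cons[OF CondF.prems(3)[unfolded compile.simps]]
  note cd1 = code_at_append[OF cd(3)]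
  note cd2 = code_at_Cons[OF conjunct2[OF cd1]]
  have 1: "runs I (i, tps) 1 (i + 2 + csize c1, tps)"
    using runs_stay[OF len cd(1,2)] CondF rel_read[OF CondF.prems(2)] by simp
  obtain tps1 where 2: "rel s1 tps1" "runs I (i + 2 + csize c1, tps) t (i + 2 + csize c1 + csize c2, tps1)"
    using CondF.IH[OF _ CondF.prems(2), of "i + 2 + csize c1"] cd2(3) CondF.prems(1) by auto
  show ?case using runs_trans[OF 1 2(2)] 2(1) by (auto simp: add.assoc)
next
  case (WhileF s r A c)
  have len: "length tps = 6" using WhileF by (simp add: rel_def)
  note cd = code_at_Cons[OF WhileF.prems(3)[unfolded compile.simps]]
  have 1: "runs I (i, tps) 1 (i + 2 + csize c, tps)"
    using runs_stay[OF len cd(1,2)] WhileF rel_read[OF WhileF.prems(2)] by simp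
  then show ?case using WhileF.prems(2) by (auto simp: add.assoc)
next
  case (WhileT s r A c t s1 u s2)
  have len: "length tps = 6" using WhileT by (simp add: rel_def)
  note cd = code_at_Cons[OF WhileT.prems(3)[unfolded compile.simps]]
  note cd1 = code_at_append[OF cd(3)]
  note cd2 = code_at_Cons[OF conjunct2[OF cd1]]
  have 1: "runs I (i, tps) 1 (Suc i, tps)"
    using runs_stay[OF len cd(1,2)] WhileT rel_read[OF WhileT.prems(2)] by simp
  obtain tps1 where 2: "rel s1 tps1" "runs I (Suc i, tps) t (Suc i + csize c, tps1)"
    using WhileT.IH(1)[OF _ WhileT.prems(2) conjunct1[OF cd1]] WhileT.prems(1) by auto
  have "length tps1 = 6" using 2 by (simp add: rel_def)
  from runs_stay[OF this cd2(1,2)]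
  have 3: "runs I (Suc i + csize c, tps1) 1 (i, tps1)" by simp
  obtain tps2 where 4: "rel s2 tps2" "runs I (i, tps1) u (i + csize (While r A c), tps2)"
    using WhileT.IH(2)[OF WhileT.prems(1) 2(1) WhileT.prems(3)] by auto
  show ?case using runs_trans[OF runs_trans[OF runs_trans[OF 1 2(2)] 3] 4(2)] 4(1) by auto
qed

lemma tm_halted: "q \<ge> num_states M \<Longrightarrow> (tm_step M ^^ t) (q, tps) = (q, tps)"
  by (induction t) auto

definition store0 :: "bool list \<Rightarrow> store" where
  "store0 xs = (\<lambda>r. if r = 0 then xs else [])"

lemma program_poly_time:
  assumes wf: "wfc c"
    and ex: "\<And>x. \<exists>t s'. t \<le> poly p (length x) \<and> exec c (store0 x) t s' \<and> s' 5 = f x"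
  shows "poly_time_computable f"
proof -
  \<comment> \<open>The trailing \<open>Pop 0\<close> gives even \<open>Skip\<close> a proper state,
    as \<open>wf_tm\<close> demands; its one step is the \<open>+ 1\<close> in the time bound
    below.\<close>
  define c' where "c' = (c ;; Pop 0)"
  define M where "M = tm_of (compile c' 0)"
  have wf': "wfc c'" "csize c' \<ge> 1" using wf by (auto simp: c'_def)
  have M: "num_states M = csize c'" "num_tapes M = 6" by (simp_all add: M_def tm_of_def)
  have "case (tm_step M ^^ poly (p + 1) (length x)) (init_config M x) of (q, tps) \<Rightarrow>
      q = num_states M \<and> tape_output (last tps) (f x)" for x
  proof -
    obtain t s' where t: "t \<le> poly p (length x)" "exec c (store0 x) t s'" "s' 5 = f x"
      using ex by blast
    define s'' where "s'' = s'(0 := tl (s' 0))"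
    have e: "exec c' (store0 x) (t + 1) s''"
      unfolding c'_def s''_def by (rule exec.Seq[OF t(2) exec.Pop])
    define tps where "tps = input_tape x # replicate 5 (\<lambda>_. 0, 0)"
    have "rel (store0 x) tps"
      by (auto simp: rel_def tps_def store0_def input_tape_def sym_at_def nth_Cons')
    moreover have "code_at (compile c' 0) 0 (compile c' 0)"
      by (auto simp: code_at_def)
    ultimately obtain tps' where r: "rel s'' tps'" "runs (compile c' 0) (0, tps) (t + 1) (csize c', tps')"
      using compile_correct[OF e wf'(1)] by fastforce
    have "init_config M x = (0, tps)" by (simp add: init_config_def M tps_def)
    moreover have "(tm_step M ^^ poly (p + 1) (length x)) (0, tps) = (csize c', tps')"
    proof -
      have "poly (p + 1) (length x) = (poly p (length x) - t) + (t + 1)" using t(1) by simp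
      then have "(tm_step M ^^ poly (p + 1) (length x)) (0, tps)
          = (tm_step M ^^ (poly p (length x) - t)) ((tm_step M ^^ (t + 1)) (0, tps))"
        by (simp only: funpow_add o_apply)
      also have "(tm_step M ^^ (t + 1)) (0, tps) = (csize c', tps')"
        using r(2) by (simp only: runs_def M_def)
      finally show ?thesis by (simp add: tm_halted M)
    qed
    moreover have "tape_output (last tps') (f x)"
    proof -
      have len: "length tps' = 6" using r(1) by (simp add: rel_def)
      then have "last tps' = tps' ! 5" by (subst last_conv_nth) auto
      moreover have "out_tape (f x) (tps' ! 5)" using r(1) t(3) by (simp add: rel_def s''_def)
      ultimately show ?thesis by (cases "tps' ! 5") (auto simp: tape_output_def sym_at_def)
    qed
    ultimately show ?thesis by (simp add: M)
  qed
  moreover have "wf_tm M" unfolding M_def using wf' by (rule wf_tm_of)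
  ultimately show ?thesis unfolding poly_time_computable_def by blast
qed

section \<open>Polynomial time on self-delimiting tree codes: sequencing, pairing, branching,
  loops\<close>

section \<open>Polynomial-time functions on binary trees\<close>

definition ex :: "com \<Rightarrow> store \<Rightarrow> nat \<Rightarrow> store \<Rightarrow> bool" where
  "ex c s T s' \<longleftrightarrow> (\<exists>t\<le>T. exec c s t s')"

lemma ex_weaken: "ex c s T1 s1 \<Longrightarrow> T1 \<le> T \<Longrightarrow> s1 = s2 \<Longrightarrow> ex c s T s2"
  unfolding ex_def by (meson order_trans)

lemma ex_Skip: "ex Skip s 0 s"
  and ex_Push: "ex (Push r b) s 2 (s(r := b # s r))"
  and ex_Pop: "ex (Pop r) s 1 (s(r := tl (s r)))"
  and ex_Out: "ex (Out b) s 1 (s(5 := s 5 @ [b]))"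
  unfolding ex_def by (blast intro: exec.intros order_refl)+

lemma ex_Seq: "ex c1 s T1 s1 \<Longrightarrow> ex c2 s1 T2 s2 \<Longrightarrow> ex (c1 ;; c2) s (T1 + T2) s2"
  unfolding ex_def by (meson add_mono exec.Seq)

lemma ex_CondT: "ex c1 s T s' \<Longrightarrow> top_sym (s r) \<in> A \<Longrightarrow> ex (Cond r A c1 c2) s (T + 2) s'"
  unfolding ex_def by (meson add_right_mono exec.CondT)

lemma ex_CondF: "ex c2 s T s' \<Longrightarrow> top_sym (s r) \<notin> A \<Longrightarrow> ex (Cond r A c1 c2) s (T + 1) s'"
  unfolding ex_def by (meson add_right_mono exec.CondF)

lemma ex_WhileF: "top_sym (s r) \<notin> A \<Longrightarrow> ex (While r A c) s 1 s"
  unfolding ex_def by (blast intro: exec.intros order_refl)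

lemma ex_WhileT:
  assumes "top_sym (s r) \<in> A" "ex c s T s1" "ex (While r A c) s1 U s2"
  shows "ex (While r A c) s (T + 2 + U) s2"
proof -
  obtain t u where "t \<le> T" "exec c s t s1" "u \<le> U" "exec (While r A c) s1 u s2"
    using assms unfolding ex_def by blast
  then show ?thesis unfolding ex_def using exec.WhileT[of s r A c t s1 u s2] assms(1)
    by (intro exI[of _ "t + 2 + u"]) auto
qed

text \<open>A step adds at most one symbol to a register, so every time bound is also a bound on the
  size of the result.\<close>

lemma exec_length: "exec c s t s' \<Longrightarrow> r \<noteq> 5 \<Longrightarrow> length (s' r) \<le> length (s r) + t"
  by (induction rule: exec.induct) auto

datatype tree = Lf | Nd tree tree

text \<open>Preorder code. It is prefix-free, so several trees can lie on one stack without
  separators.\<close>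

fun enc :: "tree \<Rightarrow> bool list" where
  "enc Lf = [False]"
| "enc (Nd a b) = True # enc a @ enc b"

abbreviation tsz :: "tree \<Rightarrow> nat" where
  "tsz t \<equiv> length (enc t)"

fun lf :: "tree \<Rightarrow> tree" where
  "lf Lf = Lf"
| "lf (Nd a b) = a"

fun rt :: "tree \<Rightarrow> tree" where
  "rt Lf = Lf"
| "rt (Nd a b) = b"

lemma poly_mono_nat: "x \<le> y \<Longrightarrow> poly p x \<le> poly (p :: nat poly) y"
  by (induction p) (auto intro: add_mono mult_mono)

definition st :: "bool list \<Rightarrow> bool list \<Rightarrow> bool list \<Rightarrow> bool list \<Rightarrow> store" where
  "st a b c d = (\<lambda>r. if r = 0 then a else if r = 1 then b else if r = 2 then c else if r = 3 then d else [])"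

lemma store0_st: "store0 a = st a [] [] []"
  by (auto simp: store0_def st_def)

lemma st_simps [simp]:
  "st a b c d 0 = a" "st a b c d (Suc 0) = b" "st a b c d 2 = c" "st a b c d 3 = d" "st a b c d 5 = []"
  "(st a b c d)(0 := x) = st x b c d" "(st a b c d)(Suc 0 := x) = st a x c d"
  "(st a b c d)(2 := x) = st a b x d" "(st a b c d)(3 := x) = st a b c x"
  by (auto simp: st_def)

subsection \<open>Stack manipulation\<close>

definition pushes :: "bool \<Rightarrow> bool \<Rightarrow> bool \<Rightarrow> com" where
  "pushes p1 p3 b = ((if p1 then Push 1 b else Skip) ;; (if p3 then Push 3 b else Skip))"

text \<open>
  Removes one tree from stack 0, copying its code in reverse to the stacks 1 and 3 as requested;
  stack 2 counts the subtrees that are still to be read.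
\<close>

definition parse_loop :: "bool \<Rightarrow> bool \<Rightarrow> com" where
  "parse_loop p1 p3 = While 2 {1, 2} (Cond 0 {2}
     (Pop 0 ;; pushes p1 p3 True ;; Push 2 True) (Pop 0 ;; pushes p1 p3 False ;; Pop 2))"

definition parse :: "bool \<Rightarrow> bool \<Rightarrow> com" where
  "parse p1 p3 = (Push 2 True ;; parse_loop p1 p3)"

definition add_to :: "bool \<Rightarrow> bool list \<Rightarrow> bool list \<Rightarrow> bool list" where
  "add_to p xs ys = (if p then xs @ ys else ys)"

lemma ex_pushes: "ex (pushes p1 p3 x) (st a b c d) 4 (st a (add_to p1 [x] b) c (add_to p3 [x] d))"
proof -
  have 1: "ex (if p1 then Push 1 x else Skip) (st a b c d) 2 (st a (add_to p1 [x] b) c d)" for b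
    using ex_Push[of 1 x "st a b c d"] ex_weaken[OF ex_Skip] by (auto simp: add_to_def)
  have 2: "ex (if p3 then Push 3 x else Skip) (st a b c d) 2 (st a b c (add_to p3 [x] d))" for b
    using ex_Push[of 3 x "st a b c d"] ex_weaken[OF ex_Skip] by (auto simp: add_to_def)
  show ?thesis unfolding pushes_def
    by (rule ex_weaken[OF ex_Seq[OF 1 2]]) simp_all
qed

lemma add_to_assoc: "add_to p xs (add_to p ys zs) = add_to p (xs @ ys) zs"
  by (simp add: add_to_def)

text \<open>Continuation style: a run from the point where \<open>x\<close> has been consumed is
  extended backwards to the point before \<open>x\<close>. The arbitrary counter \<open>c\<close>
  below the top mark is what lets the induction descend into subtrees.\<close>

lemma ex_parse_loop:
  "ex (parse_loop p1 p3) (st R (add_to p1 (rev (enc x)) b) c (add_to p3 (rev (enc x)) d)) T s' \<Longrightarrow>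
   ex (parse_loop p1 p3) (st (enc x @ R) b (True # c) d) (T + 12 * tsz x) s'"
proof (induction x arbitrary: R b c d T)
  case Lf
  have "ex (Cond 0 {2} (Pop 0 ;; pushes p1 p3 True ;; Push 2 True) (Pop 0 ;; pushes p1 p3 False ;; Pop 2))
      (st (enc Lf @ R) b (True # c) d) 7 (st R (add_to p1 (rev (enc Lf)) b) c (add_to p3 (rev (enc Lf)) d))"
    by (rule ex_weaken[OF ex_CondF[OF ex_Seq[OF ex_Pop]]], simp, rule ex_Seq[OF ex_pushes ex_Pop]) simp_all
  from ex_weaken[OF ex_WhileT[OF _ this Lf[unfolded parse_loop_def]]] show ?case
    unfolding parse_loop_def by simp
next
  case (Nd x y)
  let ?b = "add_to p1 [True] b" and ?d = "add_to p3 [True] d"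
  have c: "ex (Cond 0 {2} (Pop 0 ;; pushes p1 p3 True ;; Push 2 True) (Pop 0 ;; pushes p1 p3 False ;; Pop 2))
      (st (enc (Nd x y) @ R) b (True # c) d) 9 (st (enc x @ enc y @ R) ?b (True # True # c) ?d)"
    by (rule ex_weaken[OF ex_CondT[OF ex_Seq[OF ex_Pop]]], simp, rule ex_Seq[OF ex_pushes ex_Push]) simp_all
  \<comment> \<open>Reading the right subtree is the continuation that the induction hypothesis for
    the left subtree receives.\<close>
  have "ex (parse_loop p1 p3) (st (enc y @ R) (add_to p1 (rev (enc x)) ?b) (True # c) (add_to p3 (rev (enc x)) ?d))
      (T + 12 * tsz y) s'"
    by (rule Nd.IH(2)) (use Nd.prems in \<open>simp add: add_to_assoc\<close>)
  from Nd.IH(1)[OF this]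
  have "ex (parse_loop p1 p3) (st (enc x @ enc y @ R) ?b (True # True # c) ?d) (T + 12 * tsz y + 12 * tsz x) s'" .
  from ex_weaken[OF ex_WhileT[OF _ c this[unfolded parse_loop_def]]] show ?case
    unfolding parse_loop_def by simp
qed

lemma ex_parse:
  "ex (parse p1 p3) (st (enc x @ R) b [] d) (3 + 12 * tsz x)
     (st R (add_to p1 (rev (enc x)) b) [] (add_to p3 (rev (enc x)) d))"
proof -
  have "ex (parse_loop p1 p3) (st (enc x @ R) b [True] d) (1 + 12 * tsz x)
      (st R (add_to p1 (rev (enc x)) b) [] (add_to p3 (rev (enc x)) d))"
    by (rule ex_parse_loop) (simp add: parse_loop_def ex_WhileF[simplified])
  with ex_Push[of 2 True] show ?thesis unfolding parse_def
    by (intro ex_weaken[OF ex_Seq[OF ex_Push]]) auto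
qed

definition transfer :: "nat \<Rightarrow> nat \<Rightarrow> com" where
  "transfer a b = While a {1, 2} (Cond a {2} (Pop a ;; Push b True) (Pop a ;; Push b False))"

lemma ex_transfer:
  assumes "a \<noteq> b"
  shows "ex (transfer a b) s (7 * length (s a) + 1) (s(a := [], b := rev (s a) @ s b))"
proof (induction "s a" arbitrary: s)
  case Nil
  show ?case unfolding transfer_def
    by (rule ex_weaken[OF ex_WhileF]) (use Nil in \<open>auto simp: fun_eq_iff\<close>)
next
  case (Cons x xs)
  let ?s = "s(a := xs, b := x # s b)"
  have sa: "s a = x # xs" using Cons by simp
  have c: "ex (Cond a {2} (Pop a ;; Push b True) (Pop a ;; Push b False)) s 5 ?s"
  proof (cases x)
    case True
    then show ?thesis using assms sa
      by (intro ex_weaken[OF ex_CondT[OF ex_Seq[OF ex_Pop ex_Push]]]) auto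
  next
    case False
    then show ?thesis using assms sa
      by (intro ex_weaken[OF ex_CondF[OF ex_Seq[OF ex_Pop ex_Push]]]) auto
  qed
  have ih: "ex (transfer a b) ?s (7 * length xs + 1) (s(a := [], b := rev (s a) @ s b))"
    by (rule ex_weaken[OF Cons(1)]) (use assms sa in auto)
  have "top_sym (s a) \<in> {1, 2}" using sa by (cases x) auto
  from ex_WhileT[OF this c ih[unfolded transfer_def]] show ?case
    unfolding transfer_def by (rule ex_weaken) (simp_all add: sa)
qed

definition "drop_tree = parse False False"
text \<open>\<open>parse\<close> leaves codes reversed on the auxiliary stacks;
  \<open>transfer\<close> reverses them back onto stack 0.\<close>

definition "dup_tree = (parse True True ;; transfer 1 0 ;; transfer 3 0)"
definition "swap_tree = (parse True False ;; parse False True ;; transfer 1 0 ;; transfer 3 0)"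

lemma ex_drop: "ex drop_tree (store0 (enc x @ R)) (3 + 12 * tsz x) (store0 R)"
  using ex_parse[of False False x R "[]" "[]"] by (simp add: drop_tree_def store0_st add_to_def)

lemma ex_dup: "ex dup_tree (store0 (enc x @ R)) (5 + 26 * tsz x) (store0 (enc x @ enc x @ R))"
  unfolding dup_tree_def store0_st
  by (rule ex_weaken[OF ex_Seq[OF ex_parse ex_Seq[OF ex_transfer ex_transfer]]]) (simp_all add: add_to_def)

lemma ex_swap:
  "ex swap_tree (store0 (enc x @ enc y @ R)) (8 + 19 * (tsz x + tsz y)) (store0 (enc y @ enc x @ R))"
  unfolding swap_tree_def store0_st
  by (rule ex_weaken[OF ex_Seq[OF ex_parse ex_Seq[OF ex_parse ex_Seq[OF ex_transfer ex_transfer]]]])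
    (simp_all add: add_to_def)

lemma wfc_stack_ops [simp]: "wfc drop_tree" "wfc dup_tree" "wfc swap_tree"
  "wfc (transfer 0 1)" "wfc (transfer 1 0)"
  by (simp_all add: drop_tree_def dup_tree_def swap_tree_def parse_def parse_loop_def pushes_def transfer_def)

subsection \<open>Closure properties\<close>

class ptc =
  fixes tt :: "'a \<Rightarrow> tree"
  assumes tt_inject: "tt x = tt y \<longleftrightarrow> x = y"

abbreviation sz :: "'a::ptc \<Rightarrow> nat" where
  "sz x \<equiv> tsz (tt x)"

text \<open>The program replaces the top tree and leaves any \<open>R\<close> beneath it intact;
  this frame condition is what makes composition mere sequencing of programs.\<close>

definition PT :: "('a::ptc \<Rightarrow> 'b::ptc) \<Rightarrow> bool" where
  "PT f \<longleftrightarrow> (\<exists>c p. wfc c \<and>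
     (\<forall>x R. ex c (store0 (enc (tt x) @ R)) (poly p (sz x)) (store0 (enc (tt (f x)) @ R))))"

lemma PT_I:
  assumes "wfc c" "\<And>x R. ex c (store0 (enc (tt x) @ R)) (poly p (sz x)) (store0 (enc (tt (f x)) @ R))"
  shows "PT f"
  using assms unfolding PT_def by blast

lemma PT_E:
  assumes "PT f"
  obtains c p where "wfc c"
    "\<And>x R. ex c (store0 (enc (tt x) @ R)) (poly p (sz x)) (store0 (enc (tt (f x)) @ R))"
    "\<And>x. sz (f x) \<le> poly p (sz x)"
proof -
  obtain c p where c: "wfc c"
    "\<And>x R. ex c (store0 (enc (tt x) @ R)) (poly p (sz x)) (store0 (enc (tt (f x)) @ R))"
    using assms unfolding PT_def by blast
  let ?p = "[:0, 1:] + p"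
  have "sz (f x) \<le> poly ?p (sz x)" for x
  proof -
    obtain t where "t \<le> poly p (sz x)" "exec c (store0 (enc (tt x) @ [])) t (store0 (enc (tt (f x)) @ []))"
      using c(2) unfolding ex_def by blast
    with exec_length[OF this(2), of 0] show ?thesis by (simp add: store0_def)
  qed
  moreover have "ex c (store0 (enc (tt x) @ R)) (poly ?p (sz x)) (store0 (enc (tt (f x)) @ R))" for x R
    by (rule ex_weaken[OF c(2)]) auto
  ultimately show ?thesis using that[OF c(1)] by blast
qed

lemma PT_size:
  assumes "PT f"
  obtains p where "\<And>x. sz (f x) \<le> poly p (sz x)"
  by (rule PT_E[OF assms]) (rule that)

lemma PT_via_id: "(\<And>x. tt (f x) = tt x) \<Longrightarrow> PT f"
  by (rule PT_I[of Skip 0]) (auto intro: ex_Skip)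

lemma PT_via_Lf: "(\<And>x. tt (f x) = Lf) \<Longrightarrow> PT f"
  by (rule PT_I[of "drop_tree ;; Push 0 False" "[:5, 12:]"], simp,
      rule ex_weaken[OF ex_Seq[OF ex_drop ex_Push]]) (simp_all add: store0_st)

lemma PT_comp:
  assumes "PT f" "PT g"
  shows "PT (\<lambda>x. f (g x))"
proof -
  obtain c p where f: "wfc c" "\<And>x R. ex c (store0 (enc (tt x) @ R)) (poly p (sz x)) (store0 (enc (tt (f x)) @ R))"
    by (rule PT_E[OF assms(1)]) blast
  obtain d q where g: "wfc d" "\<And>x R. ex d (store0 (enc (tt x) @ R)) (poly q (sz x)) (store0 (enc (tt (g x)) @ R))"
    "\<And>x. sz (g x) \<le> poly q (sz x)"
    by (rule PT_E[OF assms(2)]) blast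
  show ?thesis
  proof (rule PT_I[of "d ;; c" "q + pcompose p q"])
    show "wfc (d ;; c)" using f(1) g(1) by simp
    show "ex (d ;; c) (store0 (enc (tt x) @ R)) (poly (q + pcompose p q) (sz x)) (store0 (enc (tt (f (g x))) @ R))"
      for x R
      by (rule ex_weaken[OF ex_Seq[OF g(2) f(2)]]) (simp_all add: poly_pcompose poly_mono_nat g(3))
  qed
qed

text \<open>\<open>g\<close> is applied to the first copy and swapped below the second one before
  \<open>f\<close> runs, because the code of the left subtree must end up on top; pushing
  \<open>True\<close> then joins the two codes.\<close>

lemma PT_via_Nd:
  assumes "PT f" "PT g" "\<And>x. tt (h x) = Nd (tt (f x)) (tt (g x))"
  shows "PT h"
proof -
  obtain c p where f: "wfc c" "\<And>x R. ex c (store0 (enc (tt x) @ R)) (poly p (sz x)) (store0 (enc (tt (f x)) @ R))"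
    by (rule PT_E[OF assms(1)]) blast
  obtain d q where g: "wfc d" "\<And>x R. ex d (store0 (enc (tt x) @ R)) (poly q (sz x)) (store0 (enc (tt (g x)) @ R))"
    "\<And>x. sz (g x) \<le> poly q (sz x)"
    by (rule PT_E[OF assms(2)]) blast
  have "ex (dup_tree ;; d ;; swap_tree ;; c ;; Push 0 True) (store0 (enc (tt x) @ R))
      (poly ([:15, 45:] + 20 * q + p) (sz x)) (store0 (enc (tt (h x)) @ R))" for x R
    by (rule ex_weaken[OF ex_Seq[OF ex_dup ex_Seq[OF g(2) ex_Seq[OF ex_swap ex_Seq[OF f(2) ex_Push]]]]])
      (use g(3)[of x] in \<open>simp_all add: store0_st assms(3)\<close>)
  then show ?thesis by (rule PT_I[rotated]) (simp add: f(1) g(1))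
qed

lemma PT_via_lf:
  assumes "\<And>x. tt (f x) = lf (tt x)"
  shows "PT f"
proof -
  have "ex (Cond 0 {2} (Pop 0 ;; swap_tree ;; drop_tree) Skip) (store0 (enc x @ R)) (poly [:14, 31:] (tsz x))
      (store0 (enc (lf x) @ R))" for x R
  proof (cases x)
    case Lf
    show ?thesis by (rule ex_weaken[OF ex_CondF[OF ex_Skip]]) (auto simp: Lf store0_st)
  next
    case (Nd a b)
    have *: "(store0 (enc x @ R))(0 := tl (store0 (enc x @ R) 0)) = store0 (enc a @ enc b @ R)"
      by (simp add: Nd store0_st)
    show ?thesis
      by (rule ex_weaken[OF ex_CondT[OF ex_Seq[OF ex_Pop[of 0, of "store0 (enc x @ R)", unfolded *] ex_Seq[OF ex_swap ex_drop]]]])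
        (auto simp: Nd store0_st)
  qed
  note * = this
  show ?thesis
    by (rule PT_I[of "Cond 0 {2} (Pop 0 ;; swap_tree ;; drop_tree) Skip" "[:14, 31:]"]) (use * assms in auto)
qed

lemma PT_via_rt:
  assumes "\<And>x. tt (f x) = rt (tt x)"
  shows "PT f"
proof -
  have "ex (Cond 0 {2} (Pop 0 ;; drop_tree) Skip) (store0 (enc x @ R)) (poly [:14, 31:] (tsz x))
      (store0 (enc (rt x) @ R))" for x R
  proof (cases x)
    case Lf
    show ?thesis by (rule ex_weaken[OF ex_CondF[OF ex_Skip]]) (auto simp: Lf store0_st)
  next
    case (Nd a b)
    have *: "(store0 (enc x @ R))(0 := tl (store0 (enc x @ R) 0)) = store0 (enc a @ enc b @ R)"
      by (simp add: Nd store0_st)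
    show ?thesis
      by (rule ex_weaken[OF ex_CondT[OF ex_Seq[OF ex_Pop[of 0, of "store0 (enc x @ R)", unfolded *] ex_drop]]])
        (auto simp: Nd store0_st)
  qed
  note * = this
  show ?thesis
    by (rule PT_I[of "Cond 0 {2} (Pop 0 ;; drop_tree) Skip" "[:14, 31:]"]) (use * assms in auto)
qed

lemma PT_via_if:
  assumes "PT b" "PT f" "PT g"
  shows "PT (\<lambda>x. if tt (b x) = Lf then g x else f x)"
proof -
  obtain e r where b: "wfc e" "\<And>x R. ex e (store0 (enc (tt x) @ R)) (poly r (sz x)) (store0 (enc (tt (b x)) @ R))"
    "\<And>x. sz (b x) \<le> poly r (sz x)"
    by (rule PT_E[OF assms(1)]) blast
  obtain c p where f: "wfc c" "\<And>x R. ex c (store0 (enc (tt x) @ R)) (poly p (sz x)) (store0 (enc (tt (f x)) @ R))"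
    by (rule PT_E[OF assms(2)]) blast
  obtain d q where g: "wfc d" "\<And>x R. ex d (store0 (enc (tt x) @ R)) (poly q (sz x)) (store0 (enc (tt (g x)) @ R))"
    by (rule PT_E[OF assms(3)]) blast
  have "ex (dup_tree ;; e ;; Cond 0 {2} (drop_tree ;; c) (drop_tree ;; d)) (store0 (enc (tt x) @ R))
      (poly ([:10, 26:] + 13 * r + p + q) (sz x))
      (store0 (enc (tt (if tt (b x) = Lf then g x else f x)) @ R))" for x R
  proof (cases "tt (b x)")
    case Lf
    show ?thesis
      by (rule ex_weaken[OF ex_Seq[OF ex_dup ex_Seq[OF b(2) ex_CondF[OF ex_Seq[OF ex_drop g(2)]]]]])
        (use b(3)[of x] in \<open>auto simp: Lf store0_st\<close>)
  next
    case (Nd u v)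
    show ?thesis
      by (rule ex_weaken[OF ex_Seq[OF ex_dup ex_Seq[OF b(2) ex_CondT[OF ex_Seq[OF ex_drop f(2)]]]]])
        (use b(3)[of x] in \<open>auto simp: Nd store0_st\<close>)
  qed
  then show ?thesis by (rule PT_I[rotated]) (simp add: b(1) f(1) g(1))
qed

instantiation prod :: (ptc, ptc) ptc
begin
definition tt_prod: "tt p = Nd (tt (fst p)) (tt (snd p))"
instance by standard (auto simp: tt_prod tt_inject prod_eq_iff)
end

instantiation list :: (ptc) ptc
begin
primrec tt_list :: "'a list \<Rightarrow> tree" where
  "tt_list [] = Lf"
| "tt_list (x # xs) = Nd (tt x) (tt_list xs)"
instance
proof
  show "tt xs = tt ys \<longleftrightarrow> xs = ys" for xs ys :: "'a list"
  proof (induction xs arbitrary: ys)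
    case Nil
    show ?case by (cases ys) auto
  next
    case (Cons x xs)
    then show ?case by (cases ys) (auto simp: tt_inject)
  qed
qed
end

lemma length_le_sz: "length xs \<le> sz xs"
  by (induction xs) auto

lemma PT_Pair_raw: "PT f \<Longrightarrow> PT g \<Longrightarrow> PT (\<lambda>x. (f x, g x))"
  by (rule PT_via_Nd) (auto simp: tt_prod)

lemma PT_fst_raw: "PT fst" and PT_snd_raw: "PT snd"
  by (rule PT_via_lf PT_via_rt, simp add: tt_prod)+

text \<open>
  The environment \<open>x\<close> is threaded through the accumulator, so that the loop body is a function of
  one element and one state.
\<close>

lemma PT_fold:
  fixes xs :: "'x::ptc \<Rightarrow> 'a::ptc list" and ini :: "'x \<Rightarrow> 'b::ptc"
  assumes "PT xs" "PT ini" "PT (\<lambda>p. g (fst p) (fst (snd p)) (snd (snd p)))"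
    and bd: "\<And>x ys zs. xs x = ys @ zs \<Longrightarrow> sz (fold (g x) ys (ini x)) \<le> poly q (sz x)"
  shows "PT (\<lambda>x. fold (g x) (xs x) (ini x))"
proof -
  \<comment> \<open>The argument has the shape of a list cell next to the pair of environment and
    accumulator, exactly the two trees lying on the stack during the loop.\<close>
  define F where "F = (\<lambda>z :: ('a \<times> 'a list) \<times> ('x \<times> 'b).
    (snd (fst z), (fst (snd z), g (fst (snd z)) (fst (fst z)) (snd (snd z)))))"
  note comps = PT_comp[OF PT_fst_raw PT_fst_raw] PT_comp[OF PT_snd_raw PT_fst_raw]
    PT_comp[OF PT_fst_raw PT_snd_raw] PT_comp[OF PT_snd_raw PT_snd_raw]
  have "PT F" unfolding F_def
    using PT_comp[OF assms(3) PT_Pair_raw[OF comps(3) PT_Pair_raw[OF comps(1,4)]]]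
    by (intro PT_Pair_raw comps) simp
  then obtain c p where F: "wfc c"
    "\<And>x R. ex c (store0 (enc (tt x) @ R)) (poly p (sz x)) (store0 (enc (tt (F x)) @ R))"
    by (rule PT_E) blast
  \<comment> \<open>A nonempty list starts with \<open>True\<close>, which is the loop test. Pushing
    \<open>True\<close> merges list and pair into one tree for \<open>c\<close>; popping the
    \<open>True\<close> of the result separates them again.\<close>
  define W where "W = While 0 {2} (Push 0 True ;; c ;; Pop 0)"
  \<comment> \<open>Since every prefix of the fold stays below \<open>B\<close>, one time bound for
    \<open>c\<close> is valid in all iterations.\<close>
  have loop: "ex W (store0 (enc (tt l) @ enc (tt (x, y)) @ R))
      (length l * (poly p (2 + A + sz x + B) + 5) + 1)
      (store0 (False # enc (tt (x, fold (g x) l y)) @ R))"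
    if "sz l \<le> A" "\<And>ys zs. l = ys @ zs \<Longrightarrow> sz (fold (g x) ys y) \<le> B" for l x y R A B
    using that
  proof (induction l arbitrary: y)
    case Nil
    show ?case unfolding W_def by (rule ex_weaken[OF ex_WhileF]) (simp_all add: store0_st)
  next
    case (Cons a l)
    have sy: "sz y \<le> B" using Cons.prems(2)[of "[]"] by simp
    have "poly p (sz ((a, l), (x, y))) \<le> poly p (2 + A + sz x + B)"
      by (rule poly_mono_nat) (use sy Cons.prems(1) in \<open>simp add: tt_prod\<close>)
    moreover have "ex (Push 0 True ;; c ;; Pop 0) (store0 (enc (tt (a # l)) @ enc (tt (x, y)) @ R))
        (3 + poly p (sz ((a, l), (x, y)))) (store0 (enc (tt l) @ enc (tt (x, g x a y)) @ R))"
    proof -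
      have *: "(store0 (enc (tt (a # l)) @ enc (tt (x, y)) @ R))
            (0 := True # store0 (enc (tt (a # l)) @ enc (tt (x, y)) @ R) 0)
          = store0 (enc (tt ((a, l), (x, y))) @ R)" by (simp add: store0_st tt_prod)
      show ?thesis
        by (rule ex_weaken[OF ex_Seq[OF ex_Push[of 0 True "store0 (enc (tt (a # l)) @ enc (tt (x, y)) @ R)", unfolded *]
            ex_Seq[OF F(2) ex_Pop]]])
          (simp_all add: store0_st F_def tt_prod)
    qed
    ultimately have 1: "ex (Push 0 True ;; c ;; Pop 0) (store0 (enc (tt (a # l)) @ enc (tt (x, y)) @ R))
        (3 + poly p (2 + A + sz x + B)) (store0 (enc (tt l) @ enc (tt (x, g x a y)) @ R))"
      by - (erule ex_weaken; simp)
    have 2: "ex W (store0 (enc (tt l) @ enc (tt (x, g x a y)) @ R))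
      (length l * (poly p (2 + A + sz x + B) + 5) + 1)
      (store0 (False # enc (tt (x, fold (g x) l (g x a y))) @ R))"
    proof (rule Cons.IH)
      show "sz l \<le> A" using Cons.prems(1) by simp
      show "sz (fold (g x) ys (g x a y)) \<le> B" if "l = ys @ zs" for ys zs
        using Cons.prems(2)[of "a # ys" zs] that by simp
    qed
    have "top_sym (store0 (enc (tt (a # l)) @ enc (tt (x, y)) @ R) 0) \<in> {2}" by (simp add: store0_st)
    from ex_WhileT[OF this 1 2[unfolded W_def]] show ?case
      unfolding W_def by (rule ex_weaken) simp_all
  qed
  define G where "G = (\<lambda>x. (xs x, (x, ini x)))"
  have "PT G" unfolding G_def by (intro PT_Pair_raw assms PT_via_id refl)
  then obtain d q' where G: "wfc d"
    "\<And>x R. ex d (store0 (enc (tt x) @ R)) (poly q' (sz x)) (store0 (enc (tt (G x)) @ R))"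
    "\<And>x. sz (G x) \<le> poly q' (sz x)"
    by (rule PT_E) blast
  obtain e r where S: "wfc e"
    "\<And>x R. ex e (store0 (enc (tt (x :: 'x \<times> 'b)) @ R)) (poly r (sz x)) (store0 (enc (tt (snd x)) @ R))"
    by (rule PT_E[OF PT_snd_raw]) blast
  define P where "P = q' + q' * (pcompose p (2 + q' + [:0, 1:] + q) + 5) + pcompose r (1 + [:0, 1:] + q) + 5"
  have "ex (d ;; Pop 0 ;; W ;; Pop 0 ;; e) (store0 (enc (tt x) @ R)) (poly P (sz x))
      (store0 (enc (tt (fold (g x) (xs x) (ini x))) @ R))" for x R
  proof -
    have l: "sz (xs x) \<le> poly q' (sz x)" using G(3)[of x] by (simp add: G_def tt_prod)
    have 1: "ex (Pop 0) (store0 (enc (tt (G x)) @ R)) 1 (store0 (enc (tt (xs x)) @ enc (tt (x, ini x)) @ R))"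
      by (rule ex_weaken[OF ex_Pop]) (simp_all add: G_def tt_prod store0_st)
    have "ex W (store0 (enc (tt (xs x)) @ enc (tt (x, ini x)) @ R))
      (length (xs x) * (poly p (2 + poly q' (sz x) + sz x + poly q (sz x)) + 5) + 1)
      (store0 (False # enc (tt (x, fold (g x) (xs x) (ini x))) @ R))"
      by (rule loop) (use bd[of x] l in auto)
    moreover have "length (xs x) * (poly p (2 + poly q' (sz x) + sz x + poly q (sz x)) + 5)
        \<le> poly q' (sz x) * (poly p (2 + poly q' (sz x) + sz x + poly q (sz x)) + 5)"
      using length_le_sz[of "xs x"] l by (intro mult_right_mono) auto
    ultimately have 2: "ex W (store0 (enc (tt (xs x)) @ enc (tt (x, ini x)) @ R))
      (poly q' (sz x) * (poly p (2 + poly q' (sz x) + sz x + poly q (sz x)) + 5) + 1)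
      (store0 (False # enc (tt (x, fold (g x) (xs x) (ini x))) @ R))"
      by - (erule ex_weaken; simp)
    have 3: "ex (Pop 0) (store0 (False # enc (tt (x, fold (g x) (xs x) (ini x))) @ R)) 1
      (store0 (enc (tt (x, fold (g x) (xs x) (ini x))) @ R))"
      by (rule ex_weaken[OF ex_Pop]) (simp_all add: store0_st)
    have "poly r (sz (x, fold (g x) (xs x) (ini x))) \<le> poly r (1 + sz x + poly q (sz x))"
      by (rule poly_mono_nat) (use bd[of x "xs x" "[]"] in \<open>simp add: tt_prod\<close>)
    then show ?thesis
      by (intro ex_weaken[OF ex_Seq[OF G(2) ex_Seq[OF 1 ex_Seq[OF 2 ex_Seq[OF 3 S(2)]]]]])
        (simp_all add: P_def poly_pcompose)
  qed
  then show ?thesis by (rule PT_I[rotated]) (simp add: W_def F(1) G(1) S(1))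
qed

subsection \<open>Bit strings as trees\<close>

instantiation bool :: ptc
begin
definition tt_bool: "tt b = (if b then Nd Lf Lf else Lf)"
instance by standard (auto simp: tt_bool)
end

lemma sz_bits: "sz (x :: bool list) \<le> 1 + 4 * length x"
  by (induction x) (auto simp: tt_bool)

text \<open>A list cell with entry \<open>False\<close> begins with the code
  \<open>True, False\<close>, one with entry \<open>True\<close> with
  \<open>True, True, False, False\<close>. Stack 1 holds the reversed input, so consing rebuilds the
  original order.\<close>

definition read_input :: com where
  "read_input = (transfer 0 1 ;; Push 0 False ;; While 1 {1, 2} (Cond 1 {2}
     (Pop 1 ;; Push 0 False ;; Push 0 False ;; Push 0 True ;; Push 0 True)
     (Pop 1 ;; Push 0 False ;; Push 0 True)))"

lemma ex_read_input:
  "ex read_input (store0 x) (4 + 20 * length x) (store0 (enc (tt x)))"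
proof -
  have "ex (While 1 {1, 2} (Cond 1 {2}
     (Pop 1 ;; Push 0 False ;; Push 0 False ;; Push 0 True ;; Push 0 True)
     (Pop 1 ;; Push 0 False ;; Push 0 True))) (st (enc (tt ys)) xs [] []) (1 + 13 * length xs)
     (st (enc (tt (rev xs @ ys))) [] [] [])" for xs ys
  proof (induction xs arbitrary: ys)
    case Nil
    show ?case by (rule ex_weaken[OF ex_WhileF]) auto
  next
    case (Cons b xs)
    have 1: "ex (Cond 1 {2}
     (Pop 1 ;; Push 0 False ;; Push 0 False ;; Push 0 True ;; Push 0 True)
     (Pop 1 ;; Push 0 False ;; Push 0 True)) (st (enc (tt ys)) (b # xs) [] []) 11
     (st (enc (tt (b # ys))) xs [] [])"
    proof (cases b)
      case True
      show ?thesis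
        by (rule ex_weaken[OF ex_CondT[OF ex_Seq[OF ex_Pop ex_Seq[OF ex_Push ex_Seq[OF ex_Push ex_Seq[OF ex_Push ex_Push]]]]]])
          (simp_all add: True tt_bool)
    next
      case False
      show ?thesis
        by (rule ex_weaken[OF ex_CondF[OF ex_Seq[OF ex_Pop ex_Seq[OF ex_Push ex_Push]]]])
          (simp_all add: False tt_bool)
    qed
    have "top_sym (st (enc (tt ys)) (b # xs) [] [] 1) \<in> {1, 2}" by (cases b) auto
    from ex_WhileT[OF this 1 Cons.IH] show ?case by (rule ex_weaken) simp_all
  qed
  from this[of "[]" "rev x"]
  have 1: "ex (While 1 {1, 2} (Cond 1 {2}
     (Pop 1 ;; Push 0 False ;; Push 0 False ;; Push 0 True ;; Push 0 True)
     (Pop 1 ;; Push 0 False ;; Push 0 True)))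
      ((store0 x)(0 := [], 1 := rev (store0 x 0) @ store0 x 1, 0 := [False])) (1 + 13 * length x)
      (store0 (enc (tt x)))"
    by (simp add: store0_st)
  have 2: "ex (Push 0 False) ((store0 x)(0 := [], 1 := rev (store0 x 0) @ store0 x 1)) 2
      ((store0 x)(0 := [], 1 := rev (store0 x 0) @ store0 x 1, 0 := [False]))"
    by (rule ex_weaken[OF ex_Push]) auto
  show ?thesis unfolding read_input_def
    by (rule ex_weaken[OF ex_Seq[OF ex_transfer ex_Seq[OF 2 1]]]) (simp_all add: store0_def)
qed

definition write_output :: com where
  "write_output = While 0 {2} (Pop 0 ;; Cond 0 {2} (Pop 0 ;; Pop 0 ;; Pop 0 ;; Out True) (Pop 0 ;; Out False))"

lemma ex_write_output:
  "s 0 = enc (tt y) \<Longrightarrow> ex write_output s (1 + 9 * length y) (s(0 := [False], 5 := s 5 @ y))"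
proof (induction y arbitrary: s)
  case Nil
  then have "s(0 := [False], 5 := s 5 @ []) = s" by auto
  then show ?case unfolding write_output_def using Nil
    by (intro ex_weaken[OF ex_WhileF]) auto
next
  case (Cons b y)
  let ?s = "s(0 := enc (tt y), 5 := s 5 @ [b])"
  have 1: "ex (Pop 0 ;; Cond 0 {2} (Pop 0 ;; Pop 0 ;; Pop 0 ;; Out True) (Pop 0 ;; Out False)) s 7 ?s"
  proof (cases b)
    case True
    show ?thesis
      by (rule ex_weaken[OF ex_Seq[OF ex_Pop ex_CondT[OF ex_Seq[OF ex_Pop ex_Seq[OF ex_Pop ex_Seq[OF ex_Pop ex_Out]]]]]])
        (use Cons.prems in \<open>auto simp: True tt_bool\<close>)
  next
    case False
    show ?thesis
      by (rule ex_weaken[OF ex_Seq[OF ex_Pop ex_CondF[OF ex_Seq[OF ex_Pop ex_Out]]]])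
        (use Cons.prems in \<open>auto simp: False tt_bool\<close>)
  qed
  have "top_sym (s 0) \<in> {2}" using Cons.prems by simp
  moreover have "ex write_output ?s (1 + 9 * length y) (s(0 := [False], 5 := s 5 @ b # y))"
    by (rule ex_weaken[OF Cons.IH]) auto
  from ex_WhileT[OF calculation(1) 1 this[unfolded write_output_def]] show ?case
    unfolding write_output_def by (rule ex_weaken) auto
qed

lemma PT_poly_time:
  assumes "PT h"
  shows "poly_time_computable h"
proof -
  obtain c p where f: "wfc c"
    "\<And>x R. ex c (store0 (enc (tt x) @ R)) (poly p (sz x)) (store0 (enc (tt (h x)) @ R))"
    "\<And>x. sz (h x) \<le> poly p (sz x)"
    by (rule PT_E[OF assms]) blast
  have main: "\<exists>t s'. t \<le> poly ([:5, 20:] + 10 * pcompose p [:1, 4:]) (length x) \<and>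
      exec (read_input ;; c ;; write_output) (store0 x) t s' \<and> s' 5 = h x" for x
  proof -
    let ?s = "store0 (enc (tt (h x)))"
    have 1: "ex c (store0 (enc (tt x))) (poly p (sz x)) ?s"
      using f(2)[of x "[]"] by simp
    note 2 = ex_Seq[OF ex_read_input ex_Seq[OF 1 ex_write_output[of ?s "h x"]]]
    have "poly p (sz x) \<le> poly p (1 + 4 * length x)"
      by (rule poly_mono_nat[OF sz_bits])
    moreover have "length (h x) \<le> poly p (sz x)"
      using length_le_sz f(3) by (rule order_trans)
    ultimately have "4 + 20 * length x + (poly p (sz x) + (1 + 9 * length (h x)))
        \<le> poly ([:5, 20:] + 10 * pcompose p [:1, 4:]) (length x)"
      by (simp add: poly_pcompose algebra_simps)
    from ex_weaken[OF 2 this refl] obtain t where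
      "t \<le> poly ([:5, 20:] + 10 * pcompose p [:1, 4:]) (length x)"
      "exec (read_input ;; c ;; write_output) (store0 x) t (?s(0 := [False], 5 := ?s 5 @ h x))"
      unfolding ex_def by (auto simp: store0_def)
    moreover have "(?s(0 := [False], 5 := ?s 5 @ h x)) 5 = h x"
      by (simp add: store0_def)
    ultimately show ?thesis by blast
  qed
  have wf: "wfc (read_input ;; c ;; write_output)"
    by (simp add: read_input_def write_output_def f transfer_def)
  show ?thesis by (rule program_poly_time[OF wf main])
qed

section \<open>Polynomial-time lists, equality tests, bounded iteration and unary arithmetic\<close>

section \<open>A library of polynomial-time functions\<close>

named_theorems pt

instantiation tree :: ptc
begin
definition tt_tree: "tt t = (t :: tree)"
instance by standard (auto simp: tt_tree)
end

text \<open>Numbers are coded in unary, so time is polynomial in their value. This suffices for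
  times, positions and vertex numbers; weights and potentials are handled as bit lists
  instead.\<close>

instantiation nat :: ptc
begin
primrec tt_nat :: "nat \<Rightarrow> tree" where
  "tt_nat 0 = Lf"
| "tt_nat (Suc n) = Nd Lf (tt_nat n)"
instance
proof
  show "tt m = tt n \<longleftrightarrow> m = n" for m n :: nat
  proof (induction m arbitrary: n)
    case 0
    show ?case by (cases n) auto
  next
    case (Suc m)
    then show ?case by (cases n) auto
  qed
qed
end

lemma sz_nat: "sz (n :: nat) = 2 * n + 1"
  by (induction n) auto

lemma sz_bool: "sz (b :: bool) = (if b then 3 else 1)"
  by (simp add: tt_bool)

lemma sz_prod: "sz p = 1 + sz (fst p) + sz (snd p)"
  by (simp add: tt_prod)

lemma sz_append: "sz (xs @ ys) + 1 = sz xs + sz ys"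
  by (induction xs) auto

lemma sz_append_le: "sz (xs @ ys) \<le> sz xs + sz ys"
  using sz_append[of xs ys] by linarith

lemma sz_member: "x \<in> set xs \<Longrightarrow> sz x < sz xs"
  by (induction xs) auto

lemma sz_list_bound: "(\<And>x. x \<in> set xs \<Longrightarrow> sz x \<le> B) \<Longrightarrow> sz xs \<le> 1 + length xs * (1 + B)"
proof (induction xs)
  case (Cons x xs)
  have "sz x \<le> B" "sz xs \<le> 1 + length xs * (1 + B)" using Cons by auto
  then show ?case by simp
qed simp

text \<open>Only the trees of the values matter. Results may therefore change their type for free,
  for instance from a list of leaves to a number.\<close>

lemma PT_recode: "PT f \<Longrightarrow> (\<And>x. tt (h x) = tt (f x)) \<Longrightarrow> PT h"
  unfolding PT_def by simp

lemma PT_id [pt]: "PT (\<lambda>x. x)"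
  by (rule PT_via_id) simp

lemma PT_const [pt]: "PT (\<lambda>x. c)"
proof -
  have "PT (\<lambda>x. t)" for t :: tree
  proof (induction t)
    case Lf
    show ?case by (rule PT_via_Lf) (simp add: tt_tree)
  next
    case (Nd a b)
    show ?case by (rule PT_via_Nd[OF Nd]) (simp add: tt_tree)
  qed
  then show ?thesis by (rule PT_recode[of "\<lambda>x. tt c"]) (simp add: tt_tree)
qed

lemma PT_Pair [pt]: "PT f \<Longrightarrow> PT g \<Longrightarrow> PT (\<lambda>x. (f x, g x))"
  by (rule PT_Pair_raw)

lemma PT_fst [pt]: "PT f \<Longrightarrow> PT (\<lambda>x. fst (f x))"
  by (rule PT_comp[OF PT_fst_raw])

lemma PT_snd [pt]: "PT f \<Longrightarrow> PT (\<lambda>x. snd (f x))"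
  by (rule PT_comp[OF PT_snd_raw])

lemma PT_lift2:
  assumes "PT (\<lambda>p. h (fst p) (snd p))" "PT f" "PT g"
  shows "PT (\<lambda>x. h (f x) (g x))"
  using PT_comp[OF assms(1) PT_Pair[OF assms(2,3)]] by simp

lemma PT_Cons [pt]: "PT f \<Longrightarrow> PT g \<Longrightarrow> PT (\<lambda>x. f x # g x)"
  by (rule PT_via_Nd) auto

lemma PT_tl [pt]: "PT f \<Longrightarrow> PT (\<lambda>x. tl (f x))"
proof (rule PT_comp[of tl])
  show "PT (tl :: 'b list \<Rightarrow> 'b list)"
  proof (rule PT_via_rt)
    show "tt (tl xs) = rt (tt xs)" for xs :: "'b list" by (cases xs) auto
  qed
qed

lemma PT_Suc [pt]: "PT f \<Longrightarrow> PT (\<lambda>x. Suc (f x))"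
  by (rule PT_via_Nd[OF PT_const[of Lf]]) (auto simp: tt_tree)

lemma PT_pred [pt]: "PT f \<Longrightarrow> PT (\<lambda>x. f x - Suc 0)"
proof (rule PT_comp[of "\<lambda>n. n - Suc 0"])
  show "PT (\<lambda>n. n - Suc 0)"
  proof (rule PT_via_rt)
    show "tt (n - Suc 0) = rt (tt n)" for n by (cases n) auto
  qed
qed

lemma PT_if [pt]:
  assumes "PT b" "PT f" "PT g"
  shows "PT (\<lambda>x. if b x then f x else g x)"
proof -
  have "(\<lambda>x. if tt (b x) = Lf then g x else f x) = (\<lambda>x. if b x then f x else g x)"
    by (auto simp: tt_bool)
  then show ?thesis using PT_via_if[OF assms] by simp
qed

lemma PT_Not [pt]: "PT b \<Longrightarrow> PT (\<lambda>x. \<not> b x)"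
  by (rule PT_recode[OF PT_if[of b "\<lambda>_. False" "\<lambda>_. True", OF _ PT_const PT_const]]) auto

lemma PT_conj [pt]: "PT b \<Longrightarrow> PT c \<Longrightarrow> PT (\<lambda>x. b x \<and> c x)"
  by (rule PT_recode[OF PT_if[of b c "\<lambda>_. False", OF _ _ PT_const]]) auto

lemma PT_disj [pt]: "PT b \<Longrightarrow> PT c \<Longrightarrow> PT (\<lambda>x. b x \<or> c x)"
  by (rule PT_recode[OF PT_if[of b "\<lambda>_. True" c, OF _ PT_const]]) auto

lemma PT_imp [pt]: "PT b \<Longrightarrow> PT c \<Longrightarrow> PT (\<lambda>x. b x \<longrightarrow> c x)"
  by (rule PT_recode[OF PT_if[of b c "\<lambda>_. True", OF _ _ PT_const]]) auto

text \<open>A head function with an explicit default, since the value of \<open>hd []\<close> is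
  unspecified and could not be computed.\<close>

definition hdd :: "'a \<Rightarrow> 'a list \<Rightarrow> 'a" where
  "hdd d xs = (case xs of [] \<Rightarrow> d | x # _ \<Rightarrow> x)"

lemma hdd_simps [simp]: "hdd d [] = d" "hdd d (x # xs) = x"
  by (simp_all add: hdd_def)

lemma PT_hdd [pt]:
  assumes "PT d" "PT f"
  shows "PT (\<lambda>x. hdd (d x) (f x))"
proof -
  have 1: "PT (\<lambda>x. lf (tt (f x)))"
    by (rule PT_comp[of "\<lambda>xs. lf (tt xs)", OF _ assms(2)], rule PT_via_lf) (simp add: tt_tree)
  have 2: "PT (\<lambda>x. tt (d x))"
    by (rule PT_recode[OF assms(1)]) (simp add: tt_tree)
  show ?thesis
  proof (rule PT_recode[OF PT_via_if[OF assms(2) 1 2]])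
    show "tt (hdd (d x) (f x)) = tt (if tt (f x) = Lf then tt (d x) else lf (tt (f x)))" for x
      by (cases "f x") (auto simp: tt_tree)
  qed
qed

subsection \<open>Equality\<close>

text \<open>The loop lasts as long as stack 1. If stack 3 runs out earlier, its blank top counts as
  a mismatch.\<close>

definition mismatches :: com where
  "mismatches = While 1 {1, 2} ((Cond 1 {2} (Cond 3 {2} Skip (Push 2 True)) (Cond 3 {1} Skip (Push 2 True))) ;;
     Pop 1 ;; Pop 3)"

lemma ex_mismatches:
  "\<exists>n. ex mismatches (st R xs (replicate m True) ys) (1 + 10 * length xs)
        (st R [] (replicate (m + n) True) (drop (length xs) ys)) \<and>
      (n = 0 \<longleftrightarrow> xs = take (length xs) ys) \<and> n \<le> length xs"
proof (induction xs arbitrary: m ys)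
  case Nil
  show ?case unfolding mismatches_def
    by (rule exI[of _ 0]) (auto intro: ex_weaken[OF ex_WhileF])
next
  case (Cons x xs)
  define d :: nat where "d = (if ys \<noteq> [] \<and> hd ys = x then 0 else 1)"
  obtain n where n: "ex mismatches (st R xs (replicate (m + d) True) (tl ys)) (1 + 10 * length xs)
        (st R [] (replicate (m + d + n) True) (drop (length xs) (tl ys)))"
      "n = 0 \<longleftrightarrow> xs = take (length xs) (tl ys)" "n \<le> length xs"
    using Cons.IH[of "m + d" "tl ys"] by blast
  let ?s = "st R (x # xs) (replicate m True) ys"
  let ?s1 = "st R (x # xs) (replicate (m + d) True) ys"
  have push: "ex (Push 2 True) ?s 2 ?s1" if "d = 1"
    by (rule ex_weaken[OF ex_Push]) (auto simp: that)
  have skip: "ex Skip ?s 2 ?s1" if "d = 0"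
    by (rule ex_weaken[OF ex_Skip]) (auto simp: that)
  have d01: "d = 0 \<or> d = 1" by (simp add: d_def)
  have dT: "top_sym ys = 2 \<longleftrightarrow> d = 0" if x
    using that by (cases ys; cases "hd ys") (auto simp: d_def)
  have dF: "top_sym ys = 1 \<longleftrightarrow> d = 0" if "\<not> x"
    using that by (cases ys; cases "hd ys") (auto simp: d_def)
  have 1: "ex (Cond 1 {2} (Cond 3 {2} Skip (Push 2 True)) (Cond 3 {1} Skip (Push 2 True))) ?s 6 ?s1"
  proof (cases x)
    case True
    have "ex (Cond 3 {2} Skip (Push 2 True)) ?s 4 ?s1"
    proof (cases "d = 0")
      case d0: True
      have "top_sym (?s 3) \<in> {2}" using dT[OF True] d0 by simp
      from ex_CondT[OF skip[OF d0] this] show ?thesis by (rule ex_weaken) simp_all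
    next
      case d1: False
      have t3: "top_sym (?s 3) \<notin> {2}" using dT[OF True] d1 by simp
      have "d = 1" using d01 d1 by simp
      from ex_CondF[OF push[OF this] t3] show ?thesis by (rule ex_weaken) simp_all
    qed
    moreover have "top_sym (?s 1) \<in> {2}" using True by simp
    ultimately show ?thesis by (rule ex_weaken[OF ex_CondT]) simp_all
  next
    case False
    have "ex (Cond 3 {1} Skip (Push 2 True)) ?s 4 ?s1"
    proof (cases "d = 0")
      case d0: True
      have "top_sym (?s 3) \<in> {1}" using dF[OF False] d0 by simp
      from ex_CondT[OF skip[OF d0] this] show ?thesis by (rule ex_weaken) simp_all
    next
      case d1: False
      have t3: "top_sym (?s 3) \<notin> {1}" using dF[OF False] d1 by simp
      have "d = 1" using d01 d1 by simp
      from ex_CondF[OF push[OF this] t3] show ?thesis by (rule ex_weaken) simp_all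
    qed
    moreover have "top_sym (?s 1) \<notin> {2}" using False by simp
    ultimately show ?thesis by (rule ex_weaken[OF ex_CondF]) simp_all
  qed
  have 2: "ex (Pop 1 ;; Pop 3) ?s1 2 (st R xs (replicate (m + d) True) (tl ys))"
    by (rule ex_weaken[OF ex_Seq[OF ex_Pop ex_Pop]]) auto
  have t: "top_sym (?s 1) \<in> {1, 2}" by (cases x) auto
  have 3: "ex ((Cond 1 {2} (Cond 3 {2} Skip (Push 2 True)) (Cond 3 {1} Skip (Push 2 True))) ;; Pop 1 ;; Pop 3)
      ?s (6 + 2) (st R xs (replicate (m + d) True) (tl ys))"
    by (rule ex_Seq[OF 1 2])
  have "ex mismatches ?s (10 + (1 + 10 * length xs))
      (st R [] (replicate (m + d + n) True) (drop (length xs) (tl ys)))"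
    unfolding mismatches_def
    by (rule ex_weaken[OF ex_WhileT[OF t 3 n(1)[unfolded mismatches_def]]]) simp_all
  moreover have "d + n = 0 \<longleftrightarrow> x # xs = take (length (x # xs)) ys"
    using n(2) by (cases ys) (auto simp: d_def)
  moreover have "drop (length xs) (tl ys) = drop (length (x # xs)) ys" by (cases ys) auto
  moreover have "d + n \<le> length (x # xs)" using n(3) by (simp add: d_def)
  ultimately show ?case by (intro exI[of _ "d + n"]) (simp add: add.assoc)
qed

text \<open>Symbols remaining on stack 3 show that the second code is longer; each becomes one more
  mark.\<close>

lemma ex_mark:
  "ex (While 3 {1, 2} (Push 2 True ;; Pop 3)) (st R [] (replicate m True) ys) (1 + 5 * length ys)
     (st R [] (replicate (m + length ys) True) [])"
proof (induction ys arbitrary: m)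
  case Nil
  show ?case by (rule ex_weaken[OF ex_WhileF]) auto
next
  case (Cons y ys)
  have 1: "ex (Push 2 True ;; Pop 3) (st R [] (replicate m True) (y # ys)) 3 (st R [] (replicate (Suc m) True) ys)"
    by (rule ex_weaken[OF ex_Seq[OF ex_Push ex_Pop]]) auto
  have t: "top_sym (st R [] (replicate m True) (y # ys) 3) \<in> {1, 2}" by (cases y) auto
  show ?case by (rule ex_weaken[OF ex_WhileT[OF t 1 Cons.IH]]) auto
qed

lemma ex_unmark: "ex (While 2 {2} (Pop 2)) (st R [] (replicate m True) []) (1 + 3 * m) (st R [] [] [])"
proof (induction m)
  case 0
  show ?case by (rule ex_weaken[OF ex_WhileF]) auto
next
  case (Suc m)
  have t: "top_sym (st R [] (replicate (Suc m) True) [] 2) \<in> {2}" by auto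
  have 1: "ex (Pop 2) (st R [] (replicate (Suc m) True) []) 1 (st R [] (replicate m True) [])"
    by (rule ex_weaken[OF ex_Pop]) auto
  show ?case by (rule ex_weaken[OF ex_WhileT[OF t 1 Suc.IH]]) auto
qed

text \<open>Trees are compared by their codes; stack 2 holds one mark for every mismatch.\<close>

lemma PT_eq_raw: "PT (\<lambda>p. fst p = snd p)"
proof (rule PT_I)
  let ?c = "Pop 0 ;; parse True False ;; parse False True ;; mismatches ;;
    While 3 {1, 2} (Push 2 True ;; Pop 3) ;;
    Cond 2 {2} (While 2 {2} (Pop 2) ;; Push 0 False) (Push 0 False ;; Push 0 False ;; Push 0 True)"
  show "wfc ?c" by (simp add: parse_def parse_loop_def pushes_def mismatches_def)
  fix p :: "'a \<times> 'a" and R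
  let ?x = "enc (tt (fst p))" and ?y = "enc (tt (snd p))"
  have 0: "ex (Pop 0) (store0 (enc (tt p) @ R)) 1 (st (?x @ ?y @ R) [] [] [])"
    by (rule ex_weaken[OF ex_Pop]) (auto simp: store0_st tt_prod)
  have 1: "ex (parse True False) (st (?x @ ?y @ R) [] [] []) (3 + 12 * length ?x) (st (?y @ R) (rev ?x) [] [])"
    by (rule ex_weaken[OF ex_parse]) (auto simp: add_to_def)
  have 2: "ex (parse False True) (st (?y @ R) (rev ?x) [] []) (3 + 12 * length ?y) (st R (rev ?x) [] (rev ?y))"
    by (rule ex_weaken[OF ex_parse]) (auto simp: add_to_def)
  obtain n where n: "ex mismatches (st R (rev ?x) [] (rev ?y)) (1 + 10 * length ?x)
        (st R [] (replicate n True) (drop (length ?x) (rev ?y)))"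
      "n = 0 \<longleftrightarrow> rev ?x = take (length ?x) (rev ?y)" "n \<le> length ?x"
    using ex_mismatches[of R "rev ?x" 0 "rev ?y"] by auto
  define k where "k = n + length (drop (length ?x) (rev ?y))"
  note 4 = ex_mark[of R n "drop (length ?x) (rev ?y)", folded k_def]
  have enc_inj: "enc a = enc b \<longleftrightarrow> a = b" for a b
  proof -
    have "enc a @ r = enc b @ r' \<longleftrightarrow> a = b \<and> r = r'" for r r'
    proof (induction a arbitrary: b r r')
      case Lf
      show ?case by (cases b) auto
    next
      case (Nd a1 a2)
      then show ?case by (cases b) auto
    qed
    from this[of "[]" "[]"] show ?thesis by simp
  qed
  have k0: "k = 0 \<longleftrightarrow> fst p = snd p"
  proof
    assume "k = 0"
    then have "rev ?x = take (length ?x) (rev ?y)" "length (rev ?y) \<le> length ?x"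
      using n(2) by (auto simp: k_def)
    then have "rev ?x = rev ?y" by simp
    then show "fst p = snd p" by (simp add: enc_inj tt_inject)
  next
    assume "fst p = snd p"
    then show "k = 0" using n(2) by (simp add: k_def)
  qed
  have k_le: "k \<le> length ?x + length ?y" using n(3) by (simp add: k_def)
  have 5: "ex (Cond 2 {2} (While 2 {2} (Pop 2) ;; Push 0 False) (Push 0 False ;; Push 0 False ;; Push 0 True))
      (st R [] (replicate k True) []) (8 + 3 * k) (store0 (enc (tt (fst p = snd p)) @ R))"
  proof (cases "k = 0")
    case True
    then show ?thesis using k0
      by (intro ex_weaken[OF ex_CondF[OF ex_Seq[OF ex_Push ex_Seq[OF ex_Push ex_Push]]]])
        (auto simp: store0_st tt_bool)
  next
    case False
    then have "top_sym (st R [] (replicate k True) [] 2) \<in> {2}" by (cases k) auto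
    with False show ?thesis using k0
      by (intro ex_weaken[OF ex_CondT[OF ex_Seq[OF ex_unmark ex_Push]]])
        (auto simp: store0_st tt_bool)
  qed
  show "ex ?c (store0 (enc (tt p) @ R)) (poly [:100, 100:] (sz p)) (store0 (enc (tt (fst p = snd p)) @ R))"
    by (rule ex_weaken[OF ex_Seq[OF 0 ex_Seq[OF 1 ex_Seq[OF 2 ex_Seq[OF n(1) ex_Seq[OF 4 5]]]]]])
      (use k_le in \<open>simp_all add: tt_prod\<close>)
qed

lemma PT_eq [pt]: "PT f \<Longrightarrow> PT g \<Longrightarrow> PT (\<lambda>x. f x = g x)"
  by (rule PT_lift2[OF PT_eq_raw])

subsection \<open>Loops\<close>

text \<open>Additive growth per step, summed over polynomially many steps, stays polynomial. The
  measure \<open>m\<close> may differ from \<open>sz\<close>: changing bits of a list alters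
  \<open>sz\<close>, because \<open>True\<close> has a larger tree than \<open>False\<close>, but it
  does not alter the length.\<close>

lemma PT_fold_measure:
  fixes xs :: "'x::ptc \<Rightarrow> 'a::ptc list" and ini :: "'x \<Rightarrow> 'b::ptc"
  assumes "PT xs" "PT ini" "PT (\<lambda>p. g (fst p) (fst (snd p)) (snd (snd p)))"
    and m: "\<And>y. m y \<le> sz y" "\<And>y. sz y \<le> poly K (m y)"
    and step: "\<And>x a y. a \<in> set (xs x) \<Longrightarrow> m (g x a y) \<le> m y + poly P (sz x + sz a)"
  shows "PT (\<lambda>x. fold (g x) (xs x) (ini x))"
proof -
  obtain p where p: "\<And>x. sz (xs x) \<le> poly p (sz x)" by (rule PT_size[OF assms(1)]) blast
  obtain q where q: "\<And>x. sz (ini x) \<le> poly q (sz x)" by (rule PT_size[OF assms(2)]) blast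
  define B where "B = q + p * pcompose P ([:0, 1:] + p)"
  have *: "m (fold (g x) ys y) \<le> m y + length ys * poly P (sz x + poly p (sz x))"
    if "set ys \<subseteq> set (xs x)" for x y ys
    using that
  proof (induction ys arbitrary: y)
    case (Cons a ys)
    have "poly P (sz x + sz a) \<le> poly P (sz x + poly p (sz x))"
      using sz_member[of a "xs x"] Cons.prems p[of x] by (intro poly_mono_nat) auto
    then have "m (g x a y) \<le> m y + poly P (sz x + poly p (sz x))"
      using step[of a x y] Cons.prems by auto
    with Cons.IH[of "g x a y"] Cons.prems show ?case by auto
  qed simp
  show ?thesis
  proof (rule PT_fold[OF assms(1-3)])
    fix x ys zs
    assume xs: "xs x = ys @ zs"
    have "length ys \<le> poly p (sz x)" using length_le_sz[of "xs x"] p[of x] xs by simp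
    then have "length ys * poly P (sz x + poly p (sz x)) \<le> poly p (sz x) * poly P (sz x + poly p (sz x))"
      by (rule mult_right_mono) simp
    moreover have "m (fold (g x) ys (ini x)) \<le> m (ini x) + length ys * poly P (sz x + poly p (sz x))"
      using *[of ys x "ini x"] xs by simp
    moreover have "poly B (sz x) = poly q (sz x) + poly p (sz x) * poly P (sz x + poly p (sz x))"
      by (simp add: B_def poly_pcompose)
    ultimately have "m (fold (g x) ys (ini x)) \<le> poly B (sz x)"
      using q[of x] m(1)[of "ini x"] by linarith
    then have "poly K (m (fold (g x) ys (ini x))) \<le> poly (pcompose K B) (sz x)"
      by (simp add: poly_pcompose poly_mono_nat)
    then show "sz (fold (g x) ys (ini x)) \<le> poly (pcompose K B) (sz x)"
      using m(2) order_trans by blast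
  qed
qed

lemma PT_fold_inc:
  assumes "PT xs" "PT ini" "PT (\<lambda>p. g (fst p) (fst (snd p)) (snd (snd p)))"
    and "\<And>x a y. a \<in> set (xs x) \<Longrightarrow> sz (g x a y) \<le> sz y + poly P (sz x + sz a)"
  shows "PT (\<lambda>x. fold (g x) (xs x) (ini x))"
  by (rule PT_fold_measure[where m = sz and K = "[:0, 1:]" and P = P]) (auto intro: assms)

lemma PT_rev [pt]: "PT f \<Longrightarrow> PT (\<lambda>x. rev (f x))"
proof -
  assume f: "PT f"
  have "PT (\<lambda>x. fold (\<lambda>a y. a # y) (f x) [])"
    by (rule PT_fold_inc[where P = "[:1, 1:]"], intro f, intro pt, intro pt, auto)
  then show ?thesis by (simp add: fold_Cons_rev)
qed

lemma PT_append [pt]: "PT f \<Longrightarrow> PT g \<Longrightarrow> PT (\<lambda>x. f x @ g x)"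
proof -
  assume f: "PT f" and g: "PT g"
  have "PT (\<lambda>x. fold (\<lambda>a y. a # y) (rev (f x)) (g x))"
    by (rule PT_fold_inc[where P = "[:1, 1:]"], intro pt f, intro g, intro pt, auto)
  then show ?thesis by (simp add: fold_Cons_rev)
qed

lemma PT_map [pt]:
  assumes "PT (\<lambda>p. h (fst p) (snd p))" "PT f"
  shows "PT (\<lambda>x. map (h x) (f x))"
proof -
  obtain p where p: "\<And>x. sz (h (fst x) (snd x)) \<le> poly p (sz x)" by (rule PT_size[OF assms(1)]) blast
  have h: "PT (\<lambda>p. h (fst p) (fst (snd p)))"
    using PT_comp[OF assms(1) PT_Pair[OF PT_fst[OF PT_id] PT_fst[OF PT_snd[OF PT_id]]]] by simp
  have "PT (\<lambda>x. fold (\<lambda>a y. h x a # y) (f x) [])"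
  proof (rule PT_fold_inc[where P = "1 + pcompose p [:1, 1:]"])
    fix x a and y :: "'c list"
    show "sz (h x a # y) \<le> sz y + poly (1 + pcompose p [:1, 1:]) (sz x + sz a)"
      using p[of "(x, a)"] by (simp add: poly_pcompose sz_prod)
  qed (intro pt h assms)+
  from PT_rev[OF this]
  show ?thesis
  proof (rule PT_recode)
    have "fold (\<lambda>a y. h x a # y) ys zs = rev (map (h x) ys) @ zs" for x ys zs
      by (induction ys arbitrary: zs) auto
    then show "tt (map (h x) (f x)) = tt (rev (fold (\<lambda>a y. h x a # y) (f x) []))" for x by simp
  qed
qed

lemma PT_filter [pt]:
  assumes "PT (\<lambda>p. h (fst p) (snd p))" "PT f"
  shows "PT (\<lambda>x. filter (h x) (f x))"
proof -
  have h: "PT (\<lambda>p. h (fst p) (fst (snd p)))"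
    using PT_comp[OF assms(1) PT_Pair[OF PT_fst[OF PT_id] PT_fst[OF PT_snd[OF PT_id]]]] by simp
  have "PT (\<lambda>x. fold (\<lambda>a y. if h x a then a # y else y) (f x) [])"
    by (rule PT_fold_inc[where P = "[:1, 1:]"], intro assms, intro pt, intro pt h, auto)
  from PT_rev[OF this]
  show ?thesis
  proof (rule PT_recode)
    have "fold (\<lambda>a y. if h x a then a # y else y) ys zs = rev (filter (h x) ys) @ zs" for x ys zs
      by (induction ys arbitrary: zs) auto
    then show "tt (filter (h x) (f x)) = tt (rev (fold (\<lambda>a y. if h x a then a # y else y) (f x) []))" for x by simp
  qed
qed

lemma PT_concat [pt]: "PT f \<Longrightarrow> PT (\<lambda>x. concat (f x))"
proof -
  assume f: "PT f"
  have "PT (\<lambda>x. fold (\<lambda>a y. y @ a) (f x) [])"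
    by (rule PT_fold_inc[where P = "[:0, 1:]"], intro f, intro pt, intro pt)
      (use sz_append_le in \<open>fastforce intro: order_trans\<close>)
  then show ?thesis
  proof (rule PT_recode)
    have "fold (\<lambda>a y. y @ a) ys zs = zs @ concat ys" for ys and zs :: "'b list"
      by (induction ys arbitrary: zs) auto
    then show "tt (concat (f x)) = tt (fold (\<lambda>a y. y @ a) (f x) [])" for x by simp
  qed
qed

lemma PT_Ball [pt]:
  assumes "PT (\<lambda>p. h (fst p) (snd p))" "PT f"
  shows "PT (\<lambda>x. \<forall>a\<in>set (f x). h x a)"
proof -
  have "PT (\<lambda>x. filter (\<lambda>a. \<not> h x a) (f x) = [])" by (intro pt assms)
  then show ?thesis by (rule PT_recode) (auto simp: filter_empty_conv)
qed

lemma PT_Bex [pt]: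
  assumes "PT (\<lambda>p. h (fst p) (snd p))" "PT f"
  shows "PT (\<lambda>x. \<exists>a\<in>set (f x). h x a)"
proof -
  have "PT (\<lambda>x. \<not> (\<forall>a\<in>set (f x). \<not> h x a))" by (intro pt assms)
  then show ?thesis by simp
qed

lemma PT_member [pt]: "PT f \<Longrightarrow> PT g \<Longrightarrow> PT (\<lambda>x. f x \<in> set (g x))"
proof -
  assume f: "PT f" and g: "PT g"
  have "PT (\<lambda>x. \<exists>a\<in>set (g x). f x = a)"
    by (intro pt g PT_comp[OF f])
  then show ?thesis by simp
qed

lemma PT_insert [pt]: "PT f \<Longrightarrow> PT g \<Longrightarrow> PT (\<lambda>x. List.insert (f x) (g x))"
  unfolding List.insert_def by (intro pt)

definition dedup :: "'a list \<Rightarrow> 'a list" where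
  "dedup xs = fold List.insert xs []"

lemma set_dedup [simp]: "set (dedup xs) = set xs"
proof -
  have "set (fold List.insert xs ys) = set xs \<union> set ys" for ys
    by (induction xs arbitrary: ys) auto
  then show ?thesis by (simp add: dedup_def)
qed

lemma distinct_dedup [simp]: "distinct (dedup xs)"
proof -
  have "distinct ys \<Longrightarrow> distinct (fold List.insert xs ys)" for ys
    by (induction xs arbitrary: ys) auto
  then show ?thesis by (simp add: dedup_def)
qed

lemma PT_dedup [pt]: "PT f \<Longrightarrow> PT (\<lambda>x. dedup (f x))"
  unfolding dedup_def
  by (rule PT_fold_inc[where P = "[:1, 1:]"]) (intro pt | simp add: List.insert_def)+

lemma PT_length [pt]: "PT f \<Longrightarrow> PT (\<lambda>x. length (f x))"
proof (rule PT_recode)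
  assume "PT f"
  then show "PT (\<lambda>x. map (\<lambda>_. Lf) (f x))" by (intro pt)
  have "tt (length xs) = tt (map (\<lambda>_. Lf) xs)" for xs :: "'b list"
    by (induction xs) (auto simp: tt_tree)
  then show "tt (length (f x)) = tt (map (\<lambda>_. Lf) (f x))" for x .
qed

lemma PT_distinct [pt]: "PT f \<Longrightarrow> PT (\<lambda>x. distinct (f x))"
proof -
  assume "PT f"
  then have "PT (\<lambda>x. length (dedup (f x)) = length (f x))" by (intro pt)
  moreover have "length (dedup xs) = length xs \<longleftrightarrow> distinct xs" for xs :: "'b list"
    by (metis distinct_card card_distinct distinct_dedup set_dedup)
  ultimately show ?thesis by simp
qed

text \<open>A unary number and a list of that many leaves have the same tree.\<close>

lemma PT_replicate_Lf: "PT n \<Longrightarrow> PT (\<lambda>x. replicate (n x) Lf)"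
proof (rule PT_recode)
  have "tt (replicate n Lf) = tt n" for n by (induction n) (auto simp: tt_tree)
  then show "tt (replicate (n x) Lf) = tt (n x)" for x .
qed

lemma PT_replicate [pt]: "PT n \<Longrightarrow> PT f \<Longrightarrow> PT (\<lambda>x. replicate (n x) (f x))"
proof -
  assume n: "PT n" and f: "PT f"
  have "PT (\<lambda>x. map (\<lambda>_. f x) (replicate (n x) Lf))"
    by (intro pt PT_comp[OF f] PT_replicate_Lf n)
  then show ?thesis by simp
qed

lemma PT_funpow_measure:
  assumes "PT n" "PT ini" "PT (\<lambda>p. g (fst p) (snd p))"
    and "\<And>y. m y \<le> sz y" "\<And>y. sz y \<le> poly K (m y)"
    and "\<And>x y. m (g x y) \<le> m y + poly P (sz x)"
  shows "PT (\<lambda>x. (g x ^^ n x) (ini x))"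
proof -
  have "PT (\<lambda>x. fold (\<lambda>_. g x) (replicate (n x) Lf) (ini x))"
  proof (rule PT_fold_measure[OF PT_replicate_Lf[OF assms(1)] assms(2) _ assms(4,5)])
    show "PT (\<lambda>p. g (fst p) (snd (snd p)))"
      using PT_comp[OF assms(3) PT_Pair[OF PT_fst[OF PT_id] PT_snd[OF PT_snd[OF PT_id]]]] by simp
    show "m (g x y) \<le> m y + poly P (sz x + sz a)" for x y and a :: tree
      using assms(6)[of x y] poly_mono_nat[of "sz x" "sz x + sz a" P] by linarith
  qed
  then show ?thesis by simp
qed

lemma PT_funpow:
  fixes g :: "'x::ptc \<Rightarrow> 'b::ptc \<Rightarrow> 'b"
  assumes "PT n" "PT ini" "PT (\<lambda>p. g (fst p) (snd p))"
    and "\<And>x y. sz (g x y) \<le> sz y + poly P (sz x)"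
  shows "PT (\<lambda>x. (g x ^^ n x) (ini x))"
  by (rule PT_funpow_measure[where m = sz and K = "[:0, 1:]", OF assms(1-3)]) (auto intro: assms(4))

subsection \<open>Unary arithmetic\<close>

lemma PT_add [pt]: "PT f \<Longrightarrow> PT g \<Longrightarrow> PT (\<lambda>x. f x + g x :: nat)"
proof -
  assume f: "PT f" and g: "PT g"
  have "PT (\<lambda>x. (Suc ^^ f x) (g x))"
    by (rule PT_funpow[where P = "[:2:]"], intro f, intro g, intro pt, simp)
  then show ?thesis by simp
qed

lemma PT_diff [pt]: "PT f \<Longrightarrow> PT g \<Longrightarrow> PT (\<lambda>x. f x - g x :: nat)"
proof -
  assume f: "PT f" and g: "PT g"
  have "PT (\<lambda>x. ((\<lambda>n. n - Suc 0) ^^ g x) (f x))"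
    by (rule PT_funpow[where P = 0], intro g, intro f, intro pt, simp add: sz_nat)
  moreover have "((\<lambda>n. n - Suc 0) ^^ k) n = n - k" for n k :: nat by (induction k) auto
  ultimately show ?thesis by simp
qed

lemma PT_mult [pt]: "PT f \<Longrightarrow> PT g \<Longrightarrow> PT (\<lambda>x. f x * g x :: nat)"
proof -
  assume f: "PT f" and g: "PT g"
  obtain p where p: "\<And>x. sz (g x) \<le> poly p (sz x)" by (rule PT_size[OF g]) blast
  have "PT (\<lambda>x. ((\<lambda>n. n + g x) ^^ f x) 0)"
  proof (rule PT_funpow[where P = p])
    show "sz (y + g x) \<le> sz y + poly p (sz x)" for x y using p[of x] by (simp add: sz_nat)
  qed (intro pt f PT_comp[OF g])+
  moreover have "((\<lambda>n. n + b) ^^ a) 0 = a * b" for a b :: nat by (induction a) auto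
  ultimately show ?thesis by simp
qed

lemma PT_le [pt]: "PT f \<Longrightarrow> PT g \<Longrightarrow> PT (\<lambda>x. f x \<le> (g x :: nat))"
proof -
  assume "PT f" "PT g"
  then have "PT (\<lambda>x. f x - g x = 0)" by (intro pt)
  then show ?thesis by simp
qed

lemma PT_less [pt]: "PT f \<Longrightarrow> PT g \<Longrightarrow> PT (\<lambda>x. f x < (g x :: nat))"
proof -
  assume "PT f" "PT g"
  then have "PT (\<lambda>x. Suc (f x) \<le> g x)" by (intro pt)
  then show ?thesis by (simp add: Suc_le_eq)
qed

lemma PT_poly [pt]: "PT f \<Longrightarrow> PT (\<lambda>x. poly p (f x :: nat))"
proof (induction p)
  case 0
  show ?case by (simp add: PT_const)
next
  case (pCons a p)
  then have "PT (\<lambda>x. a + f x * poly p (f x))" by (intro pt)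
  then show ?case by simp
qed

text \<open>Quotient and remainder are counted up together. With divisor 0 the test never succeeds
  and the result is \<open>(0, a)\<close>, in agreement with \<open>a div 0\<close> and
  \<open>a mod 0\<close>.\<close>

lemma PT_divmod:
  assumes "PT f" "PT g"
  shows "PT (\<lambda>x. (f x div g x :: nat, f x mod g x))"
proof -
  have "PT (\<lambda>x. ((\<lambda>p. if Suc (snd p) = g x then (Suc (fst p), 0) else (fst p, Suc (snd p))) ^^ f x) (0, 0))"
    by (rule PT_funpow[where P = "[:2:]"], intro assms, intro pt, intro pt PT_comp[OF assms(2)])
      (auto simp: sz_prod sz_nat)
  moreover have "((\<lambda>p. if Suc (snd p) = b then (Suc (fst p), 0) else (fst p, Suc (snd p))) ^^ a) (0, 0) = (a div b, a mod b)"
    for a b :: nat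
    by (induction a) (auto simp: div_Suc mod_Suc)
  ultimately show ?thesis by simp
qed

lemma PT_div [pt]: "PT f \<Longrightarrow> PT g \<Longrightarrow> PT (\<lambda>x. f x div g x :: nat)"
  using PT_fst[OF PT_divmod] by fastforce

lemma PT_mod [pt]: "PT f \<Longrightarrow> PT g \<Longrightarrow> PT (\<lambda>x. f x mod g x :: nat)"
  using PT_snd[OF PT_divmod] by fastforce

definition nthd :: "'a \<Rightarrow> 'a list \<Rightarrow> nat \<Rightarrow> 'a" where
  "nthd d xs n = (if n < length xs then xs ! n else d)"

lemma PT_nthd [pt]:
  assumes "PT d" "PT f" "PT n"
  shows "PT (\<lambda>x. nthd (d x) (f x) (n x))"
proof -
  have "PT (\<lambda>x. hdd (d x) ((tl ^^ n x) (f x)))"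
  proof (intro pt assms, rule PT_funpow[where P = 0])
    show "sz (tl y) \<le> sz y + poly 0 (sz x)" for y :: "'b list" and x :: 'a by (cases y) auto
  qed (intro pt assms)+
  then show ?thesis
  proof (rule PT_recode)
    have "(tl ^^ n) xs = drop n xs" for n and xs :: "'b list"
      by (induction n) (auto simp: drop_Suc tl_drop)
    then show "tt (nthd (d x) (f x) (n x)) = tt (hdd (d x) ((tl ^^ n x) (f x)))" for x
      by (cases "n x < length (f x)") (simp_all add: nthd_def Cons_nth_drop_Suc[symmetric])
  qed
qed

lemma PT_upt [pt]:
  assumes "PT f" "PT g"
  shows "PT (\<lambda>x. [f x..<g x])"
proof -
  obtain p where p: "\<And>x. sz (g x) \<le> poly p (sz x)" by (rule PT_size[OF assms(2)]) blast
  \<comment> \<open>Here the increments grow with the accumulator, so an explicit bound on all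
    prefixes is used instead of bounded increments.\<close>
  have "PT (\<lambda>x. fold (\<lambda>_ l. length l # l) (replicate (g x) Lf) [])"
  proof (rule PT_fold[where q = "1 + p * (2 + 2 * p)"])
    fix x ys zs
    assume "replicate (g x) Lf = ys @ zs"
    then have len: "length ys \<le> g x" by (metis length_append length_replicate le_add1)
    have f: "fold (\<lambda>_ l. length l # l) ys [] = rev [0..<length ys]" for ys :: "tree list"
      by (induction ys rule: rev_induct) auto
    have g: "g x \<le> poly p (sz x)" using p[of x] by (simp add: sz_nat)
    have "sz (rev [0..<length ys]) \<le> 1 + length (rev [0..<length ys]) * (1 + (2 * poly p (sz x) + 1))"
      by (rule sz_list_bound) (use len g in \<open>auto simp: sz_nat\<close>)
    also have "\<dots> \<le> 1 + poly p (sz x) * (2 + 2 * poly p (sz x))"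
      using len g mult_right_mono[of "length ys" "poly p (sz x)" "2 + 2 * poly p (sz x)"] by simp
    finally show "sz (fold (\<lambda>_ l. length l # l) ys []) \<le> poly (1 + p * (2 + 2 * p)) (sz x)"
      by (simp add: f)
  qed (intro pt PT_replicate_Lf assms)+
  then have "PT (\<lambda>x. filter (\<lambda>i. f x \<le> i) (rev (fold (\<lambda>_ l. length l # l) (replicate (g x) Lf) [])))"
    by (intro pt PT_comp[OF assms(1)])
  then show ?thesis
  proof (rule PT_recode)
    have f: "fold (\<lambda>_ l. length l # l) ys [] = rev [0..<length ys]" for ys :: "tree list"
      by (induction ys rule: rev_induct) auto
    have u: "filter (\<lambda>i. a \<le> i) [0..<b] = [a..<b]" for a b
      by (induction b) auto
    then show "tt [f x..<g x] = tt (filter (\<lambda>i. f x \<le> i) (rev (fold (\<lambda>_ l. length l # l) (replicate (g x) Lf) [])))" for x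
      by (simp only: f u rev_rev_ident length_replicate)
  qed
qed

text \<open>Only each single \<open>h c\<close> has to be computable. The finite case distinction is
  built into the program, so \<open>h\<close> itself may depend on \<open>c\<close> in any way, such
  as through the transition table of a machine.\<close>

lemma PT_table:
  fixes n :: "'x::ptc \<Rightarrow> nat"
  assumes "PT n" "\<And>c. c < m \<Longrightarrow> PT (h c)" "PT d"
  shows "PT (\<lambda>x. if n x < m then h (n x) x else d x)"
proof -
  have "(\<And>c. c < m \<Longrightarrow> PT (h c)) \<Longrightarrow> PT (\<lambda>x. if n x < m then h (n x) x else d x)" for m
  proof (induction m)
    case 0
    show ?case using assms(3) by simp
  next
    case (Suc m)
    then have "PT (\<lambda>x. if n x < m then h (n x) x else d x)" "PT (h m)" by auto
    then have "PT (\<lambda>x. if n x = m then h m x else if n x < m then h (n x) x else d x)"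
      by (intro PT_if[OF PT_eq[OF assms(1) PT_const]])
    then show ?case by (rule PT_recode) (auto simp: less_Suc_eq)
  qed
  then show ?thesis using assms(2) .
qed

section \<open>Shortest paths between the outer layers of a unit-weight layered graph\<close>

section \<open>Shortest paths\<close>

lemma edge_of_eq_iff:
  "edge_of G a b = edge_of G c d \<longleftrightarrow> (a = c \<and> b = d) \<or> (\<not> is_directed G \<and> a = d \<and> b = c)"
  by (auto simp: edge_of_def doubleton_eq_iff)

text \<open>The weight sums over a set of edges, which could merge repeated ones. Distinct vertices
  exclude this; a backward repetition would need \<open>i = Suc j\<close> and
  \<open>j = Suc i\<close>.\<close>

lemma path_weight_distinct:
  assumes "distinct P"
  shows "path_weight G w P = (\<Sum>i<length P - 1. w (edge_of G (P ! i) (P ! Suc i)))"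
proof -
  have "path_edges G P = (\<lambda>i. edge_of G (P ! i) (P ! Suc i)) ` {..<length P - 1}"
    unfolding path_edges_def by (auto simp: less_diff_conv)
  moreover have "inj_on (\<lambda>i. edge_of G (P ! i) (P ! Suc i)) {..<length P - 1}"
  proof (rule inj_onI)
    fix i j
    assume ij: "i \<in> {..<length P - 1}" "j \<in> {..<length P - 1}"
      "edge_of G (P ! i) (P ! Suc i) = edge_of G (P ! j) (P ! Suc j)"
    then have "(P ! i = P ! j) \<or> (P ! i = P ! Suc j \<and> P ! Suc i = P ! j)"
      by (auto simp: edge_of_eq_iff)
    moreover have "i < length P" "j < length P" "Suc i < length P" "Suc j < length P" using ij by auto
    ultimately have "i = j \<or> (i = Suc j \<and> Suc i = j)"
      using assms by (simp add: nth_eq_iff_index_eq)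
    then show "i = j" by auto
  qed
  ultimately show ?thesis unfolding path_weight_def by (simp add: sum.reindex)
qed

lemma path_edges_nth: "Suc i < length P \<Longrightarrow> edge_of G (P ! i) (P ! Suc i) \<in> path_edges G P"
  unfolding path_edges_def by blast

section \<open>Layered graphs\<close>

text \<open>The arcs in \<open>A\<close> are a hidden orientation of the undirected graph
  \<open>G\<close>. The inclusion for \<open>verts G\<close> leaves room for isolated vertices,
  which arise from numbering.\<close>

locale layered =
  fixes A :: "('v \<times> 'v) set" and lay :: "'v \<Rightarrow> nat" and code :: "'v \<Rightarrow> 'u"
    and G :: "'u graph" and w :: "'u edge \<Rightarrow> real" and a0 b0 :: 'v and D :: nat
  assumes fin: "finite A"
    and inj: "inj_on code (Field A)"
    and lay: "(a, b) \<in> A \<Longrightarrow> lay b = Suc (lay a)"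
    and undirected: "\<not> is_directed G"
    and edges_G: "edges G = (\<lambda>(a, b). Link {code a, code b}) ` A"
    and verts_G: "code ` Field A \<subseteq> verts G"
    and unit: "\<And>e. e \<in> edges G \<Longrightarrow> w e = 1"
    and a0: "a0 \<in> Field A" "lay a0 = 0"
    and b0: "b0 \<in> Field A" "lay b0 = D"
    and D: "D > 0"
begin

definition fpath :: "(nat \<Rightarrow> 'v) \<Rightarrow> bool" where
  "fpath q \<longleftrightarrow> q 0 = a0 \<and> q D = b0 \<and> (\<forall>i<D. (q i, q (Suc i)) \<in> A)"

definition plist :: "(nat \<Rightarrow> 'v) \<Rightarrow> 'u list" where
  "plist q = map (code \<circ> q) [0..<Suc D]"

definition link :: "'v \<times> 'v \<Rightarrow> 'u edge" where
  "link = (\<lambda>(a, b). Link {code a, code b})"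

lemma length_plist [simp]: "length (plist q) = Suc D"
  by (simp add: plist_def)

lemma nth_plist: "i \<le> D \<Longrightarrow> plist q ! i = code (q i)"
  by (simp add: plist_def nth_append del: upt_Suc)

lemma fpath_Field: "fpath q \<Longrightarrow> i \<le> D \<Longrightarrow> q i \<in> Field A"
  using a0 by (cases i) (auto simp: fpath_def Suc_le_eq intro: FieldI2)

lemma fpath_lay: "fpath q \<Longrightarrow> i \<le> D \<Longrightarrow> lay (q i) = i"
proof (induction i)
  case (Suc i)
  then have "(q i, q (Suc i)) \<in> A" by (simp add: fpath_def)
  with Suc show ?case using lay by simp
qed (use a0 in \<open>simp add: fpath_def\<close>)

lemma inj_link: "inj_on link A"
proof (rule inj_onI)
  fix x y assume xy: "x \<in> A" "y \<in> A" "link x = link y"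
  obtain a b c d where x: "x = (a, b)" and y: "y = (c, d)" by fastforce
  have F: "a \<in> Field A" "b \<in> Field A" "c \<in> Field A" "d \<in> Field A"
    using xy x y by (auto simp: Field_def)
  have "{code a, code b} = {code c, code d}" using xy x y by (simp add: link_def)
  then have "(a = c \<and> b = d) \<or> (a = d \<and> b = c)"
    using inj_onD[OF inj] F by (metis doubleton_eq_iff)
  moreover have "\<not> (a = d \<and> b = c)"
    using lay[of a b] lay[of c d] xy x y by auto
  ultimately show "x = y" using x y by simp
qed

lemma path_edges_plist: "path_edges G (plist q) = (\<lambda>i. link (q i, q (Suc i))) ` {..<D}"
proof -
  have "path_edges G (plist q) = (\<lambda>i. edge_of G (plist q ! i) (plist q ! Suc i)) ` {..<D}"
    unfolding path_edges_def by auto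
  also have "\<dots> = (\<lambda>i. link (q i, q (Suc i))) ` {..<D}"
    by (rule image_cong) (use undirected in \<open>auto simp: nth_plist edge_of_def link_def\<close>)
  finally show ?thesis .
qed

lemma st_path_plist:
  assumes "fpath q"
  shows "st_path G (code a0) (code b0) (plist q)" "path_weight G w (plist q) = D"
proof -
  have "distinct (plist q)"
    unfolding distinct_conv_nth
  proof (intro allI impI)
    fix i j assume ij: "i < length (plist q)" "j < length (plist q)" "i \<noteq> j"
    then have "q i \<noteq> q j" using fpath_lay[OF assms, of i] fpath_lay[OF assms, of j] by auto
    then show "plist q ! i \<noteq> plist q ! j"
      using ij inj_onD[OF inj, of "q i" "q j"] fpath_Field[OF assms] by (auto simp: nth_plist)
  qed
  moreover have E: "path_edges G (plist q) \<subseteq> edges G"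
    using assms by (auto simp: path_edges_plist edges_G link_def fpath_def)
  moreover have "set (plist q) \<subseteq> verts G"
    using verts_G fpath_Field[OF assms] by (auto simp: plist_def simp del: upt_Suc)
  moreover have "hd (plist q) = code a0"
    using assms nth_plist[of 0 q] by (metis fpath_def hd_conv_nth le0 length_plist list.size(3) nat.distinct(1))
  moreover have "last (plist q) = code b0"
    using assms nth_plist[of D q] last_conv_nth[of "plist q"] by (auto simp: fpath_def simp flip: length_greater_0_conv)
  ultimately show "st_path G (code a0) (code b0) (plist q)"
    by (auto simp: st_path_def simp flip: length_greater_0_conv)
  have "w (edge_of G (plist q ! i) (plist q ! Suc i)) = 1" if "i < D" for i
    using that E by (intro unit) (auto intro!: subsetD[OF E] path_edges_nth)
  then show "path_weight G w (plist q) = D"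
    by (simp add: path_weight_distinct[OF \<open>distinct (plist q)\<close>])
qed

text \<open>Every edge changes the layer by exactly one, so at least \<open>D\<close> edges are
  needed, and with exactly \<open>D\<close> edges there is no slack for going backwards.\<close>

lemma st_path_cases:
  assumes P: "st_path G (code a0) (code b0) P"
  shows "path_weight G w P = length P - 1" "length P \<ge> Suc D"
    and "length P = Suc D \<Longrightarrow> \<exists>q. fpath q \<and> P = plist q"
proof -
  have dist: "distinct P" and E: "path_edges G P \<subseteq> edges G" and ne: "P \<noteq> []"
    and hd: "P ! 0 = code a0" and lst: "P ! (length P - 1) = code b0"
    using P by (auto simp: st_path_def hd_conv_nth last_conv_nth)
  have "w (edge_of G (P ! i) (P ! Suc i)) = 1" if "i < length P - 1" for i
    using that by (intro unit subsetD[OF E] path_edges_nth) auto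
  then show "path_weight G w P = length P - 1"
    by (simp add: path_weight_distinct[OF dist])
  define u where "u i = inv_into (Field A) code (P ! i)" for i
  have u_code: "inv_into (Field A) code (code x) = x" if "x \<in> Field A" for x
    using inv_into_f_f[OF inj that] .
  have step: "(u i, u (Suc i)) \<in> A \<or> (u (Suc i), u i) \<in> A" "P ! i \<in> code ` Field A" "P ! Suc i \<in> code ` Field A"
    if "Suc i < length P" for i
  proof -
    have "edge_of G (P ! i) (P ! Suc i) \<in> edges G" using E path_edges_nth[OF that] by blast
    then obtain a b where ab: "(a, b) \<in> A" "{P ! i, P ! Suc i} = {code a, code b}"
      using undirected by (auto simp: edges_G edge_of_def)
    have F: "a \<in> Field A" "b \<in> Field A" using ab(1) by (auto simp: Field_def)
    have "(P ! i = code a \<and> P ! Suc i = code b) \<or> (P ! i = code b \<and> P ! Suc i = code a)"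
      using ab(2) by (auto simp: doubleton_eq_iff)
    then show "(u i, u (Suc i)) \<in> A \<or> (u (Suc i), u i) \<in> A" "P ! i \<in> code ` Field A" "P ! Suc i \<in> code ` Field A"
      using ab(1) F u_code by (auto simp: u_def)
  qed
  have u0: "u 0 = a0" and ul: "u (length P - 1) = b0"
    using hd lst u_code a0 b0 by (auto simp: u_def)
  have up: "lay (u i) \<le> i" if "i < length P" for i
    using that
  proof (induction i)
    case (Suc i)
    then show ?case using step(1)[of i] lay[of "u i" "u (Suc i)"] lay[of "u (Suc i)" "u i"] by auto
  qed (use u0 a0 in auto)
  from up[of "length P - 1"] show len: "length P \<ge> Suc D" using ne ul b0 by (cases P) auto
  assume l: "length P = Suc D"
  \<comment> \<open>The same bound counted from the end. Together with \<open>up\<close> it fixes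
    the layer of each vertex, so every edge is traversed along its arc.\<close>
  have down: "lay (u (D - i)) \<ge> D - i" if "i \<le> D" for i
    using that
  proof (induction i)
    case 0
    then show ?case using ul b0 l by simp
  next
    case (Suc i)
    have e: "Suc (D - Suc i) = D - i" using Suc.prems by simp
    have "lay (u (D - i)) \<ge> D - i" using Suc by simp
    moreover have "(u (D - Suc i), u (D - i)) \<in> A \<or> (u (D - i), u (D - Suc i)) \<in> A"
      using step(1)[of "D - Suc i"] l Suc.prems unfolding e by simp
    ultimately show ?case
      using lay[of "u (D - Suc i)" "u (D - i)"] lay[of "u (D - i)" "u (D - Suc i)"] by auto
  qed
  have lu: "lay (u i) = i" if "i \<le> D" for i
    using up[of i] down[of "D - i"] that l by auto
  have "fpath u"
    unfolding fpath_def
  proof (intro conjI allI impI)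
    show "(u i, u (Suc i)) \<in> A" if "i < D" for i
      using step(1)[of i] lu[of i] lu[of "Suc i"] lay[of "u (Suc i)" "u i"] that l by auto
  qed (use u0 ul l in auto)
  moreover have "P = plist u"
  proof (rule nth_equalityI)
    fix i assume i: "i < length P"
    have "P ! i \<in> code ` Field A"
      using step(2)[of i] step(3)[of "i - 1"] i l D by (cases "i = D") auto
    then have "code (u i) = P ! i" unfolding u_def by (rule f_inv_into_f)
    then show "P ! i = plist u ! i" using i l by (simp add: nth_plist)
  qed (simp add: l)
  ultimately show "\<exists>q. fpath q \<and> P = plist q" by blast
qed

lemma shortest_path_iff:
  assumes "fpath q0"
  shows "shortest_path G w (code a0) (code b0) P \<longleftrightarrow> (\<exists>q. fpath q \<and> P = plist q)"
proof
  assume "shortest_path G w (code a0) (code b0) P"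
  then have P: "st_path G (code a0) (code b0) P" "path_weight G w P \<le> path_weight G w (plist q0)"
    using st_path_plist[OF assms] by (auto simp: shortest_path_def)
  then have "length P = Suc D"
    using st_path_cases(1,2)[OF P(1)] st_path_plist(2)[OF assms] by auto
  then show "\<exists>q. fpath q \<and> P = plist q" using st_path_cases(3)[OF P(1)] by blast
next
  assume "\<exists>q. fpath q \<and> P = plist q"
  then show "shortest_path G w (code a0) (code b0) P"
    using st_path_plist st_path_cases(1,2) by (fastforce simp: shortest_path_def)
qed

definition avoids :: "(nat \<Rightarrow> 'v) \<Rightarrow> ('v \<times> 'v) set \<Rightarrow> bool" where
  "avoids q S \<longleftrightarrow> (\<forall>i<D. (q i, q (Suc i)) \<notin> S)"

text \<open>Agreement is required up to \<open>D\<close> only, because the functions representing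
  paths are arbitrary beyond.\<close>

definition unique_avoiding :: "('v \<times> 'v) set \<Rightarrow> (nat \<Rightarrow> 'v) \<Rightarrow> bool" where
  "unique_avoiding S q \<longleftrightarrow> fpath q \<and> avoids q S \<and>
     (\<forall>q'. fpath q' \<and> avoids q' S \<longrightarrow> (\<forall>i\<le>D. q' i = q i))"

lemma anti_forcing_link:
  assumes "fpath q0" "S \<subseteq> A"
  shows "anti_forcing_set G w (code a0) (code b0) (link ` S) \<longleftrightarrow> (\<exists>q. unique_avoiding S q)"
proof -
  have av: "link ` S \<inter> path_edges G (plist q) = {} \<longleftrightarrow> avoids q S" if "fpath q" for q
  proof -
    have "link (q i, q (Suc i)) \<in> link ` S \<longleftrightarrow> (q i, q (Suc i)) \<in> S" if "i < D" for i
      using \<open>fpath q\<close> that assms(2) inj_on_image_mem_iff[OF inj_link] by (auto simp: fpath_def)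
    moreover have "link ` S \<inter> path_edges G (plist q) = {} \<longleftrightarrow> (\<forall>i<D. link (q i, q (Suc i)) \<notin> link ` S)"
    proof -
      have "T \<inter> f ` {..<D} = {} \<longleftrightarrow> (\<forall>i<D. f i \<notin> T)" for T and f :: "nat \<Rightarrow> 'u edge" by blast
      then show ?thesis unfolding path_edges_plist .
    qed
    ultimately show ?thesis by (simp add: avoids_def)
  qed
  have eq: "plist q' = plist q \<longleftrightarrow> (\<forall>i\<le>D. q' i = q i)" if "fpath q" "fpath q'" for q q'
  proof -
    have "code (q' i) = code (q i) \<longleftrightarrow> q' i = q i" if "i \<le> D" for i
      using inj_onD[OF inj] fpath_Field[OF \<open>fpath q\<close> that] fpath_Field[OF \<open>fpath q'\<close> that] by auto
    moreover have "plist q' = plist q \<longleftrightarrow> (\<forall>i\<le>D. code (q' i) = code (q i))"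
      by (simp add: list_eq_iff_nth_eq nth_plist less_Suc_eq_le)
    ultimately show ?thesis by simp
  qed
  have sub: "link ` S \<subseteq> edges G" using assms(2) by (auto simp: edges_G link_def)
  note sp = iffD1[OF shortest_path_iff[OF assms(1)]]
  have sp': "shortest_path G w (code a0) (code b0) (plist q)" if "fpath q" for q
    by (rule iffD2[OF shortest_path_iff[OF assms(1)]]) (use that in blast)
  show ?thesis
  proof
    define Q where "Q = (\<lambda>P. shortest_path G w (code a0) (code b0) P \<and> link ` S \<inter> path_edges G P = {})"
    assume "anti_forcing_set G w (code a0) (code b0) (link ` S)"
    then have "\<exists>!P. Q P" by (simp add: anti_forcing_set_def Q_def)
    then obtain P where "Q P" and Q_uniq: "\<And>P'. Q P' \<Longrightarrow> P' = P" by (elim ex1E) metis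
    from \<open>Q P\<close> have P: "shortest_path G w (code a0) (code b0) P" "link ` S \<inter> path_edges G P = {}"
      by (simp_all add: Q_def)
    have uniq: "P' = P" if "shortest_path G w (code a0) (code b0) P'" "link ` S \<inter> path_edges G P' = {}" for P'
      by (rule Q_uniq) (simp add: Q_def that)
    from sp[OF P(1)] obtain q where q: "fpath q" "P = plist q" by (elim exE conjE)
    have "\<forall>i\<le>D. q' i = q i" if q': "fpath q'" "avoids q' S" for q'
    proof -
      have "plist q' = P" 
      proof (rule uniq[OF sp'[OF q'(1)]])
        show "link ` S \<inter> path_edges G (plist q') = {}" using av[OF q'(1)] q'(2) by blast
      qed
      then show ?thesis using eq[OF q(1) q'(1)] q(2) by simp
    qed
    moreover have "avoids q S" using P(2) av[OF q(1)] q(2) by simp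
    ultimately show "\<exists>q. unique_avoiding S q" using q(1) unfolding unique_avoiding_def by blast
  next
    assume "\<exists>q. unique_avoiding S q"
    then obtain q where q: "fpath q" "avoids q S"
      and uniq: "\<And>q'. fpath q' \<Longrightarrow> avoids q' S \<Longrightarrow> \<forall>i\<le>D. q' i = q i"
      unfolding unique_avoiding_def by blast
    have "\<exists>!P. shortest_path G w (code a0) (code b0) P \<and> link ` S \<inter> path_edges G P = {}"
    proof (rule ex1I[of _ "plist q"])
      show "shortest_path G w (code a0) (code b0) (plist q) \<and> link ` S \<inter> path_edges G (plist q) = {}"
        using sp'[OF q(1)] av[OF q(1)] q(2) by simp
      fix P assume P: "shortest_path G w (code a0) (code b0) P \<and> link ` S \<inter> path_edges G P = {}"
      from sp[OF conjunct1[OF P]] obtain q' where q': "fpath q'" "P = plist q'" by (elim exE conjE)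
      have "avoids q' S" using P q'(2) av[OF q'(1)] by simp
      from uniq[OF q'(1) this] show "P = plist q" using eq[OF q(1) q'(1)] q'(2) by simp
    qed
    then show "anti_forcing_set G w (code a0) (code b0) (link ` S)"
      using sub by (simp add: anti_forcing_set_def)
  qed
qed

text \<open>The existence of some \<open>q0\<close> makes \<open>D\<close> the true distance. Cuts
  of edges and of arcs correspond through the injective \<open>link\<close>, which preserves
  cardinality.\<close>

lemma anti_forcing_iff:
  assumes "fpath q0"
  shows "(\<exists>S. anti_forcing_set G w (code a0) (code b0) S \<and> card S \<le> k) \<longleftrightarrow>
    (\<exists>S\<subseteq>A. card S \<le> k \<and> (\<exists>q. unique_avoiding S q))"
proof
  assume "\<exists>S. anti_forcing_set G w (code a0) (code b0) S \<and> card S \<le> k"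
  then obtain S where S: "anti_forcing_set G w (code a0) (code b0) S" "card S \<le> k" by blast
  then have "S \<subseteq> link ` A" by (simp add: anti_forcing_set_def edges_G link_def)
  then obtain S' where S': "S' \<subseteq> A" "S = link ` S'" by (metis subset_imageE)
  moreover have "card S = card S'" unfolding S'(2) by (rule card_image[OF inj_on_subset[OF inj_link S'(1)]])
  ultimately show "\<exists>S\<subseteq>A. card S \<le> k \<and> (\<exists>q. unique_avoiding S q)"
    using S anti_forcing_link[OF assms S'(1)] by auto
next
  assume "\<exists>S\<subseteq>A. card S \<le> k \<and> (\<exists>q. unique_avoiding S q)"
  then obtain S where S: "S \<subseteq> A" "card S \<le> k" "\<exists>q. unique_avoiding S q" by blast
  have "card (link ` S) = card S" by (rule card_image[OF inj_on_subset[OF inj_link S(1)]])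
  then show "\<exists>S. anti_forcing_set G w (code a0) (code b0) S \<and> card S \<le> k"
    using S anti_forcing_link[OF assms S(1)] by (intro exI[of _ "link ` S"]) simp
qed

end

section \<open>The gadget graph of a binary constraint satisfaction problem\<close>

section \<open>From constraint satisfaction to anti-forcing sets\<close>

datatype vtx = V nat | Y nat nat | X nat nat | E nat nat nat nat nat nat

fun layer :: "vtx \<Rightarrow> nat" where
  "layer (V g) = 3 * g"
| "layer (Y g j) = 3 * g + 1"
| "layer (X g j) = 3 * g + 2"
| "layer (E g j g' j' r l) = l"

text \<open>Indexing by the layer \<open>l\<close> covers the shared ends and the private inner
  vertices of copy \<open>r\<close> uniformly. A detour occupies one vertex per layer and hence is
  no longer than the route through the groups.\<close>

definition ear :: "nat \<Rightarrow> nat \<Rightarrow> nat \<Rightarrow> nat \<Rightarrow> nat \<Rightarrow> nat \<Rightarrow> vtx" where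
  "ear g j g' j' r l =
     (if l = 3 * g + 2 then X g j else if l = 3 * g' + 1 then Y g' j' else E g j g' j' r l)"

definition csp_solution ::
  "nat \<Rightarrow> nat \<Rightarrow> (nat \<Rightarrow> nat \<Rightarrow> nat \<Rightarrow> nat \<Rightarrow> bool) \<Rightarrow> (nat \<Rightarrow> nat) \<Rightarrow> bool" where
  "csp_solution N m cf sel \<longleftrightarrow> (\<forall>g<N. sel g < m) \<and>
     (\<forall>g' g. g < g' \<and> g' < N \<longrightarrow> \<not> cf g (sel g) g' (sel g'))"

text \<open>
  Every group \<open>g\<close> offers \<open>m\<close> parallel paths from \<open>V g\<close> to \<open>V (g + 1)\<close>, one per value. A conflict
  between two values is an ear made of more parallel paths than the budget allows to cut, leaving
  behind the edge \<open>Y g j \<longrightarrow> X g j\<close> of the first value and arriving before that of the second one.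
  Hence cutting the edges \<open>Y g j \<longrightarrow> X g j\<close> of the values that are not selected also disables all
  ears, unless an ear connects two selected values.
\<close>

definition csp_arcs ::
  "nat \<Rightarrow> nat \<Rightarrow> (nat \<Rightarrow> nat \<Rightarrow> nat \<Rightarrow> nat \<Rightarrow> bool) \<Rightarrow> (vtx \<times> vtx) set" where
  "csp_arcs N m cf =
     {(V g, Y g j) | g j. g < N \<and> j < m} \<union> {(Y g j, X g j) | g j. g < N \<and> j < m} \<union>
     {(X g j, V (Suc g)) | g j. g < N \<and> j < m} \<union>
     {(ear g j g' j' r l, ear g j g' j' r (Suc l)) | g j g' j' r l.
        g < g' \<and> g' < N \<and> j < m \<and> j' < m \<and> cf g j g' j' \<and> r < N * m + 2 \<and>
        3 * g + 2 \<le> l \<and> l < 3 * g' + 1}"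

lemma layer_ear [simp]: "layer (ear g j g' j' r l) = l"
  by (simp add: ear_def)

lemma csp_arcs_layer: "(a, b) \<in> csp_arcs N m cf \<Longrightarrow> layer b = Suc (layer a)"
  by (auto simp: csp_arcs_def)

lemma arc_V: "(V g, b) \<in> csp_arcs N m cf \<Longrightarrow> \<exists>j<m. g < N \<and> b = Y g j"
  by (auto simp: csp_arcs_def ear_def split: if_splits)

text \<open>Ears arrive at \<open>Y\<close> and depart from \<open>X\<close>, so the edge between
  them is crossed at both ends of every ear in use. Cutting that edge therefore also blocks the ears
  of the value.\<close>

lemma arc_Y: "(Y g j, b) \<in> csp_arcs N m cf \<Longrightarrow> b = X g j \<and> g < N \<and> j < m"
  by (auto simp: csp_arcs_def ear_def split: if_splits)

lemma arc_to_X: "(b, X g j) \<in> csp_arcs N m cf \<Longrightarrow> b = Y g j \<and> g < N \<and> j < m"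
  by (auto simp: csp_arcs_def ear_def split: if_splits)

lemma arc_X:
  "(X g j, b) \<in> csp_arcs N m cf \<Longrightarrow> b = V (Suc g) \<or>
     (\<exists>g' j' r. g < g' \<and> g' < N \<and> j < m \<and> j' < m \<and> cf g j g' j' \<and> b = E g j g' j' r (3 * g + 3))"
  by (auto simp: csp_arcs_def ear_def split: if_splits) presburger

lemma arc_E:
  "(E g j g' j' r l, b) \<in> csp_arcs N m cf \<Longrightarrow> b = ear g j g' j' r (Suc l)"
  by (auto simp: csp_arcs_def ear_def split: if_splits)

lemma arc_ear:
  "g < g' \<Longrightarrow> g' < N \<Longrightarrow> j < m \<Longrightarrow> j' < m \<Longrightarrow> cf g j g' j' \<Longrightarrow> r < N * m + 2 \<Longrightarrow>
   3 * g + 2 \<le> l \<Longrightarrow> l < 3 * g' + 1 \<Longrightarrow> (ear g j g' j' r l, ear g j g' j' r (Suc l)) \<in> csp_arcs N m cf"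
  unfolding csp_arcs_def by blast

definition csp_vertices :: "nat \<Rightarrow> nat \<Rightarrow> vtx set" where
  "csp_vertices N m = V ` {..N} \<union> (\<lambda>(g, j). Y g j) ` ({..<N} \<times> {..<m}) \<union> (\<lambda>(g, j). X g j) ` ({..<N} \<times> {..<m}) \<union>
     (\<lambda>(g, j, g', j', r, l). E g j g' j' r l) `
       ({..<N} \<times> {..<m} \<times> {..<N} \<times> {..<m} \<times> {..<N * m + 2} \<times> {..<3 * N})"

lemma ear_vertex:
  "g < g' \<Longrightarrow> g' < N \<Longrightarrow> j < m \<Longrightarrow> j' < m \<Longrightarrow> r < N * m + 2 \<Longrightarrow> l \<le> 3 * g' + 1 \<Longrightarrow>
    ear g j g' j' r l \<in> csp_vertices N m"
  by (force simp: ear_def csp_vertices_def image_iff)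

lemma Field_csp_arcs: "Field (csp_arcs N m cf) \<subseteq> csp_vertices N m"
proof -
  have "a \<in> csp_vertices N m \<and> b \<in> csp_vertices N m" if "(a, b) \<in> csp_arcs N m cf" for a b
  proof -
    from that consider g j where "a = V g" "b = Y g j" "g < N" "j < m"
      | g j where "a = Y g j" "b = X g j" "g < N" "j < m"
      | g j where "a = X g j" "b = V (Suc g)" "g < N" "j < m"
      | g j g' j' r l where "a = ear g j g' j' r l" "b = ear g j g' j' r (Suc l)"
        "g < g'" "g' < N" "j < m" "j' < m" "r < N * m + 2" "l < 3 * g' + 1"
      unfolding csp_arcs_def by blast
    then show ?thesis
    proof cases
      case 4
      then show ?thesis by (simp add: ear_vertex)
    qed (auto simp: csp_vertices_def image_iff)
  qed
  then show ?thesis by (auto simp: Field_def)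
qed

lemma finite_csp_arcs: "finite (csp_arcs N m cf)"
proof (rule finite_subset)
  show "csp_arcs N m cf \<subseteq> Field (csp_arcs N m cf) \<times> Field (csp_arcs N m cf)"
    by (auto simp: Field_def)
  have "finite (Field (csp_arcs N m cf))"
    by (rule finite_subset[OF Field_csp_arcs]) (auto simp: csp_vertices_def)
  then show "finite (Field (csp_arcs N m cf) \<times> Field (csp_arcs N m cf))" by simp
qed

locale csp_graph = layered "csp_arcs N m cf" layer code G w "V 0" "V N" "3 * N"
  for N m :: nat and cf :: "nat \<Rightarrow> nat \<Rightarrow> nat \<Rightarrow> nat \<Rightarrow> bool" and code :: "vtx \<Rightarrow> 'u"
    and G :: "'u graph" and w :: "'u edge \<Rightarrow> real"
begin

definition sel_path :: "(nat \<Rightarrow> nat) \<Rightarrow> nat \<Rightarrow> vtx" where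
  "sel_path sel i = (if i mod 3 = 0 then V (i div 3) else if i mod 3 = 1 then Y (i div 3) (sel (i div 3))
     else X (i div 3) (sel (i div 3)))"

lemma fpath_sel_path:
  assumes "\<And>g. g < N \<Longrightarrow> sel g < m"
  shows "fpath (sel_path sel)"
  unfolding fpath_def
proof (intro conjI allI impI)
  fix i assume i: "i < 3 * N"
  then have g: "i div 3 < N" by auto
  consider "i mod 3 = 0" | "i mod 3 = 1" | "i mod 3 = 2" by linarith
  then show "(sel_path sel i, sel_path sel (Suc i)) \<in> csp_arcs N m cf"
  proof cases
    case 1
    then have "Suc i mod 3 = 1" "Suc i div 3 = i div 3" by presburger+
    then show ?thesis using 1 g assms[OF g] by (auto simp: sel_path_def csp_arcs_def)
  next
    case 2
    then have "Suc i mod 3 = 2" "Suc i div 3 = i div 3" by presburger+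
    then show ?thesis using 2 g assms[OF g] by (auto simp: sel_path_def csp_arcs_def)
  next
    case 3
    then have "Suc i mod 3 = 0" "Suc i div 3 = Suc (i div 3)" by presburger+
    then show ?thesis using 3 g assms[OF g] by (auto simp: sel_path_def csp_arcs_def)
  qed
qed (auto simp: sel_path_def)

definition conflict_free :: "(nat \<Rightarrow> vtx) \<Rightarrow> bool" where
  "conflict_free q \<longleftrightarrow> (\<forall>g j g' j'. g < g' \<and> g' < N \<and> j < m \<and> j' < m \<and> cf g j g' j' \<longrightarrow>
     \<not> (q (3 * g + 2) = X g j \<and> q (3 * g' + 1) = Y g' j'))"

text \<open>Using an ear means visiting \<open>X g j\<close> and later \<open>Y g' j'\<close> of a
  conflicting pair. Without such a pair the path must go through all \<open>V g\<close>, choosing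
  one value in every group.\<close>

lemma conflict_free_path:
  assumes q: "fpath q" and cfree: "conflict_free q"
  obtains sel where "csp_solution N m cf sel" "\<And>i. i \<le> 3 * N \<Longrightarrow> q i = sel_path sel i"
proof -
  have step: "(q i, q (Suc i)) \<in> csp_arcs N m cf" if "i < 3 * N" for i
    using q that by (simp add: fpath_def)
  have group: "\<exists>j<m. q (3 * g + 1) = Y g j \<and> q (3 * g + 2) = X g j \<and> q (3 * g + 3) = V (Suc g)"
    if g: "g < N" and Vg: "q (3 * g) = V g" for g
  proof -
    obtain j where j: "j < m" "q (3 * g + 1) = Y g j"
      using step[of "3 * g"] arc_V Vg g by fastforce
    then have x: "q (3 * g + 2) = X g j"
      using step[of "3 * g + 1"] arc_Y g by fastforce
    have "q (3 * g + 3) = V (Suc g)"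
    proof (rule ccontr)
      assume nV: "q (3 * g + 3) \<noteq> V (Suc g)"
      have "(X g j, q (3 * g + 3)) \<in> csp_arcs N m cf"
        using step[of "3 * g + 2"] x g by (simp add: eval_nat_numeral)
      then obtain g' j' r where c: "g < g'" "g' < N" "j' < m" "cf g j g' j'"
        "q (3 * g + 3) = E g j g' j' r (3 * g + 3)"
        using arc_X[of g j "q (3 * g + 3)"] nV by blast
      \<comment> \<open>Inner ear vertices have one successor, so a path that enters a copy follows
        it to the end.\<close>
      have "q (3 * g + 3 + d) = ear g j g' j' r (3 * g + 3 + d)" if "3 * g + 3 + d \<le> 3 * g' + 1" for d
        using that
      proof (induction d)
        case 0
        then show ?case using c by (simp add: ear_def)
      next
        case (Suc d)
        then have "q (3 * g + 3 + d) = E g j g' j' r (3 * g + 3 + d)"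
          by (simp add: ear_def)
        moreover have "3 * g + 3 + d < 3 * N" using Suc.prems c by linarith
        ultimately have "(E g j g' j' r (3 * g + 3 + d), q (Suc (3 * g + 3 + d))) \<in> csp_arcs N m cf"
          using step[of "3 * g + 3 + d"] by simp
        from arc_E[OF this] show ?case by simp
      qed
      from this[of "3 * g' - 3 * g - 2"] have "q (3 * g' + 1) = Y g' j'"
        using c(1) by (simp add: ear_def)
      then show False using cfree c x j by (auto simp: conflict_free_def)
    qed
    then show ?thesis using j x by blast
  qed
  have Vg: "q (3 * g) = V g" if "g \<le> N" for g
    using that
  proof (induction g)
    case 0
    then show ?case using q by (simp add: fpath_def)
  next
    case (Suc g)
    then have "q (3 * g + 3) = V (Suc g)" using group[of g] by auto
    then show ?case by (simp add: add.commute)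
  qed
  define sel where "sel g = (SOME j. j < m \<and> q (3 * g + 1) = Y g j \<and> q (3 * g + 2) = X g j)" for g
  have sel: "sel g < m" "q (3 * g + 1) = Y g (sel g)" "q (3 * g + 2) = X g (sel g)" if "g < N" for g
    using someI_ex[of "\<lambda>j. j < m \<and> q (3 * g + 1) = Y g j \<and> q (3 * g + 2) = X g j"] group[OF that Vg] that
    unfolding sel_def by auto
  have "csp_solution N m cf sel"
    unfolding csp_solution_def
  proof (intro conjI allI impI)
    show "\<not> cf g (sel g) g' (sel g')" if "g < g' \<and> g' < N" for g g'
    proof -
      have "g < N" "g' < N" using that by auto
      then show ?thesis
        using cfree that sel(1)[of g] sel(1)[of g'] sel(3)[of g] sel(2)[of g'] unfolding conflict_free_def by blast
    qed
  qed (use sel in auto)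
  moreover have "q i = sel_path sel i" if "i \<le> 3 * N" for i
  proof (cases "i = 3 * N")
    case True
    then show ?thesis using Vg[of N] by (simp add: sel_path_def)
  next
    case False
    then have g: "i div 3 < N" using that by auto
    consider "i = 3 * (i div 3)" | "i = 3 * (i div 3) + 1" | "i = 3 * (i div 3) + 2" by linarith
    then show ?thesis
    proof cases
      case 1
      then have "i mod 3 = 0" by presburger
      then show ?thesis using Vg[of "i div 3"] g 1 by (simp add: sel_path_def)
    next
      case 2
      then have "i mod 3 = 1" by presburger
      then show ?thesis using sel(2)[OF g] 2 by (simp add: sel_path_def)
    next
      case 3
      then have "i mod 3 = 2" by presburger
      then show ?thesis using sel(3)[OF g] 3 by (simp add: sel_path_def)
    qed
  qed
  ultimately show thesis using that by blast
qed

text \<open>The cut removes the middle edge of each value that is not selected, at most one edge per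
  value, which explains the budget \<open>N * m\<close>.\<close>

lemma solution_imp_anti_forcing:
  assumes sel: "csp_solution N m cf sel"
  shows "\<exists>S\<subseteq>csp_arcs N m cf. card S \<le> N * m \<and> (\<exists>q. unique_avoiding S q)"
proof -
  define S where "S = (\<lambda>(g, j). (Y g j, X g j)) ` {(g, j). g < N \<and> j < m \<and> j \<noteq> sel g}"
  have "card S \<le> card {(g, j). g < N \<and> j < m \<and> j \<noteq> sel g}"
    unfolding S_def by (rule card_image_le) (rule finite_subset[of _ "{..<N} \<times> {..<m}"], auto)
  also have "\<dots> \<le> card ({..<N} \<times> {..<m})" by (rule card_mono) auto
  finally have card: "card S \<le> N * m" by simp
  have uniq: "q i = sel_path sel i" if q: "fpath q" "avoids q S" and "i \<le> 3 * N" for q i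
  proof -
    have step: "(q i, q (Suc i)) \<in> csp_arcs N m cf" "(q i, q (Suc i)) \<notin> S" if "i < 3 * N" for i
      using q that by (auto simp: fpath_def avoids_def)
    have yes: "j = sel g" if "q i = Y g j" "q (Suc i) = X g j" "i < 3 * N" "g < N" "j < m" for i g j
    proof (rule ccontr)
      assume "j \<noteq> sel g"
      then have "(q i, q (Suc i)) \<in> S" using that by (auto simp: S_def)
      then show False using step(2) that by blast
    qed
    \<comment> \<open>Visiting both ends of an ear forces the middle edges of both values onto the
      path. As these are uncut, both values are selected, and selected values do not
      conflict.\<close>
    have "conflict_free q"
      unfolding conflict_free_def
    proof (intro allI impI notI)
      fix g j g' j'
      assume c: "g < g' \<and> g' < N \<and> j < m \<and> j' < m \<and> cf g j g' j'"
        "q (3 * g + 2) = X g j \<and> q (3 * g' + 1) = Y g' j'"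
      have "q (3 * g + 1) = Y g j" using arc_to_X step(1)[of "3 * g + 1"] c by fastforce
      then have "j = sel g" using yes[of "3 * g + 1" g j] c by simp
      moreover have "q (3 * g' + 2) = X g' j'" using arc_Y step(1)[of "3 * g' + 1"] c by fastforce
      then have "j' = sel g'" using yes[of "3 * g' + 1" g' j'] c by simp
      ultimately show False using sel c by (auto simp: csp_solution_def)
    qed
    then obtain sel' where sel': "csp_solution N m cf sel'" "\<And>i. i \<le> 3 * N \<Longrightarrow> q i = sel_path sel' i"
      using conflict_free_path[OF q(1)] by blast
    have "sel' g = sel g" if g: "g < N" for g
    proof -
      have "(3 * g + 1) mod 3 = 1" "(3 * g + 1) div 3 = g" "Suc (3 * g + 1) mod 3 = 2" "Suc (3 * g + 1) div 3 = g"
        by presburger+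
      then have "q (3 * g + 1) = Y g (sel' g)" "q (Suc (3 * g + 1)) = X g (sel' g)"
        using sel'(2)[of "3 * g + 1"] sel'(2)[of "Suc (3 * g + 1)"] g by (simp_all add: sel_path_def)
      then show ?thesis using yes[of "3 * g + 1"] g sel'(1) by (simp add: csp_solution_def)
    qed
    moreover have "i div 3 < N \<or> i = 3 * N" using that(3) by auto
    ultimately show ?thesis using sel'(2)[OF that(3)] by (auto simp: sel_path_def)
  qed
  have "fpath (sel_path sel)" using sel by (intro fpath_sel_path) (simp add: csp_solution_def)
  moreover have "avoids (sel_path sel) S"
    by (auto simp: avoids_def S_def sel_path_def split: if_splits)
  ultimately have "unique_avoiding S (sel_path sel)" using uniq unfolding unique_avoiding_def by blast
  moreover have "S \<subseteq> csp_arcs N m cf" by (auto simp: S_def csp_arcs_def)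
  ultimately show ?thesis using card by blast
qed

text \<open>If the unique path met a conflicting pair, its section between them could be replaced by
  any copy of the ear, and two of the copies would survive the cut.\<close>

lemma anti_forcing_imp_solution:
  assumes S: "S \<subseteq> csp_arcs N m cf" "card S \<le> N * m" and q: "unique_avoiding S q"
  shows "\<exists>sel. csp_solution N m cf sel"
proof -
  have qp: "fpath q" using q by (simp add: unique_avoiding_def)
  have "conflict_free q"
    unfolding conflict_free_def
  proof (intro allI impI notI)
    fix g j g' j'
    assume c: "g < g' \<and> g' < N \<and> j < m \<and> j' < m \<and> cf g j g' j'"
      "q (3 * g + 2) = X g j \<and> q (3 * g' + 1) = Y g' j'"
    \<comment> \<open>The path \<open>q\<close> rerouted through copy \<open>r\<close>; at the two
      ends of the ear both descriptions coincide.\<close>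
    define p where "p r i = (if 3 * g + 2 \<le> i \<and> i \<le> 3 * g' + 1 then ear g j g' j' r i else q i)" for r i
    have in_ear: "p r i = ear g j g' j' r i" if "3 * g + 2 \<le> i" "i \<le> 3 * g' + 1" for r i
      using that by (simp add: p_def)
    have out_ear: "p r i = q i" if "i \<le> 3 * g + 2 \<or> i \<ge> 3 * g' + 1" for r i
      using that c by (auto simp: p_def ear_def)
    have p_step: "(p r i, p r (Suc i)) = (ear g j g' j' r i, ear g j g' j' r (Suc i)) \<and>
        3 * g + 2 \<le> i \<and> i < 3 * g' + 1 \<or> (p r i, p r (Suc i)) = (q i, q (Suc i))" for r i
      using in_ear[of i r] in_ear[of "Suc i" r] out_ear[of i r] out_ear[of "Suc i" r]
      by (cases "3 * g + 2 \<le> i \<and> i < 3 * g' + 1") auto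
    have fp: "fpath (p r)" if "r < N * m + 2" for r
      unfolding fpath_def
    proof (intro conjI allI impI)
      show "p r 0 = V 0" "p r (3 * N) = V N" using qp out_ear c by (auto simp: fpath_def)
      show "(p r i, p r (Suc i)) \<in> csp_arcs N m cf" if "i < 3 * N" for i
        using p_step[of r i] arc_ear[of g g' N j m j' cf r i] c \<open>r < N * m + 2\<close> qp that
        by (auto simp: fpath_def)
    qed
    define T where "T = {r. r < N * m + 2 \<and> \<not> avoids (p r) S}"
    \<comment> \<open>All rerouted paths that avoid \<open>S\<close> equal \<open>q\<close>. At
      layer \<open>3 * g + 3\<close> they stand on an inner vertex that records \<open>r\<close>, so
      at most one copy is uncut.\<close>
    have av: "r = r'" if "r < N * m + 2" "r' < N * m + 2" "r \<notin> T" "r' \<notin> T" for r r'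
    proof -
      have le: "3 * g + 3 \<le> 3 * N" using c by auto
      have "p r'' (3 * g + 3) = q (3 * g + 3)" if "r'' < N * m + 2" "r'' \<notin> T" for r''
      proof -
        have "fpath (p r'')" "avoids (p r'') S" using fp[OF that(1)] that by (simp_all add: T_def)
        then show ?thesis using q le unfolding unique_avoiding_def by blast
      qed
      then have "p r (3 * g + 3) = p r' (3 * g + 3)" using that by simp
      then show ?thesis using in_ear[of "3 * g + 3"] c by (simp add: ear_def)
    qed
    have "\<exists>i. (p r i, p r (Suc i)) \<in> S \<and> 3 * g + 2 \<le> i \<and> i < 3 * g' + 1" if "r \<in> T" for r
    proof -
      obtain i where i: "i < 3 * N" "(p r i, p r (Suc i)) \<in> S" using \<open>r \<in> T\<close> by (auto simp: T_def avoids_def)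
      moreover have "(q i, q (Suc i)) \<notin> S" using q i by (auto simp: unique_avoiding_def avoids_def)
      ultimately show ?thesis using p_step[of r i] by metis
    qed
    then obtain I where I: "\<And>r. r \<in> T \<Longrightarrow> (p r (I r), p r (Suc (I r))) \<in> S \<and> 3 * g + 2 \<le> I r \<and> I r < 3 * g' + 1"
      by metis
    have "inj_on (\<lambda>r. (p r (I r), p r (Suc (I r)))) T"
    proof (rule inj_onI)
      fix r r' assume r: "r \<in> T" "r' \<in> T" "(p r (I r), p r (Suc (I r))) = (p r' (I r'), p r' (Suc (I r')))"
      then have e: "ear g j g' j' r (I r) = ear g j g' j' r' (I r')"
        "ear g j g' j' r (Suc (I r)) = ear g j g' j' r' (Suc (I r'))"
        using I[of r] I[of r'] in_ear by auto
      then have "I r = I r'" by (metis layer_ear)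
      \<comment> \<open>An arc leading from \<open>X g j\<close> straight to \<open>Y g' j'\<close>
        would be common to all copies; \<open>g < g'\<close> guarantees an inner vertex.\<close>
      moreover have "\<not> (I r = 3 * g + 2 \<and> Suc (I r) = 3 * g' + 1)" using c by auto
      ultimately show "r = r'" using e I[OF r(1)] by (auto simp: ear_def split: if_splits)
    qed
    then have "card T \<le> card S"
      using I finite_subset[OF S(1) finite_csp_arcs] by (intro card_inj_on_le) auto
    \<comment> \<open>Counting: \<open>N * m + 2\<close> copies, at most one uncut, each other one
      using up a different arc of \<open>S\<close>; this needs \<open>N * m + 1\<close>
      cuts.\<close>
    moreover have "N * m + 2 \<le> card T + 1"
    proof -
      have "card ({..<N * m + 2} - T) \<le> 1"
        by (rule card_le_Suc0_iff_eq[THEN iffD2, unfolded One_nat_def[symmetric]]) (use av in auto)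
      moreover have "T \<subseteq> {..<N * m + 2}" by (auto simp: T_def)
      ultimately show ?thesis
        using card_Diff_subset[of T "{..<N * m + 2}"] finite_subset[of T "{..<N * m + 2}"] by simp
    qed
    ultimately show False using S(2) by simp
  qed
  then show ?thesis using conflict_free_path[OF qp] by blast
qed

theorem csp_anti_forcing:
  assumes "m > 0"
  shows "(\<exists>S. anti_forcing_set G w (code (V 0)) (code (V N)) S \<and> card S \<le> N * m) \<longleftrightarrow>
    (\<exists>sel. csp_solution N m cf sel)"
proof -
  have "fpath (sel_path (\<lambda>_. 0))" by (rule fpath_sel_path) (use assms in simp)
  from anti_forcing_iff[OF this] show ?thesis
    using solution_imp_anti_forcing anti_forcing_imp_solution by metis
qed

end

section \<open>A Cook-Levin tableau whose constraints relate two cells at a time\<close>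

section \<open>Computations as constraint satisfaction problems\<close>

type_synonym tabopt = "nat \<times> nat list \<times> (nat \<times> bool) list"

lemma fst_act_tape: "fst (act_tape am tp) = (fst tp)(snd tp := fst am)"
  and snd_act_tape: "snd (act_tape am tp) = snd tp + head_shift (snd am)"
  by (cases am; cases tp; simp)+

lemma read_sym_eq: "read_sym tp = fst tp (snd tp)"
  by (cases tp) simp

declare tm_step.simps [simp del]

locale tableau_data =
  fixes M :: tm and xs :: "bool list" and U T :: nat
begin

definition "\<tau> = num_tapes M"
text \<open>In \<open>T\<close> steps the heads stay within the cells from \<open>-T\<close> to
  \<open>T\<close>; column \<open>i\<close> stands for cell \<open>pos i\<close>.\<close>

definition "W = 2 * T + 1"
definition "N = (T + 1) * W"

definition pos :: "nat \<Rightarrow> int" where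
  "pos i = int i - int T"

text \<open>Made total by idling in the halting state, like \<open>tm_step\<close>, so that the
  tableau always has \<open>T\<close> steps.\<close>

definition \<delta> :: "nat \<Rightarrow> nat list \<Rightarrow> nat \<times> (nat \<times> move) list" where
  "\<delta> q syms = (if q \<ge> num_states M then (q, map (\<lambda>a. (a, Stay)) syms) else trans M q syms)"

definition nx :: "tabopt \<Rightarrow> nat" where
  "nx v = fst (\<delta> (fst v) (fst (snd v)))"

definition act :: "tabopt \<Rightarrow> nat \<Rightarrow> nat \<times> move" where
  "act v j = snd (\<delta> (fst v) (fst (snd v))) ! j"

definition sy :: "tabopt \<Rightarrow> nat \<Rightarrow> nat" where
  "sy v j = fst (snd (snd v) ! j)"

definition hd_at :: "tabopt \<Rightarrow> nat \<Rightarrow> bool" where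
  "hd_at v j = snd (snd (snd v) ! j)"

text \<open>
  The value of cell \<open>i\<close> at time \<open>t\<close> repeats the state and the symbols read on all tapes at time \<open>t\<close>;
  this makes all constraints binary.
\<close>

definition domain :: "tabopt set" where
  "domain = {(q, syms, cell). q \<le> num_states M \<and> length syms = \<tau> \<and> set syms \<subseteq> {..<num_symbols M} \<and>
     length cell = \<tau> \<and> set cell \<subseteq> {..<num_symbols M} \<times> UNIV \<and> (\<forall>j<\<tau>. snd (cell ! j) \<longrightarrow> fst (cell ! j) = syms ! j)}"

definition agree :: "tabopt \<Rightarrow> tabopt \<Rightarrow> bool" where
  "agree v v' \<longleftrightarrow> fst v = fst v' \<and> fst (snd v) = fst (snd v') \<and> (\<forall>j<\<tau>. \<not> (hd_at v j \<and> hd_at v' j))"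

definition keep :: "tabopt \<Rightarrow> tabopt \<Rightarrow> bool" where
  "keep v v' \<longleftrightarrow> fst v' = nx v \<and> (\<forall>j<\<tau>. sy v' j = (if hd_at v j then fst (act v j) else sy v j))"

text \<open>Only the arrival of a head is enforced. That no further head appears in the row follows
  from \<open>agree\<close>; the same holds for \<open>ini\<close>.\<close>

definition mv :: "move \<Rightarrow> tabopt \<Rightarrow> tabopt \<Rightarrow> bool" where
  "mv d v v' \<longleftrightarrow> (\<forall>j<\<tau>. hd_at v j \<and> snd (act v j) = d \<longrightarrow> hd_at v' j)"

text \<open>Applied along the certificate area of the first row: after a blank there are only
  blanks, so the area spells a word of length at most \<open>U\<close>.\<close>

definition blank :: "tabopt \<Rightarrow> tabopt \<Rightarrow> bool" where
  "blank v v' \<longleftrightarrow> (sy v 0 = 0 \<longrightarrow> sy v' 0 = 0)"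

text \<open>The values 0, 1 and 2 are the prescribed initial symbols; 3 marks the \<open>U\<close>
  cells whose contents are guessed.\<close>

definition cls :: "nat \<Rightarrow> nat" where
  "cls i = (if i < T then 0 else if i < T + length xs then (if nthd False xs (i - T) then 2 else 1)
     else if i < T + length xs + U then 3 else 0)"

definition ini :: "nat \<Rightarrow> bool \<Rightarrow> tabopt \<Rightarrow> bool" where
  "ini c b v \<longleftrightarrow> fst v = 0 \<and> (\<forall>j<\<tau>. (b \<longrightarrow> hd_at v j) \<and> (j \<noteq> 0 \<longrightarrow> sy v j = 0)) \<and>
     (if c = 3 then sy v 0 \<le> 2 else sy v 0 = c)"

definition fin_ok :: "tabopt \<Rightarrow> bool" where
  "fin_ok v \<longleftrightarrow> sy v (\<tau> - 1) = 2"

definition bad :: "nat \<Rightarrow> nat \<Rightarrow> tabopt \<Rightarrow> bool" where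
  "bad t i v \<longleftrightarrow> (t = 0 \<and> \<not> ini (cls i) (i = T) v) \<or> (t = T \<and> i = T \<and> \<not> fin_ok v)"

definition clash :: "nat \<Rightarrow> nat \<Rightarrow> tabopt \<Rightarrow> nat \<Rightarrow> nat \<Rightarrow> tabopt \<Rightarrow> bool" where
  "clash t i v t' i' v' \<longleftrightarrow>
     (t = t' \<and> i \<noteq> i' \<and> \<not> agree v v') \<or>
     (t = 0 \<and> t' = 0 \<and> i < i' \<and> T + length xs \<le> i \<and> \<not> blank v v') \<or>
     (t' = Suc t \<and> i' = i \<and> \<not> (keep v v' \<and> mv Stay v v')) \<or>
     (t' = Suc t \<and> i' = Suc i \<and> \<not> mv Move_Right v v') \<or>
     (t' = Suc t \<and> i = Suc i' \<and> \<not> mv Move_Left v v')"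

text \<open>Any enumeration will do, since \<open>domain\<close> depends on \<open>M\<close> alone:
  for a fixed machine this list is a constant of the reduction.\<close>

definition dlist :: "tabopt list" where
  "dlist = (SOME vs. set vs = domain)"

text \<open>The unary condition \<open>bad\<close> is charged to every pair containing the cell,
  which makes all constraints binary.\<close>

definition cf :: "nat \<Rightarrow> nat \<Rightarrow> nat \<Rightarrow> nat \<Rightarrow> bool" where
  "cf g j g' j' \<longleftrightarrow> bad (g div W) (g mod W) (dlist ! j) \<or> bad (g' div W) (g' mod W) (dlist ! j') \<or>
     clash (g div W) (g mod W) (dlist ! j) (g' div W) (g' mod W) (dlist ! j')"

definition tab :: "(nat \<Rightarrow> nat \<Rightarrow> tabopt) \<Rightarrow> bool" where
  "tab \<sigma> \<longleftrightarrow> (\<forall>t\<le>T. \<forall>i<W. \<sigma> t i \<in> domain \<and> \<not> bad t i (\<sigma> t i)) \<and>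
     (\<forall>t\<le>T. \<forall>t'\<le>T. \<forall>i<W. \<forall>i'<W. t * W + i < t' * W + i' \<longrightarrow> \<not> clash t i (\<sigma> t i) t' i' (\<sigma> t' i'))"

end

locale tableau = tableau_data +
  assumes wf: "wf_tm M" and T_pos: "T \<ge> 1" and T_ge: "T \<ge> length xs + U"
begin

lemma tau_pos: "\<tau> \<ge> 1"
  using wf by (simp add: wf_tm_def \<tau>_def)

lemma symbols: "num_symbols M \<ge> 3"
  using wf by (simp add: wf_tm_def)

lemma finite_domain: "finite domain"
proof (rule finite_subset)
  show "domain \<subseteq> {..num_states M} \<times> {syms. set syms \<subseteq> {..<num_symbols M} \<and> length syms = \<tau>} \<times>
      {cell. set cell \<subseteq> {..<num_symbols M} \<times> UNIV \<and> length cell = \<tau>}"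
    by (auto simp: domain_def)
  show "finite ({..num_states M} \<times> {syms. set syms \<subseteq> {..<num_symbols M} \<and> length syms = \<tau>} \<times>
      {cell :: (nat \<times> bool) list. set cell \<subseteq> {..<num_symbols M} \<times> UNIV \<and> length cell = \<tau>})"
    by (intro finite_cartesian_product finite_lists_length_eq) auto
qed

lemma set_dlist: "set dlist = domain"
  unfolding dlist_def by (rule someI_ex) (rule finite_list[OF finite_domain])

lemma dlist_pos: "length dlist > 0"
proof -
  have "(0, replicate \<tau> 0, replicate \<tau> (0, False)) \<in> domain"
    using symbols by (auto simp: domain_def)
  then show ?thesis using set_dlist by (metis length_pos_if_in_set)
qed

lemma W_pos: "W > 0"
  by (simp add: W_def)

lemma solution_imp_tab:
  assumes sel: "csp_solution N (length dlist) cf sel"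
  shows "tab (\<lambda>t i. dlist ! sel (t * W + i))"
proof -
  have lt: "t * W + i < N" if "t \<le> T" "i < W" for t i
  proof -
    have "t * W \<le> T * W" using that(1) by (rule mult_right_mono) simp
    then show ?thesis using that(2) unfolding N_def add_mult_distrib by linarith
  qed
  have dm: "(t * W + i) div W = t" "(t * W + i) mod W = i" if "i < W" for t i
    using that by simp_all
  have nocf: "\<not> cf g (sel g) g' (sel g')" if "g < g'" "g' < N" for g g'
    using sel that by (auto simp: csp_solution_def)
  \<comment> \<open>With at least two groups each cell occurs in some ordered pair, so its unary
    condition really is enforced.\<close>
  have N2: "N \<ge> 2" using T_pos by (simp add: N_def W_def)
  have nobad: "\<not> bad (g div W) (g mod W) (dlist ! sel g)" if "g < N" for g
  proof (cases "g = 0")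
    case True
    then show ?thesis using nocf[of 0 1] N2 by (auto simp: cf_def)
  next
    case False
    then show ?thesis using nocf[of 0 g] that by (auto simp: cf_def)
  qed
  show ?thesis
    unfolding tab_def
  proof (intro conjI allI impI)
    fix t i assume ti: "t \<le> T" "i < W"
    show "dlist ! sel (t * W + i) \<in> domain"
      using sel lt[OF ti] set_dlist nth_mem by (auto simp: csp_solution_def)
    show "\<not> bad t i (dlist ! sel (t * W + i))" using nobad[OF lt[OF ti]] dm[OF ti(2)] by simp
  next
    fix t t' i i' assume ti: "t \<le> T" "t' \<le> T" "i < W" "i' < W" "t * W + i < t' * W + i'"
    show "\<not> clash t i (dlist ! sel (t * W + i)) t' i' (dlist ! sel (t' * W + i'))"
      using nocf[OF ti(5) lt[OF ti(2,4)]] dm[OF ti(3)] dm[OF ti(4)] by (auto simp: cf_def)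
  qed
qed

lemma tab_imp_solution:
  assumes "tab \<sigma>"
  shows "\<exists>sel. csp_solution N (length dlist) cf sel"
proof -
  have gN: "g div W \<le> T" "g mod W < W" "g div W * W + g mod W = g" if "g < N" for g
  proof -
    have "g div W < T + 1" using that by (intro less_mult_imp_div_less) (simp add: N_def)
    then show "g div W \<le> T" "g mod W < W" "g div W * W + g mod W = g" using W_pos by simp_all
  qed
  have "\<exists>j<length dlist. dlist ! j = \<sigma> (g div W) (g mod W)" if "g < N" for g
    using gN[OF that] assms set_dlist unfolding tab_def by (metis in_set_conv_nth)
  then obtain sel where sel: "\<And>g. g < N \<Longrightarrow> sel g < length dlist \<and> dlist ! sel g = \<sigma> (g div W) (g mod W)"
    by metis
  have "csp_solution N (length dlist) cf sel"
    unfolding csp_solution_def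
  proof (intro conjI allI impI)
    fix g g' assume g: "g < g' \<and> g' < N"
    then have gs: "g < N" "g' < N" by auto
    note G = gN[OF gs(1)] and G' = gN[OF gs(2)]
    have "\<not> bad (g div W) (g mod W) (dlist ! sel g)" "\<not> bad (g' div W) (g' mod W) (dlist ! sel g')"
      using assms G(1,2) G'(1,2) sel[OF gs(1)] sel[OF gs(2)] unfolding tab_def by metis+
    moreover have "g div W * W + g mod W < g' div W * W + g' mod W" using g G(3) G'(3) by simp
    then have "\<not> clash (g div W) (g mod W) (dlist ! sel g) (g' div W) (g' mod W) (dlist ! sel g')"
      using assms G(1,2) G'(1,2) sel[OF gs(1)] sel[OF gs(2)] unfolding tab_def by metis
    ultimately show "\<not> cf g (sel g) g' (sel g')" by (simp add: cf_def)
  qed (use sel in auto)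
  then show ?thesis by blast
qed

subsection \<open>Runs of the machine\<close>

definition run :: "bool list \<Rightarrow> nat \<Rightarrow> config" where
  "run z t = (tm_step M ^^ t) (init_config M z)"

definition good :: "config \<Rightarrow> bool" where
  "good c \<longleftrightarrow> fst c \<le> num_states M \<and> length (snd c) = \<tau> \<and> (\<forall>j<\<tau>. \<forall>p. fst (snd c ! j) p < num_symbols M)"

lemma good_reads:
  assumes "good (q, tps)"
  shows "length (map read_sym tps) = \<tau>" "set (map read_sym tps) \<subseteq> {..<num_symbols M}"
proof -
  have "read_sym (tps ! i) < num_symbols M" if "i < \<tau>" for i
    using assms that by (simp add: good_def read_sym_eq)
  then show "length (map read_sym tps) = \<tau>" "set (map read_sym tps) \<subseteq> {..<num_symbols M}"
    using assms unfolding good_def by (simp, metis (no_types, lifting) image_subsetI in_set_conv_nth lessThan_iff list.set_map snd_conv)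
qed

lemma delta_valid:
  assumes "q \<le> num_states M" "length syms = \<tau>" "set syms \<subseteq> {..<num_symbols M}"
  shows "fst (\<delta> q syms) \<le> num_states M" "length (snd (\<delta> q syms)) = \<tau>"
    "j < \<tau> \<Longrightarrow> fst (snd (\<delta> q syms) ! j) < num_symbols M"
proof -
  have "fst (\<delta> q syms) \<le> num_states M \<and> length (snd (\<delta> q syms)) = \<tau> \<and>
      fst ` set (snd (\<delta> q syms)) \<subseteq> {..<num_symbols M}"
  proof (cases "q \<ge> num_states M")
    case True
    then show ?thesis using assms by (auto simp: \<delta>_def)
  next
    case False
    then have "case trans M q syms of (q', acts) \<Rightarrow> q' \<le> num_states M \<and> length acts = num_tapes M \<and>
        fst ` set acts \<subseteq> {..<num_symbols M}"
      using assms wf unfolding wf_tm_def \<tau>_def by auto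
    then show ?thesis using False by (cases "trans M q syms") (auto simp: \<delta>_def \<tau>_def)
  qed
  then show "fst (\<delta> q syms) \<le> num_states M" "length (snd (\<delta> q syms)) = \<tau>"
    "j < \<tau> \<Longrightarrow> fst (snd (\<delta> q syms) ! j) < num_symbols M"
    by (auto simp: image_subset_iff)
qed

lemma step_delta:
  assumes "good (q, tps)"
  shows "tm_step M (q, tps) = (fst (\<delta> q (map read_sym tps)), map2 act_tape (snd (\<delta> q (map read_sym tps))) tps)"
proof (cases "q \<ge> num_states M")
  case True
  have "map2 act_tape (map (\<lambda>a. (a, Stay)) (map read_sym tps)) tps = tps"
  proof (rule nth_equalityI)
    fix i assume "i < length (map2 act_tape (map (\<lambda>a. (a, Stay)) (map read_sym tps)) tps)"
    then show "map2 act_tape (map (\<lambda>a. (a, Stay)) (map read_sym tps)) tps ! i = tps ! i"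
      by (cases "tps ! i") simp
  qed simp
  then show ?thesis using True by (simp add: \<delta>_def tm_step.simps)
next
  case False
  then show ?thesis by (simp add: \<delta>_def tm_step.simps split: prod.splits)
qed

lemma step_components:
  assumes "good c"
  shows "fst (tm_step M c) = fst (\<delta> (fst c) (map read_sym (snd c)))"
    "length (snd (tm_step M c)) = \<tau>"
    "j < \<tau> \<Longrightarrow> snd (tm_step M c) ! j = act_tape (snd (\<delta> (fst c) (map read_sym (snd c))) ! j) (snd c ! j)"
proof -
  obtain q tps where c: "c = (q, tps)" by fastforce
  have len: "length tps = \<tau>" "length (snd (\<delta> q (map read_sym tps))) = \<tau>"
    using assms delta_valid(2) good_reads[of q tps] by (auto simp: c good_def)
  have s: "tm_step M c = (fst (\<delta> q (map read_sym tps)), map2 act_tape (snd (\<delta> q (map read_sym tps))) tps)"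
    using step_delta assms unfolding c by blast
  show "fst (tm_step M c) = fst (\<delta> (fst c) (map read_sym (snd c)))"
    "length (snd (tm_step M c)) = \<tau>"
    "j < \<tau> \<Longrightarrow> snd (tm_step M c) ! j = act_tape (snd (\<delta> (fst c) (map read_sym (snd c))) ! j) (snd c ! j)"
    unfolding s using len by (simp_all add: c)
qed

lemma good_step:
  assumes "good c"
  shows "good (tm_step M c)"
proof -
  obtain q tps where c: "c = (q, tps)" by fastforce
  note v = delta_valid[OF _ good_reads[of q tps]]
  note s = step_components[OF assms]
  show ?thesis
    unfolding good_def
  proof (intro conjI allI impI)
    show "fst (tm_step M c) \<le> num_states M" using v(1) assms s(1) by (simp add: c good_def)
    show "length (snd (tm_step M c)) = \<tau>" by (rule s(2))
    fix j p assume j: "j < \<tau>"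
    have "fst (snd (\<delta> q (map read_sym tps)) ! j) < num_symbols M" using v(3) assms j by (simp add: c good_def)
    then show "fst (snd (tm_step M c) ! j) p < num_symbols M"
      using assms j by (simp add: s(3)[of j, unfolded c] fst_act_tape c good_def)
  qed
qed

lemma init_tapes:
  "fst (init_config M z) = 0" "length (snd (init_config M z)) = \<tau>"
  "j < \<tau> \<Longrightarrow> snd (init_config M z) ! j = (if j = 0 then input_tape z else (\<lambda>_. 0, 0))"
  using tau_pos by (auto simp: init_config_def \<tau>_def nth_Cons')

lemma snd_input_tape [simp]: "snd (input_tape z) = 0"
  by (simp add: input_tape_def)

lemma good_run: "good (run z t)"
proof (induction t)
  case 0
  have "fst (input_tape z) p < num_symbols M" for p
    using symbols by (cases "z ! nat p") (auto simp: input_tape_def)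
  then show ?case using symbols by (auto simp: run_def good_def init_tapes)
next
  case (Suc t)
  then show ?case using good_step by (simp add: run_def)
qed

lemma run_Suc: "run z (Suc t) = tm_step M (run z t)"
  by (simp add: run_def)

lemma head_bound: "j < \<tau> \<Longrightarrow> \<bar>snd (snd (run z t) ! j)\<bar> \<le> int t"
proof (induction t)
  case 0
  then show ?case by (simp add: run_def init_tapes)
next
  case (Suc t)
  have "\<bar>head_shift m\<bar> \<le> 1" for m by (cases m) auto
  from this[of "snd (snd (\<delta> (fst (run z t)) (map read_sym (snd (run z t)))) ! j)"]
  show ?case using Suc by (simp add: run_Suc step_components[OF good_run] snd_act_tape)
qed

definition opt :: "config \<Rightarrow> int \<Rightarrow> tabopt" where
  "opt c p = (fst c, map read_sym (snd c), map (\<lambda>tp. (fst tp p, snd tp = p)) (snd c))"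

lemma opt_simps:
  assumes "good c"
  shows "fst (opt c p) = fst c" "fst (snd (opt c p)) = map read_sym (snd c)"
    "j < \<tau> \<Longrightarrow> sy (opt c p) j = fst (snd c ! j) p" "j < \<tau> \<Longrightarrow> hd_at (opt c p) j \<longleftrightarrow> snd (snd c ! j) = p"
  using assms by (simp_all add: opt_def sy_def hd_at_def good_def)

lemma opt_step:
  assumes "good c"
  shows "nx (opt c p) = fst (tm_step M c)"
    "j < \<tau> \<Longrightarrow> fst (snd (tm_step M c) ! j) = (fst (snd c ! j))(snd (snd c ! j) := fst (act (opt c p) j))"
    "j < \<tau> \<Longrightarrow> snd (snd (tm_step M c) ! j) = snd (snd c ! j) + head_shift (snd (act (opt c p) j))"
  using step_components[OF assms] by (simp_all add: nx_def act_def opt_simps[OF assms] fst_act_tape snd_act_tape)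

lemma opt_domain:
  assumes "good c"
  shows "opt c p \<in> domain"
proof -
  have "set (map (\<lambda>tp. (fst tp p, snd tp = p)) (snd c)) \<subseteq> {..<num_symbols M} \<times> UNIV"
  proof
    fix x assume "x \<in> set (map (\<lambda>tp. (fst tp p, snd tp = p)) (snd c))"
    then obtain j where "j < length (snd c)" "x = (fst (snd c ! j) p, snd (snd c ! j) = p)"
      by (metis (no_types, lifting) in_set_conv_nth length_map nth_map)
    then show "x \<in> {..<num_symbols M} \<times> UNIV" using assms by (simp add: good_def)
  qed
  moreover have "length (snd c) = \<tau>" "fst c \<le> num_states M" using assms by (simp_all add: good_def)
  moreover have "set (map read_sym (snd c)) \<subseteq> {..<num_symbols M}"
    using good_reads(2)[of "fst c" "snd c"] assms by simp
  ultimately show ?thesis by (simp add: domain_def opt_def read_sym_eq)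
qed

lemma run_step:
  "nx (opt (run z t) p) = fst (run z (Suc t))"
  "j < \<tau> \<Longrightarrow> fst (snd (run z (Suc t)) ! j) = (fst (snd (run z t) ! j))(snd (snd (run z t) ! j) := fst (act (opt (run z t) p) j))"
  "j < \<tau> \<Longrightarrow> snd (snd (run z (Suc t)) ! j) = snd (snd (run z t) ! j) + head_shift (snd (act (opt (run z t) p) j))"
  unfolding run_Suc using opt_step[OF good_run] by blast+

definition accepts :: "bool list \<Rightarrow> bool" where
  "accepts z \<longleftrightarrow> fst (last (snd (run z T))) 0 = 2"

lemma accepts_iff: "accepts z \<longleftrightarrow> fst (snd (run z T) ! (\<tau> - 1)) 0 = 2"
proof -
  have "length (snd (run z T)) = \<tau>" using good_run[of z T] by (simp add: good_def)
  then show ?thesis using tau_pos by (simp add: accepts_def last_conv_nth flip: length_greater_0_conv)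
qed

lemma input_class:
  assumes "i < W" "length u \<le> U"
  shows "if cls i = 3 then fst (input_tape (xs @ u)) (pos i) \<le> 2 else fst (input_tape (xs @ u)) (pos i) = cls i"
proof -
  have "bit_sym b \<le> 2" for b by (cases b) auto
  moreover have "nat (pos i) = i - T" by (simp add: pos_def)
  moreover have "0 \<le> pos i \<longleftrightarrow> T \<le> i" "pos i < int n \<longleftrightarrow> i < T + n" for n by (auto simp: pos_def)
  ultimately show ?thesis
    using assms by (auto simp: input_tape_def cls_def nthd_def nth_append)
qed

lemma accepts_imp_tab:
  assumes u: "length u \<le> U" and acc: "accepts (xs @ u)"
  shows "tab (\<lambda>t i. opt (run (xs @ u) t) (pos i))"
proof -
  let ?c = "run (xs @ u)"
  have pos_inj: "pos i = pos i' \<longleftrightarrow> i = i'" for i i' by (simp add: pos_def)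
  note os = opt_simps[OF good_run]
  have c0: "?c 0 = init_config M (xs @ u)" by (simp add: run_def)
  have t0: "snd (?c 0) ! j = (if j = 0 then input_tape (xs @ u) else (\<lambda>_. 0, 0))" if "j < \<tau>" for j
    using that by (simp add: c0 init_tapes)
  have nobad: "\<not> bad t i (opt (?c t) (pos i))" if "i < W" for t i
  proof -
    have "ini (cls i) (i = T) (opt (?c 0) (pos i))"
      using tau_pos input_class[OF that u]
      by (auto simp: ini_def os t0 pos_def) (auto simp: c0 init_tapes)
    moreover have "fin_ok (opt (?c T) (pos T))"
      using acc tau_pos by (simp add: fin_ok_def os accepts_iff) (simp add: pos_def)
    ultimately show ?thesis by (cases "t = 0"; cases "t = T \<and> i = T") (use T_pos in \<open>auto simp: bad_def\<close>)
  qed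
  have noclash: "\<not> clash t i (opt (?c t) (pos i)) t' i' (opt (?c t') (pos i'))" for t i t' i'
  proof -
    have "agree (opt (?c t) (pos i)) (opt (?c t) (pos i'))" if "i \<noteq> i'"
      using that pos_inj by (auto simp: agree_def os)
    moreover have "blank (opt (?c 0) (pos i)) (opt (?c 0) (pos i'))" if "i < i'" "T + length xs \<le> i"
      using that tau_pos by (auto simp: blank_def os t0 input_tape_def pos_def)
    moreover have "keep (opt (?c t) (pos i)) (opt (?c (Suc t)) (pos i))"
      using run_step(1,2)[where p = "pos i" and t = t] by (auto simp: keep_def os)
    moreover have "mv d (opt (?c t) (pos i)) (opt (?c (Suc t)) (pos i'))" if "pos i' = pos i + head_shift d" for d
      using that run_step(3)[where p = "pos i" and t = t] by (auto simp: mv_def os)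
    from this[of Stay] this[of Move_Left] this[of Move_Right]
    have "i = i' \<Longrightarrow> mv Stay (opt (?c t) (pos i)) (opt (?c (Suc t)) (pos i'))"
      "i = Suc i' \<Longrightarrow> mv Move_Left (opt (?c t) (pos i)) (opt (?c (Suc t)) (pos i'))"
      "i' = Suc i \<Longrightarrow> mv Move_Right (opt (?c t) (pos i)) (opt (?c (Suc t)) (pos i'))"
      by (auto simp: pos_def)
    ultimately show ?thesis unfolding clash_def by blast
  qed
  show ?thesis unfolding tab_def using opt_domain[OF good_run] nobad noclash by blast
qed

lemma domain_D:
  assumes "v \<in> domain"
  shows "length (fst (snd v)) = \<tau>" "length (snd (snd v)) = \<tau>" "j < \<tau> \<Longrightarrow> hd_at v j \<Longrightarrow> sy v j = fst (snd v) ! j"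
  using assms by (auto simp: domain_def hd_at_def sy_def)

text \<open>Every head of \<open>c\<close> lies in some column, where \<open>heads\<close> places
  it, and \<open>agree\<close> excludes a second one. At that column \<open>domain\<close> ties the
  symbol read to the cell contents, and agreement spreads it over the whole row.\<close>

lemma tab_rowI:
  assumes c: "good c" "\<And>j. j < \<tau> \<Longrightarrow> \<bar>snd (snd c ! j)\<bar> \<le> int T"
    and dom: "\<And>i. i < W \<Longrightarrow> \<rho> i \<in> domain"
    and agr: "\<And>i i'. i < W \<Longrightarrow> i' < W \<Longrightarrow> i \<noteq> i' \<Longrightarrow> agree (\<rho> i) (\<rho> i')"
    and st: "\<And>i. i < W \<Longrightarrow> fst (\<rho> i) = fst c"
    and cell: "\<And>i j. i < W \<Longrightarrow> j < \<tau> \<Longrightarrow> sy (\<rho> i) j = fst (snd c ! j) (pos i)"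
    and heads: "\<And>i j. i < W \<Longrightarrow> j < \<tau> \<Longrightarrow> snd (snd c ! j) = pos i \<Longrightarrow> hd_at (\<rho> i) j"
    and i: "i < W"
  shows "\<rho> i = opt c (pos i)"
proof -
  have idx: "\<exists>k<W. pos k = snd (snd c ! j)" if "j < \<tau>" for j
    using c(2)[OF that] by (intro exI[of _ "nat (snd (snd c ! j) + int T)"]) (auto simp: pos_def W_def)
  have hd_iff: "hd_at (\<rho> i) j \<longleftrightarrow> snd (snd c ! j) = pos i" if j: "j < \<tau>" for j
  proof
    assume h: "hd_at (\<rho> i) j"
    obtain k where k: "k < W" "pos k = snd (snd c ! j)" using idx[OF j] by blast
    then have "hd_at (\<rho> k) j" using heads[of k j] j by simp
    then have "i = k" using agr[OF i k(1)] h j by (auto simp: agree_def)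
    then show "snd (snd c ! j) = pos i" using k by simp
  qed (use heads[OF i j] in simp)
  have syms: "fst (snd (\<rho> i)) ! j = read_sym (snd c ! j)" if j: "j < \<tau>" for j
  proof -
    obtain k where k: "k < W" "pos k = snd (snd c ! j)" using idx[OF j] by blast
    have "fst (snd (\<rho> k)) ! j = sy (\<rho> k) j" using domain_D(3)[OF dom[OF k(1)] j] heads[of k j] k j by simp
    also have "\<dots> = read_sym (snd c ! j)" using cell[OF k(1) j] k(2) by (simp add: read_sym_eq)
    finally have "fst (snd (\<rho> k)) ! j = read_sym (snd c ! j)" .
    moreover have "fst (snd (\<rho> i)) = fst (snd (\<rho> k))" using agr[OF i k(1)] by (cases "i = k") (auto simp: agree_def)
    ultimately show ?thesis by simp
  qed
  note d = domain_D[OF dom[OF i]]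
  have len: "length (snd c) = \<tau>" using c(1) by (simp add: good_def)
  have "fst (snd (\<rho> i)) = map read_sym (snd c)"
    by (rule nth_equalityI) (use d len syms in auto)
  moreover have "snd (snd (\<rho> i)) = map (\<lambda>tp. (fst tp (pos i), snd tp = pos i)) (snd c)"
  proof (rule nth_equalityI)
    fix j assume "j < length (snd (snd (\<rho> i)))"
    then have j: "j < \<tau>" using d by simp
    then show "snd (snd (\<rho> i)) ! j = map (\<lambda>tp. (fst tp (pos i), snd tp = pos i)) (snd c) ! j"
      using hd_iff[OF j] cell[OF i j] len by (simp add: prod_eq_iff hd_at_def sy_def)
  qed (use d len in simp)
  ultimately show ?thesis using st[OF i] by (simp add: opt_def prod_eq_iff)
qed

text \<open>The first row spells a certificate; afterwards each row is forced by its predecessor, so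
  the tableau is the run on that input.\<close>

lemma tab_imp_accepts:
  assumes tab: "tab \<sigma>"
  shows "\<exists>u. length u \<le> U \<and> accepts (xs @ u)"
proof -
  have dom: "\<sigma> t i \<in> domain" and nobad: "\<not> bad t i (\<sigma> t i)" if "t \<le> T" "i < W" for t i
    using tab that unfolding tab_def by blast+
  have nocl: "\<not> clash t i (\<sigma> t i) t' i' (\<sigma> t' i')"
    if "t \<le> T" "t' \<le> T" "i < W" "i' < W" "t * W + i < t' * W + i'" for t i t' i'
    using tab that unfolding tab_def by blast
  have agr: "agree (\<sigma> t i) (\<sigma> t i')" if "t \<le> T" "i < W" "i' < W" "i \<noteq> i'" for t i i'
  proof (cases "i < i'")
    case True
    then show ?thesis using nocl[of t t i i'] that by (auto simp: clash_def)
  next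
    case False
    then have "agree (\<sigma> t i') (\<sigma> t i)" using nocl[of t t i' i] that by (auto simp: clash_def)
    then show ?thesis by (auto simp: agree_def)
  qed
  have next_lt: "t * W + i < Suc t * W + i'" if "i < W" for t i i'
    using that by simp
  have kp: "keep (\<sigma> t i) (\<sigma> (Suc t) i)" if "t < T" "i < W" for t i
    using nocl[of t "Suc t" i i] next_lt[of i t i] that by (auto simp: clash_def)
  have mvs: "mv d (\<sigma> t i) (\<sigma> (Suc t) i')" if "t < T" "i < W" "i' < W" "pos i' = pos i + head_shift d" for t i i' d
  proof -
    have nc: "\<not> clash t i (\<sigma> t i) (Suc t) i' (\<sigma> (Suc t) i')"
      by (rule nocl) (use that next_lt[of i t i'] in auto)
    show ?thesis
    proof (cases d)
      case Move_Left
      then have "i = Suc i'" using that(4) by (simp add: pos_def)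
      then show ?thesis using nc Move_Left by (simp add: clash_def)
    next
      case Stay
      then have "i' = i" using that(4) by (simp add: pos_def)
      then show ?thesis using nc Stay by (simp add: clash_def)
    next
      case Move_Right
      then have "i' = Suc i" using that(4) by (simp add: pos_def)
      then show ?thesis using nc Move_Right by (simp add: clash_def)
    qed
  qed
  \<comment> \<open>The length of the guessed word: its first blank, or \<open>U\<close> if the area
    is full.\<close>
  define k where "k = (LEAST p. p \<ge> U \<or> sy (\<sigma> 0 (T + length xs + p)) 0 = 0)"
  define u where "u = map (\<lambda>p. sy (\<sigma> 0 (T + length xs + p)) 0 = 2) [0..<k]"
  have kU: "k \<le> U" unfolding k_def by (rule Least_le) simp
  have k_stop: "k \<ge> U \<or> sy (\<sigma> 0 (T + length xs + k)) 0 = 0"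
    unfolding k_def by (rule LeastI[of _ U]) simp
  have k_min: "p < U \<and> sy (\<sigma> 0 (T + length xs + p)) 0 \<noteq> 0" if "p < k" for p
    using not_less_Least[OF that[unfolded k_def]] by simp
  have init: "ini (cls i) (i = T) (\<sigma> 0 i)" if "i < W" for i
    using nobad[of 0 i] that by (auto simp: bad_def)
  have s0: "sy (\<sigma> 0 i) 0 = fst (input_tape (xs @ u)) (pos i)" if i: "i < W" for i
  proof -
    have c: "if cls i = 3 then sy (\<sigma> 0 i) 0 \<le> 2 else sy (\<sigma> 0 i) 0 = cls i"
      using init[OF i] by (simp add: ini_def)
    have p: "nat (pos i) = i - T" "0 \<le> pos i \<longleftrightarrow> T \<le> i" "pos i < int n \<longleftrightarrow> i < T + n"
      "pos i < int n + int n' \<longleftrightarrow> i < T + n + n'" for n n' by (auto simp: pos_def)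
    consider "i < T + length xs" | "T + length xs \<le> i" "i < T + length xs + U" | "i \<ge> T + length xs + U" by linarith
    then show ?thesis
    proof cases
      case 1
      then show ?thesis using c by (auto simp: cls_def input_tape_def p nthd_def nth_append)
    next
      case 2
      define r where "r = i - T - length xs"
      have r: "i = T + length xs + r" "r < U" using 2 by (auto simp: r_def)
      show ?thesis
      proof (cases "r < k")
        case True
        have "sy (\<sigma> 0 i) 0 \<le> 2" "sy (\<sigma> 0 i) 0 \<noteq> 0" using c 2 k_min[OF True] r by (auto simp: cls_def)
        then have "sy (\<sigma> 0 i) 0 = bit_sym (sy (\<sigma> 0 i) 0 = 2)"
          by (cases "sy (\<sigma> 0 i) 0 = 2") auto
        moreover have "fst (input_tape (xs @ u)) (pos i) = bit_sym (u ! r)"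
        proof -
          have pr: "pos i = int (length xs + r)" using r(1) by (simp add: pos_def)
          show ?thesis unfolding pr using True by (simp add: input_tape_def nth_append u_def del: of_nat_add)
        qed
        ultimately show ?thesis using True r by (simp add: u_def)
      next
        case False
        then have k0: "sy (\<sigma> 0 (T + length xs + k)) 0 = 0" using k_stop r by auto
        have "sy (\<sigma> 0 i) 0 = 0"
        proof (cases "r = k")
          case True
          then show ?thesis using k0 r by simp
        next
          case rk: False
          have "\<not> clash 0 (T + length xs + k) (\<sigma> 0 (T + length xs + k)) 0 i (\<sigma> 0 i)"
            by (rule nocl) (use False rk r i in auto)
          then have "blank (\<sigma> 0 (T + length xs + k)) (\<sigma> 0 i)" using False rk r by (auto simp: clash_def)
          then show ?thesis using k0 by (simp add: blank_def)
        qed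
        moreover have pr: "pos i = int (length xs + r)" using r(1) by (simp add: pos_def)
        ultimately show ?thesis unfolding pr using False by (simp add: input_tape_def u_def del: of_nat_add)
      qed
    next
      case 3
      then have "sy (\<sigma> 0 i) 0 = 0" using c by (simp add: cls_def)
      moreover have "pos i = int (i - T)" using 3 by (simp add: pos_def)
      ultimately show ?thesis using 3 kU by (auto simp: input_tape_def u_def)
    qed
  qed
  have rows: "\<forall>i<W. \<sigma> t i = opt (run (xs @ u) t) (pos i)" if "t \<le> T" for t
    using that
  proof (induction t)
    case 0
    have t0: "snd (run (xs @ u) 0) ! j = (if j = 0 then input_tape (xs @ u) else (\<lambda>_. 0, 0))" if "j < \<tau>" for j
      using that by (simp add: run_def init_tapes)
    show ?case
    proof (intro allI impI, rule tab_rowI[OF good_run])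
      fix i j assume i: "i < W" and j: "j < \<tau>"
      show "sy (\<sigma> 0 i) j = fst (snd (run (xs @ u) 0) ! j) (pos i)"
        using s0[OF i] init[OF i] j by (auto simp: t0 ini_def)
      assume "snd (snd (run (xs @ u) 0) ! j) = pos i"
      then have "i = T" using j by (simp add: t0 pos_def split: if_splits)
      then show "hd_at (\<sigma> 0 i) j" using init[OF i] j by (simp add: ini_def)
    next
      show "fst (\<sigma> 0 i) = fst (run (xs @ u) 0)" if "i < W" for i
        using init[OF that] by (simp add: run_def init_tapes ini_def)
      show "\<bar>snd (snd (run (xs @ u) 0) ! j)\<bar> \<le> int T" if "j < \<tau>" for j
        using head_bound[OF that, of "xs @ u" 0] by simp
    qed (use dom agr in auto)
  next
    case (Suc t)
    let ?c = "run (xs @ u) t"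
    have ih: "\<sigma> t i = opt ?c (pos i)" if "i < W" for i using Suc that by simp
    have tT: "t < T" using Suc.prems by simp
    note op = opt_simps[OF good_run]
    show ?case
    proof (intro allI impI, rule tab_rowI[OF good_run])
      fix i assume i: "i < W"
      have kp': "keep (opt ?c (pos i)) (\<sigma> (Suc t) i)" using kp[OF tT i] ih[OF i] by simp
      then show "fst (\<sigma> (Suc t) i) = fst (run (xs @ u) (Suc t))"
        by (simp add: keep_def run_step(1))
      fix j assume j: "j < \<tau>"
      show "sy (\<sigma> (Suc t) i) j = fst (snd (run (xs @ u) (Suc t)) ! j) (pos i)"
        using kp' j by (simp add: keep_def run_step(2)[OF j, where p = "pos i"] op)
      assume h: "snd (snd (run (xs @ u) (Suc t)) ! j) = pos i"
      \<comment> \<open>The column of the head one step earlier; its move must bring the head to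
        \<open>i\<close>, and \<open>mv\<close> demands it there.\<close>
      define k' where "k' = nat (snd (snd ?c ! j) + int T)"
      have k': "k' < W" "pos k' = snd (snd ?c ! j)"
        using head_bound[OF j, of "xs @ u" t] tT by (auto simp: k'_def pos_def W_def)
      have "pos i = pos k' + head_shift (snd (act (\<sigma> t k') j))"
        using h run_step(3)[OF j, where p = "pos k'" and t = t and z = "xs @ u"] k' ih by simp
      from mvs[OF tT k'(1) i this] show "hd_at (\<sigma> (Suc t) i) j"
        using j k' ih[OF k'(1)] by (simp add: mv_def op)
    next
      show "\<bar>snd (snd (run (xs @ u) (Suc t)) ! j)\<bar> \<le> int T" if "j < \<tau>" for j
        using head_bound[OF that, of "xs @ u" "Suc t"] Suc.prems by linarith
    qed (use dom[OF Suc.prems] agr[OF Suc.prems] in auto)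
  qed
  have "T < W" by (simp add: W_def)
  then have "fin_ok (\<sigma> T T)" using nobad[of T T] by (auto simp: bad_def)
  then have "accepts (xs @ u)"
    using rows[of T] \<open>T < W\<close> tau_pos 
    by (simp add: fin_ok_def accepts_iff opt_simps[OF good_run]) (simp add: pos_def)
  moreover have "length u \<le> U" using kU by (simp add: u_def)
  ultimately show ?thesis by blast
qed

theorem csp_accepts:
  "(\<exists>sel. csp_solution N (length dlist) cf sel) \<longleftrightarrow> (\<exists>u. length u \<le> U \<and> accepts (xs @ u))"
  using solution_imp_tab tab_imp_solution accepts_imp_tab tab_imp_accepts by blast

end

section \<open>Computing the instance: binary output, vertex numbers, constraint tables\<close>

section \<open>The encoding is computable in polynomial time\<close>

fun inc :: "bool list \<Rightarrow> bool list" where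
  "inc [] = [True]"
| "inc (False # bs) = True # bs"
| "inc (True # bs) = False # inc bs"

lemma binary_Suc: "binary (Suc n) = inc (binary n)"
proof (induction n rule: less_induct)
  case (less n)
  show ?case
  proof (cases "n = 0")
    case True
    then show ?thesis by (simp add: binary.simps[of "Suc 0"] binary.simps[of 0])
  next
    case False
    show ?thesis
    proof (cases "odd n")
      case True
      then have "Suc n div 2 = Suc (n div 2)" by presburger
      moreover have "binary (Suc (n div 2)) = inc (binary (n div 2))" using less False by simp
      ultimately show ?thesis using True False by (simp add: binary.simps[of "Suc n"] binary.simps[of n])
    next
      case even: False
      then have "Suc n div 2 = n div 2" by presburger
      then show ?thesis using even False by (simp add: binary.simps[of "Suc n"] binary.simps[of n])
    qed
  qed
qed

lemma binary_funpow: "binary n = (inc ^^ n) []"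
  by (induction n) (simp_all add: binary.simps[of 0] binary_Suc)

lemma length_inc: "length (inc bs) \<le> Suc (length bs)"
  by (induction bs rule: inc.induct) auto

lemma sz_bits_length: "length (bs :: bool list) \<le> sz bs" "sz (bs :: bool list) \<le> poly [:1, 4:] (length bs)"
  using length_le_sz sz_bits[of bs] by auto

lemma PT_inc [pt]:
  assumes "PT f"
  shows "PT (\<lambda>x. inc (f x))"
proof -
  \<comment> \<open>Ripple carry: the state is the carry and the reversed list of sum bits, where
    disequality acts as exclusive or.\<close>
  define step where "step = (\<lambda>(b :: bool) (p :: bool \<times> bool list). (fst p \<and> b, (b \<noteq> fst p) # snd p))"
  have *: "PT (\<lambda>x. fold (\<lambda>b p. step b p) (f x) (True, []))"
    by (rule PT_fold_inc[where P = "[:6:]"], intro assms, intro pt, unfold step_def, intro pt)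
      (auto simp: sz_prod sz_bool)
  have "PT (\<lambda>x. rev (snd (fold (\<lambda>b p. step b p) (f x) (True, []))) @
      (if fst (fold (\<lambda>b p. step b p) (f x) (True, [])) then [True] else []))"
    by (intro PT_append PT_rev PT_snd PT_if PT_fst * PT_const)
  then show ?thesis
  proof (rule PT_recode)
    have "rev (snd (fold (\<lambda>b p. step b p) bs (c, acc))) @ (if fst (fold (\<lambda>b p. step b p) bs (c, acc)) then [True] else [])
        = rev acc @ (if c then inc bs else bs)" for bs c acc
      by (induction bs arbitrary: c acc) (auto simp: step_def)
    from this[of "f _" True "[]"]
    show "tt (inc (f x)) = tt (rev (snd (fold (\<lambda>b p. step b p) (f x) (True, []))) @
      (if fst (fold (\<lambda>b p. step b p) (f x) (True, [])) then [True] else []))" for x by simp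
  qed
qed

text \<open>A unary number is converted by incrementing that often. Length is the measure, since one
  increment can change many bits and with them \<open>sz\<close>.\<close>

lemma PT_binary [pt]: "PT f \<Longrightarrow> PT (\<lambda>x. binary (f x))"
  unfolding binary_funpow
proof (rule PT_funpow_measure[where m = length and K = "[:1, 4:]" and P = "[:1:]"])
  show "length (inc y) \<le> length y + poly [:1:] (sz x)" for x :: 'a and y
    using length_inc[of y] by simp
qed (intro pt sz_bits_length | assumption)+

lemma PT_self_delim [pt]: "PT f \<Longrightarrow> PT (\<lambda>x. self_delim (f x))"
  unfolding self_delim_def by (intro pt)

lemma PT_enc_nat [pt]: "PT f \<Longrightarrow> PT (\<lambda>x. enc_nat (f x))"
  unfolding enc_nat_def by (intro pt)

lemma PT_enc_list [pt]:
  "PT (\<lambda>p. f (fst p) (snd p)) \<Longrightarrow> PT g \<Longrightarrow> PT (\<lambda>x. enc_list (f x) (g x))"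
  unfolding enc_list_def by (intro pt)

lemma enc_entry_eq: "enc_entry e = enc_nat (fst e) @ enc_nat (fst (snd e)) @ enc_nat (fst (snd (snd e))) @ enc_nat (snd (snd (snd e)))"
  by (cases e) simp

lemma PT_enc_entry [pt]: "PT f \<Longrightarrow> PT (\<lambda>x. enc_entry (f x))"
  unfolding enc_entry_eq by (intro pt)

lemma PT_enc_data [pt]:
  "PT d \<Longrightarrow> PT n \<Longrightarrow> PT es \<Longrightarrow> PT s \<Longrightarrow> PT t \<Longrightarrow> PT k \<Longrightarrow>
    PT (\<lambda>x. enc_data (d x) (n x) (es x) (s x) (t x) (k x))"
  unfolding enc_data_def by (intro pt)

section \<open>Hardness\<close>

subsection \<open>Numbering the vertices\<close>

text \<open>Six digits in base \<open>B\<close> below a leading digit that tells the kind of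
  vertex.\<close>

definition enc7 :: "nat \<Rightarrow> nat \<Rightarrow> nat \<Rightarrow> nat \<Rightarrow> nat \<Rightarrow> nat \<Rightarrow> nat \<Rightarrow> nat \<Rightarrow> nat" where
  "enc7 B a g j g' j' r l = (((((a * B + g) * B + j) * B + g') * B + j') * B + r) * B + l"

fun vcode :: "nat \<Rightarrow> vtx \<Rightarrow> nat" where
  "vcode B (V g) = enc7 B 0 g 0 0 0 0 0"
| "vcode B (Y g j) = enc7 B 1 g j 0 0 0 0"
| "vcode B (X g j) = enc7 B 2 g j 0 0 0 0"
| "vcode B (E g j g' j' r l) = enc7 B 3 g j g' j' r l"

lemma digit_inject:
  assumes "b < B" "b' < B"
  shows "a * B + b = a' * B + b' \<longleftrightarrow> a = a' \<and> b = (b' :: nat)"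
proof
  assume e: "a * B + b = a' * B + b'"
  have "(a * B + b) div B = a" "(a' * B + b') div B = a'" using assms by auto
  then have "a = a'" using e by simp
  then show "a = a' \<and> b = b'" using e by simp
qed simp

lemma enc7_inject:
  assumes "g < B" "j < B" "g' < B" "j' < B" "r < B" "l < B"
    "h < B" "i < B" "h' < B" "i' < B" "q < B" "k < B"
  shows "enc7 B a g j g' j' r l = enc7 B b h i h' i' q k \<longleftrightarrow>
    a = b \<and> g = h \<and> j = i \<and> g' = h' \<and> j' = i' \<and> r = q \<and> l = k"
  unfolding enc7_def using assms by (simp add: digit_inject)

lemma digit_less: "a < A \<Longrightarrow> b < B \<Longrightarrow> a * B + b < A * (B :: nat)"
proof -
  assume "a < A" "b < B"
  then have "Suc a * B \<le> A * B" by (intro mult_right_mono) auto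
  then show ?thesis using \<open>b < B\<close> by simp
qed

lemma enc7_less:
  "a < 4 \<Longrightarrow> g < B \<Longrightarrow> j < B \<Longrightarrow> g' < B \<Longrightarrow> j' < B \<Longrightarrow> r < B \<Longrightarrow> l < B \<Longrightarrow>
    enc7 B a g j g' j' r l < 4 * B * B * B * B * B * B"
  unfolding enc7_def by (intro digit_less)

text \<open>Larger than every index in use: groups up to \<open>N\<close>, values below
  \<open>m\<close>, copies below \<open>N * m + 2\<close>, layers below
  \<open>3 * N\<close>.\<close>

definition radix :: "nat \<Rightarrow> nat \<Rightarrow> nat" where
  "radix N m = N * m + 3 * N + m + 4"

lemma csp_vertices_cases:
  assumes "v \<in> csp_vertices N m"
  shows "(\<exists>g<radix N m. v = V g) \<or> (\<exists>g<radix N m. \<exists>j<radix N m. v = Y g j) \<or>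
    (\<exists>g<radix N m. \<exists>j<radix N m. v = X g j) \<or>
    (\<exists>g<radix N m. \<exists>j<radix N m. \<exists>g'<radix N m. \<exists>j'<radix N m. \<exists>r<radix N m. \<exists>l<radix N m. v = E g j g' j' r l)"
proof -
  have b: "g < radix N m" if "g \<le> N \<or> g < N \<or> g < m \<or> g < N * m + 2 \<or> g < 3 * N" for g
    using that by (auto simp: radix_def)
  show ?thesis using assms unfolding csp_vertices_def by (auto intro: b) (use b in \<open>simp_all add: numeral_2_eq_2\<close>)
qed

lemma inj_vcode: "inj_on (vcode (radix N m)) (csp_vertices N m)"
proof (rule inj_onI)
  fix u v assume uv: "u \<in> csp_vertices N m" "v \<in> csp_vertices N m" "vcode (radix N m) u = vcode (radix N m) v"
  have "0 < radix N m" by (simp add: radix_def)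
  then show "u = v"
    using csp_vertices_cases[OF uv(1)] csp_vertices_cases[OF uv(2)] uv(3)
    by (elim disjE exE conjE) (simp_all add: enc7_inject)
qed

lemma vcode_less:
  assumes "v \<in> csp_vertices N m"
  shows "vcode (radix N m) v < 4 * radix N m * radix N m * radix N m * radix N m * radix N m * radix N m"
proof -
  have "0 < radix N m" by (simp add: radix_def)
  then show ?thesis
    using csp_vertices_cases[OF assms] by (elim disjE exE conjE) (simp_all add: enc7_less)
qed

definition code_list ::
  "nat \<Rightarrow> nat \<Rightarrow> nat \<Rightarrow> (nat \<Rightarrow> nat \<Rightarrow> nat \<Rightarrow> nat \<Rightarrow> bool) \<Rightarrow> (nat \<times> nat) list" where
  "code_list N m B cf =
     concat (map (\<lambda>g. concat (map (\<lambda>j.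
       [(vcode B (V g), vcode B (Y g j)), (vcode B (Y g j), vcode B (X g j)), (vcode B (X g j), vcode B (V (Suc g)))])
       [0..<m])) [0..<N]) @
     concat (map (\<lambda>g. concat (map (\<lambda>j. concat (map (\<lambda>g'. concat (map (\<lambda>j'.
       if g < g' \<and> cf g j g' j' then concat (map (\<lambda>r. map (\<lambda>l.
         (vcode B (ear g j g' j' r l), vcode B (ear g j g' j' r (Suc l)))) [3 * g + 2..<3 * g' + 1]) [0..<N * m + 2])
       else []) [0..<m])) [0..<N])) [0..<m])) [0..<N])"

lemma set_code_list:
  "set (code_list N m B cf) = (\<lambda>(a, b). (vcode B a, vcode B b)) ` csp_arcs N m cf"
proof (intro equalityI subsetI)
  have in_concat_map: "e \<in> set (concat (map f xs)) \<longleftrightarrow> (\<exists>x\<in>set xs. e \<in> set (f x))"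
    for e :: "nat \<times> nat" and f and xs :: "nat list" by auto
  have in_map: "e \<in> set (map f xs) \<longleftrightarrow> (\<exists>x\<in>set xs. e = f x)"
    for e :: "nat \<times> nat" and f and xs :: "nat list" by auto
  have in_if: "e \<in> set (if c then A else []) \<longleftrightarrow> c \<and> e \<in> set A" for e :: "nat \<times> nat" and c A by auto
  have code_list_iff: "e \<in> set (code_list N m B cf) \<longleftrightarrow>
    (\<exists>g\<in>{0..<N}. \<exists>j\<in>{0..<m}. e \<in> set [(vcode B (V g), vcode B (Y g j)), (vcode B (Y g j), vcode B (X g j)),
        (vcode B (X g j), vcode B (V (Suc g)))]) \<or>
    (\<exists>g\<in>{0..<N}. \<exists>j\<in>{0..<m}. \<exists>g'\<in>{0..<N}. \<exists>j'\<in>{0..<m}. (g < g' \<and> cf g j g' j') \<and>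
        (\<exists>r\<in>{0..<N * m + 2}. \<exists>l\<in>{3 * g + 2..<3 * g' + 1}.
          e = (vcode B (ear g j g' j' r l), vcode B (ear g j g' j' r (Suc l)))))" for e
    unfolding code_list_def by (simp only: set_append Un_iff in_concat_map in_map in_if set_upt)
  {
    fix e assume "e \<in> set (code_list N m B cf)"
    then have "(\<exists>g\<in>{0..<N}. \<exists>j\<in>{0..<m}. e \<in> set [(vcode B (V g), vcode B (Y g j)), (vcode B (Y g j), vcode B (X g j)),
          (vcode B (X g j), vcode B (V (Suc g)))]) \<or>
      (\<exists>g\<in>{0..<N}. \<exists>j\<in>{0..<m}. \<exists>g'\<in>{0..<N}. \<exists>j'\<in>{0..<m}. (g < g' \<and> cf g j g' j') \<and>
        (\<exists>r\<in>{0..<N * m + 2}. \<exists>l\<in>{3 * g + 2..<3 * g' + 1}.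
          e = (vcode B (ear g j g' j' r l), vcode B (ear g j g' j' r (Suc l)))))"
      unfolding code_list_iff .
    then show "e \<in> (\<lambda>(a, b). (vcode B a, vcode B b)) ` csp_arcs N m cf"
    proof (elim disjE bexE conjE)
      fix g j assume 1: "g \<in> {0..<N}" "j \<in> {0..<m}" "e \<in> set [(vcode B (V g), vcode B (Y g j)), (vcode B (Y g j), vcode B (X g j)),
          (vcode B (X g j), vcode B (V (Suc g)))]"
      then have arc: "(V g, Y g j) \<in> csp_arcs N m cf" "(Y g j, X g j) \<in> csp_arcs N m cf" "(X g j, V (Suc g)) \<in> csp_arcs N m cf"
        by (auto simp: csp_arcs_def)
      have "e = (vcode B (V g), vcode B (Y g j)) \<or> e = (vcode B (Y g j), vcode B (X g j)) \<or> e = (vcode B (X g j), vcode B (V (Suc g)))"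
        using 1(3) by (simp del: vcode.simps)
      then show ?thesis
        by (elim disjE) (rule rev_image_eqI[OF arc(1)], simp, rule rev_image_eqI[OF arc(2)], simp, rule rev_image_eqI[OF arc(3)], simp)
    next
      fix g j g' j' r l
      assume 2: "g \<in> {0..<N}" "j \<in> {0..<m}" "g' \<in> {0..<N}" "j' \<in> {0..<m}" "g < g'" "cf g j g' j'" "r \<in> {0..<N * m + 2}"
        "l \<in> {3 * g + 2..<3 * g' + 1}" "e = (vcode B (ear g j g' j' r l), vcode B (ear g j g' j' r (Suc l)))"
      then have "(ear g j g' j' r l, ear g j g' j' r (Suc l)) \<in> csp_arcs N m cf"
        by (intro arc_ear) auto
      then show ?thesis unfolding 2(9) by (rule rev_image_eqI) simp
    qed
  }
  fix e assume "e \<in> (\<lambda>(a, b). (vcode B a, vcode B b)) ` csp_arcs N m cf"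
  then obtain a b where ab: "(a, b) \<in> csp_arcs N m cf" "e = (vcode B a, vcode B b)" by auto
  from ab(1) consider g j where "g < N" "j < m" "(a, b) = (V g, Y g j) \<or> (a, b) = (Y g j, X g j) \<or> (a, b) = (X g j, V (Suc g))"
    | g j g' j' r l where "g < g'" "g' < N" "j < m" "j' < m" "cf g j g' j'" "r < N * m + 2" "3 * g + 2 \<le> l" "l < 3 * g' + 1"
      "(a, b) = (ear g j g' j' r l, ear g j g' j' r (Suc l))"
    unfolding csp_arcs_def by blast
  then show "e \<in> set (code_list N m B cf)"
  proof cases
    case 1
    then have "e \<in> set [(vcode B (V g), vcode B (Y g j)), (vcode B (Y g j), vcode B (X g j)),
        (vcode B (X g j), vcode B (V (Suc g)))]"
      using ab(2) by (auto simp del: vcode.simps)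
    then show ?thesis using 1(1,2) unfolding code_list_iff
      by - (rule disjI1, rule bexI[of _ g], rule bexI[of _ j], auto simp del: vcode.simps)
  next
    case 2
    then have "e = (vcode B (ear g j g' j' r l), vcode B (ear g j g' j' r (Suc l)))" using ab(2) by simp
    then show ?thesis using 2(1-8) unfolding code_list_iff
      by - (rule disjI2, rule bexI[of _ g], rule bexI[of _ j], rule bexI[of _ g'], rule bexI[of _ j'], rule conjI,
          simp, rule bexI[of _ r], rule bexI[of _ l], auto simp del: vcode.simps)
  qed
qed

text \<open>The vertex count is the range of seven-digit codes with leading digit below 4; numbers
  that code no gadget vertex become isolated vertices. \<open>dedup\<close> supplies the
  distinctness demanded of the edge list.\<close>

definition csp_encoding ::
  "nat \<Rightarrow> nat \<Rightarrow> (nat \<Rightarrow> nat \<Rightarrow> nat \<Rightarrow> nat \<Rightarrow> bool) \<Rightarrow> bool list" where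
  "csp_encoding N m cf = (let B = radix N m in
     enc_data False (4 * B * B * B * B * B * B) (map (\<lambda>e. (fst e, snd e, 1, 1)) (dedup (code_list N m B cf)))
       (vcode B (V 0)) (vcode B (V N)) (N * m))"

text \<open>An encoding determines the weights on edges only, so notions must be shown independent
  of the values elsewhere.\<close>

lemma shortest_path_cong:
  assumes "\<And>e. e \<in> edges G \<Longrightarrow> w e = w' e"
  shows "shortest_path G w s t P \<longleftrightarrow> shortest_path G w' s t P"
proof -
  have "path_weight G w P = path_weight G w' P" if "st_path G s t P" for P
    unfolding path_weight_def by (rule sum.cong) (use that assms in \<open>auto simp: st_path_def\<close>)
  then show ?thesis by (auto simp: shortest_path_def)
qed

lemma anti_forcing_set_cong:
  assumes "\<And>e. e \<in> edges G \<Longrightarrow> w e = w' e"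
  shows "anti_forcing_set G w s t S \<longleftrightarrow> anti_forcing_set G w' s t S"
  unfolding anti_forcing_set_def using shortest_path_cong[of G w w', OF assms] by simp

lemma encoded_ANTI_FORCING_iff:
  assumes "encodes_instance y G w s t k" "valid_instance G w s t"
  shows "y \<in> ANTI_FORCING \<longleftrightarrow> (\<exists>S. anti_forcing_set G w s t S \<and> card S \<le> k)" (is ?A)
    and "y \<in> ANTI_FORCING_undirected_unit \<longleftrightarrow> \<not> is_directed G \<and> (\<forall>e\<in>edges G. w e = 1) \<and>
      (\<exists>S. anti_forcing_set G w s t S \<and> card S \<le> k)" (is ?B)
proof -
  have u: "G' = G \<and> (\<forall>e\<in>edges G. w' e = w e) \<and> s' = s \<and> t' = t \<and> k' = k"
    if "encodes_instance y G' w' s' t' k'" for G' w' s' t' k'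
    using encodes_instance_unique[OF that assms(1)] by auto
  have c: "anti_forcing_set G w' s t S \<longleftrightarrow> anti_forcing_set G w s t S" if "\<forall>e\<in>edges G. w' e = w e" for w' S
    by (rule anti_forcing_set_cong) (use that in auto)
  show ?A
  proof
    assume "y \<in> ANTI_FORCING"
    then obtain G' w' s' t' k' S where "encodes_instance y G' w' s' t' k'" "anti_forcing_set G' w' s' t' S" "card S \<le> k'"
      unfolding ANTI_FORCING_def by blast
    then show "\<exists>S. anti_forcing_set G w s t S \<and> card S \<le> k" using u[of G' w' s' t' k'] c by blast
  qed (use assms in \<open>unfold ANTI_FORCING_def, blast\<close>)
  show ?B
  proof
    assume "y \<in> ANTI_FORCING_undirected_unit"
    then obtain G' w' s' t' k' S where 1: "encodes_instance y G' w' s' t' k'" "anti_forcing_set G' w' s' t' S"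
      "card S \<le> k'" "\<not> is_directed G'" "\<forall>e\<in>edges G'. w' e = 1"
      unfolding ANTI_FORCING_undirected_unit_def by blast
    note 2 = u[OF 1(1)]
    have "\<forall>e\<in>edges G. w e = 1" using 1(5) 2 by auto
    then show "\<not> is_directed G \<and> (\<forall>e\<in>edges G. w e = 1) \<and> (\<exists>S. anti_forcing_set G w s t S \<and> card S \<le> k)"
      using 1 2 c by blast
  qed (use assms in \<open>unfold ANTI_FORCING_undirected_unit_def, blast\<close>)
qed

theorem csp_encoding_correct:
  assumes N: "N > 0" and m: "m > 0"
  shows "csp_encoding N m cf \<in> ANTI_FORCING \<longleftrightarrow> (\<exists>sel. csp_solution N m cf sel)"
    and "csp_encoding N m cf \<in> ANTI_FORCING_undirected_unit \<longleftrightarrow> (\<exists>sel. csp_solution N m cf sel)"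
proof -
  define B where "B = radix N m"
  define n where "n = 4 * B * B * B * B * B * B"
  define es where "es = map (\<lambda>e. (fst e, snd e, 1 :: nat, 1 :: nat)) (dedup (code_list N m B cf))"
  define G where "G = \<lparr>is_directed = False, verts = {..<n},
    edges = (\<lambda>(a, b). Link {vcode B a, vcode B b}) ` csp_arcs N m cf\<rparr>"
  let ?w = "\<lambda>_ :: nat edge. 1 :: real"
  have V: "v \<in> csp_vertices N m" if "v \<in> Field (csp_arcs N m cf)" for v
    using that Field_csp_arcs by blast
  have V_Field: "V 0 \<in> Field (csp_arcs N m cf)" "V N \<in> Field (csp_arcs N m cf)"
  proof -
    have "(V 0, Y 0 0) \<in> csp_arcs N m cf" using N m by (auto simp: csp_arcs_def)
    then show "V 0 \<in> Field (csp_arcs N m cf)" by (rule FieldI1)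
    have "(X (N - 1) 0, V (Suc (N - 1))) \<in> csp_arcs N m cf" using N m by (force simp: csp_arcs_def)
    then show "V N \<in> Field (csp_arcs N m cf)" using N by (auto intro: FieldI2)
  qed
  have less: "vcode B v < n" if "v \<in> Field (csp_arcs N m cf)" for v
    unfolding n_def B_def by (rule vcode_less[OF V[OF that]])
  interpret csp_graph N m cf "vcode B" G ?w
  proof
    show "inj_on (vcode B) (Field (csp_arcs N m cf))"
      unfolding B_def by (rule inj_on_subset[OF inj_vcode Field_csp_arcs])
    show "vcode B ` Field (csp_arcs N m cf) \<subseteq> verts G" using less by (auto simp: G_def)
  qed (use N V_Field csp_arcs_layer finite_csp_arcs in \<open>auto simp: G_def\<close>)
  have edge: "edge_of G a b = Link {a, b}" for a b by (simp add: edge_of_def G_def)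
  have enc: "encodes_instance (csp_encoding N m cf) G ?w (vcode B (V 0)) (vcode B (V N)) (N * m)"
    unfolding encodes_instance_def
  proof (intro exI[of _ n] exI[of _ es] conjI)
    show "csp_encoding N m cf = enc_data (is_directed G) n es (vcode B (V 0)) (vcode B (V N)) (N * m)"
      by (simp add: csp_encoding_def Let_def B_def n_def es_def G_def)
    show "verts G = {..<n}" by (simp add: G_def)
    show "edges G = (\<lambda>(u, v, a, b). edge_of G u v) ` set es"
      by (force simp: es_def edge set_code_list edges_G)
    have "map (\<lambda>(u, v, a, b). edge_of G u v) es = map (\<lambda>e. Link {fst e, snd e}) (dedup (code_list N m B cf))"
      by (simp add: es_def edge)
    moreover have "inj_on (\<lambda>e. Link {fst e, snd e}) (set (code_list N m B cf))"
    proof -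
      have "(\<lambda>e. Link {fst e, snd e}) \<circ> (\<lambda>(a, b). (vcode B a, vcode B b)) = link"
        by (auto simp: fun_eq_iff link_def)
      then have "inj_on ((\<lambda>e. Link {fst e, snd e}) \<circ> (\<lambda>(a, b). (vcode B a, vcode B b))) (csp_arcs N m cf)"
        using inj_link by simp
      then show ?thesis unfolding set_code_list by (rule inj_on_imageI)
    qed
    ultimately show "distinct (map (\<lambda>(u, v, a, b). edge_of G u v) es)"
      by (simp add: distinct_map)
    show "\<forall>(u, v, a, b)\<in>set es. b \<noteq> 0 \<and> 1 = real a / real b" by (auto simp: es_def)
  qed
  have val: "valid_instance G ?w (vcode B (V 0)) (vcode B (V N))"
  proof -
    have "vcode B a \<noteq> vcode B b" "a \<in> Field (csp_arcs N m cf)" "b \<in> Field (csp_arcs N m cf)"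
      if "(a, b) \<in> csp_arcs N m cf" for a b
    proof -
      show F: "a \<in> Field (csp_arcs N m cf)" "b \<in> Field (csp_arcs N m cf)"
        using that by (auto intro: FieldI1 FieldI2)
      have "a \<noteq> b" using csp_arcs_layer[OF that] by auto
      then show "vcode B a \<noteq> vcode B b" using inj_onD[OF inj _ F] by blast
    qed
    note arc = this
    have "edges G \<subseteq> {edge_of G u v |u v. u \<in> verts G \<and> v \<in> verts G \<and> u \<noteq> v}"
    proof
      fix e assume "e \<in> edges G"
      then obtain a b where ab: "(a, b) \<in> csp_arcs N m cf" "e = edge_of G (vcode B a) (vcode B b)"
        by (auto simp: edge edges_G)
      have "vcode B a \<in> verts G" "vcode B b \<in> verts G"
        using less arc(2,3)[OF ab(1)] by (auto simp: G_def)
      then show "e \<in> {edge_of G u v |u v. u \<in> verts G \<and> v \<in> verts G \<and> u \<noteq> v}"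
        using ab(2) arc(1)[OF ab(1)] by blast
    qed
    moreover have "verts G = {..<n}" by (simp add: G_def)
    ultimately show ?thesis using less[OF V_Field(1)] less[OF V_Field(2)]
      by (simp add: valid_instance_def wf_graph_def del: vcode.simps)
  qed
  note iff = encoded_ANTI_FORCING_iff[OF enc val] csp_anti_forcing[OF m]
  show "csp_encoding N m cf \<in> ANTI_FORCING \<longleftrightarrow> (\<exists>sel. csp_solution N m cf sel)"
    using iff by simp
  show "csp_encoding N m cf \<in> ANTI_FORCING_undirected_unit \<longleftrightarrow> (\<exists>sel. csp_solution N m cf sel)"
    using iff undirected by simp
qed

subsection \<open>The reduction is computable in polynomial time\<close>

lemma PT_enc7 [pt]:
  "PT B \<Longrightarrow> PT a \<Longrightarrow> PT g \<Longrightarrow> PT j \<Longrightarrow> PT g' \<Longrightarrow> PT j' \<Longrightarrow> PT r \<Longrightarrow> PT l \<Longrightarrow>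
    PT (\<lambda>x. enc7 (B x) (a x) (g x) (j x) (g' x) (j' x) (r x) (l x))"
  unfolding enc7_def by (intro pt)

lemma PT_vcode_ear [pt]:
  "PT B \<Longrightarrow> PT g \<Longrightarrow> PT j \<Longrightarrow> PT g' \<Longrightarrow> PT j' \<Longrightarrow> PT r \<Longrightarrow> PT l \<Longrightarrow>
    PT (\<lambda>x. vcode (B x) (ear (g x) (j x) (g' x) (j' x) (r x) (l x)))"
  unfolding ear_def if_distrib[of "vcode _"] vcode.simps by (intro pt)

lemma PT_csp_encoding:
  assumes "PT N" "PT m"
    and cf: "PT (\<lambda>p. cf (fst p) (fst (snd p)) (fst (snd (snd p))) (fst (snd (snd (snd p)))) (snd (snd (snd (snd p)))))"
  shows "PT (\<lambda>x. csp_encoding (N x) (m x) (cf x))"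
proof -
  have cf': "PT (\<lambda>x. cf (a x) (g x) (j x) (g' x) (j' x))" if "PT a" "PT g" "PT j" "PT g'" "PT j'"
    for a :: "'z::ptc \<Rightarrow> 'a" and g j g' j'
    using PT_comp[OF cf PT_Pair[OF that(1) PT_Pair[OF that(2) PT_Pair[OF that(3) PT_Pair[OF that(4,5)]]]]] by simp
  note [pt] = cf' PT_comp[OF assms(1)] PT_comp[OF assms(2)]
  show ?thesis
    unfolding csp_encoding_def Let_def radix_def code_list_def vcode.simps by (intro pt)
qed

text \<open>Two nested tables; the bounds \<open>j x < m\<close> and \<open>j' x < m\<close> are
  part of the predicate so that the default case is false.\<close>

lemma PT_table2:
  fixes j j' :: "'x::ptc \<Rightarrow> nat"
  assumes "PT j" "PT j'" "\<And>c d. c < m \<Longrightarrow> d < m \<Longrightarrow> PT (h c d)"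
  shows "PT (\<lambda>x. j x < m \<and> j' x < m \<and> h (j x) (j' x) x)"
proof -
  have "PT (\<lambda>x. if j x < m then if j' x < m then h (j x) (j' x) x else False else False)"
    by (rule PT_table[where h = "\<lambda>c x. if j' x < m then h c (j' x) x else False"], rule assms, rule PT_table)
      (use assms in \<open>auto intro: PT_const\<close>)
  then show ?thesis by (rule PT_recode) auto
qed

lemma PT_tableau_cf:
  fixes xs :: "'x::ptc \<Rightarrow> bool list"
  assumes [pt]: "PT xs" "PT U" "PT T" "PT g" "PT j" "PT g'" "PT j'"
  shows "PT (\<lambda>x. j x < m \<and> j' x < m \<and> tableau_data.cf M (xs x) (U x) (T x) (g x) (j x) (g' x) (j' x))"
proof -
  \<comment> \<open>Reordered so that each quantifier over tapes concerns the fixed value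
    \<open>v\<close> alone and counts as a constant; what remains depends on the input through
    \<open>b\<close> and \<open>c\<close> only.\<close>
  have ini: "tableau_data.ini M c b v = (fst v = 0 \<and> (b \<longrightarrow> (\<forall>j<tableau_data.\<tau> M. tableau_data.hd_at v j)) \<and>
      (\<forall>j<tableau_data.\<tau> M. j \<noteq> 0 \<longrightarrow> tableau_data.sy v j = 0) \<and> (if c = 3 then tableau_data.sy v 0 \<le> 2 else tableau_data.sy v 0 = c))"
    for c b v unfolding tableau_data.ini_def by auto
  have "PT (\<lambda>x. tableau_data.ini M (tableau_data.cls (xs x) (U x) (T x) (f x)) (b x) v)" if [pt]: "PT f" "PT b" for f b v
    unfolding ini tableau_data.cls_def by (intro pt)
  note [pt] = this
  have "PT (\<lambda>x. tableau_data.bad M (xs x) (U x) (T x) (t x) (i x) v)" if [pt]: "PT t" "PT i" for t i v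
    unfolding tableau_data.bad_def by (intro pt)
  note [pt] = this
  have "PT (\<lambda>x. tableau_data.clash M (xs x) (T x) (t x) (i x) v (t' x) (i' x) v')"
    if [pt]: "PT t" "PT i" "PT t'" "PT i'" for t i t' i' v v'
    unfolding tableau_data.clash_def by (intro pt)
  note [pt] = this
  have "PT (\<lambda>x. tableau_data.W (T x))" unfolding tableau_data.W_def by (intro pt)
  note [pt] = this
  show ?thesis
    unfolding tableau_data.cf_def by (rule PT_table2) (intro pt)+
qed

theorem NP_reduction:
  assumes "in_NP L"
  shows "\<exists>f. poly_time_computable f \<and> (\<forall>x. x \<in> L \<longleftrightarrow> f x \<in> ANTI_FORCING) \<and>
    (\<forall>x. x \<in> L \<longleftrightarrow> f x \<in> ANTI_FORCING_undirected_unit)"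
proof -
  obtain V p where V: "in_P V" and L: "\<And>x. x \<in> L \<longleftrightarrow> (\<exists>u. length u \<le> poly p (length x) \<and> pair_str x u \<in> V)"
    using assms unfolding in_NP_def by blast
  obtain M q where M: "wf_tm M" and run: "\<And>z. case (tm_step M ^^ poly q (length z)) (init_config M z) of (qh, tps) \<Rightarrow>
      qh = num_states M \<and> tape_output (last tps) [z \<in> V]"
    using V unfolding in_P_def poly_time_computable_def by blast
  define Z where "Z x = self_delim x" for x
  define U where "U x = poly p (length x)" for x :: "bool list"
  \<comment> \<open>Enough time for every certificate of length at most \<open>U x\<close>, plus
    room for the input, plus 1 to make \<open>T x\<close> positive.\<close>
  define T where "T x = poly q (length (Z x) + U x) + (length (Z x) + U x) + 1" for x
  define m where "m = length (tableau_data.dlist M)"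
  \<comment> \<open>Restricting to indices below \<open>m\<close> makes the predicate a finite table
    and leaves the solutions unchanged, since selected values are below \<open>m\<close>.\<close>
  define conf where "conf x g j g' j' \<longleftrightarrow> j < m \<and> j' < m \<and> tableau_data.cf M (Z x) (U x) (T x) g j g' j'" for x g j g' j'
  define f where "f x = csp_encoding (tableau_data.N (T x)) m (conf x)" for x
  have "PT f"
    unfolding f_def conf_def T_def U_def Z_def tableau_data.N_def tableau_data.W_def
    by (intro PT_csp_encoding PT_tableau_cf pt)
  then have "poly_time_computable f" by (rule PT_poly_time)
  moreover have "f x \<in> ANTI_FORCING \<longleftrightarrow> x \<in> L" "f x \<in> ANTI_FORCING_undirected_unit \<longleftrightarrow> x \<in> L" for x
  proof -
    interpret tableau M "Z x" "U x" "T x"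
      by standard (use M in \<open>auto simp: T_def\<close>)
    have m: "m > 0" using dlist_pos by (simp add: m_def)
    have N0: "N > 0" by (simp add: N_def W_def)
    \<comment> \<open>The machine has halted before time \<open>T x\<close>, and the remaining steps
      do not change its output tape.\<close>
    have acc: "accepts (Z x @ u) \<longleftrightarrow> pair_str x u \<in> V" if "length u \<le> U x" for u
    proof -
      define z where "z = Z x @ u"
      obtain qh tps where s: "(tm_step M ^^ poly q (length z)) (init_config M z) = (qh, tps)"
        by (cases "(tm_step M ^^ poly q (length z)) (init_config M z)") blast
      then have h: "qh = num_states M" "tape_output (last tps) [z \<in> V]" using run[of z] by auto
      have "poly q (length z) \<le> poly q (length (Z x) + U x)"
        by (rule poly_mono_nat) (use that in \<open>simp add: z_def\<close>)
      then have "T x = (T x - poly q (length z)) + poly q (length z)" by (simp add: T_def)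
      then have "(tm_step M ^^ T x) (init_config M z) = (tm_step M ^^ (T x - poly q (length z))) (qh, tps)"
        using s by (metis funpow_add o_apply)
      also have "\<dots> = (qh, tps)" by (rule tm_halted) (simp add: h)
      finally have "snd (local.run z (T x)) = tps" by (simp add: run_def)
      moreover have "fst (last tps) 0 = bit_sym (z \<in> V)" using h(2) by (simp add: tape_output_def)
      ultimately have "accepts z \<longleftrightarrow> z \<in> V" by (cases "z \<in> V") (simp_all add: accepts_def)
      then show ?thesis by (simp add: z_def Z_def pair_str_def)
    qed
    have "(\<exists>sel. csp_solution N m (conf x) sel) \<longleftrightarrow> (\<exists>sel. csp_solution N (length dlist) local.cf sel)"
      by (intro ex_cong1) (auto simp: csp_solution_def m_def conf_def)
    also have "\<dots> \<longleftrightarrow> x \<in> L" using csp_accepts acc L by (auto simp: U_def)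
    finally show "f x \<in> ANTI_FORCING \<longleftrightarrow> x \<in> L" "f x \<in> ANTI_FORCING_undirected_unit \<longleftrightarrow> x \<in> L"
      using csp_encoding_correct[OF N0 m, of "conf x"] by (simp_all add: f_def)
  qed
  ultimately show ?thesis by blast
qed

lemma NP_hard_ANTI_FORCING: "NP_hard ANTI_FORCING" "NP_hard ANTI_FORCING_undirected_unit"
  unfolding NP_hard_def poly_time_reducible_def using NP_reduction by blast+

section \<open>Potentials and tight edges: duality for shortest paths\<close>

section \<open>Certificates for anti-forcing sets\<close>

text \<open>All weights share the denominator \<open>B\<close>, so that distances and potentials are
  naturals in units of \<open>1 / B\<close>.\<close>

locale weighted =
  fixes G :: "'v graph" and w :: "'v edge \<Rightarrow> real" and W :: "'v edge \<Rightarrow> nat" and B :: nat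
  assumes wf: "wf_graph G" and B: "B > 0"
    and wW: "\<And>e. e \<in> edges G \<Longrightarrow> w e = real (W e) / real B"
    and W_pos: "\<And>e. e \<in> edges G \<Longrightarrow> W e > 0"
begin

abbreviation eg :: "'v \<Rightarrow> 'v \<Rightarrow> 'v edge" where
  "eg \<equiv> edge_of G"

lemma edge_verts: "eg u v \<in> edges G \<Longrightarrow> u \<in> verts G \<and> v \<in> verts G"
  using wf unfolding wf_graph_def by (fastforce simp: edge_of_eq_iff)

lemma finite_edges: "finite (edges G)"
proof (rule finite_subset)
  show "edges G \<subseteq> (\<lambda>(u, v). eg u v) ` (verts G \<times> verts G)" using wf by (fastforce simp: wf_graph_def)
  show "finite ((\<lambda>(u, v). eg u v) ` (verts G \<times> verts G))" using wf by (simp add: wf_graph_def)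
qed

definition tight :: "('v \<Rightarrow> nat) \<Rightarrow> 'v \<Rightarrow> 'v \<Rightarrow> bool" where
  "tight D u v \<longleftrightarrow> eg u v \<in> edges G \<and> D v = D u + W (eg u v)"

definition steps :: "('v \<Rightarrow> 'v \<Rightarrow> bool) \<Rightarrow> 'v list \<Rightarrow> bool" where
  "steps R Q \<longleftrightarrow> Q \<noteq> [] \<and> (\<forall>i. Suc i < length Q \<longrightarrow> R (Q ! i) (Q ! Suc i))"

definition feasible :: "'v \<Rightarrow> ('v \<Rightarrow> nat) \<Rightarrow> bool" where
  "feasible s D \<longleftrightarrow> D s = 0 \<and> (\<forall>u v. eg u v \<in> edges G \<longrightarrow> D v \<le> D u + W (eg u v))"

lemma steps_append:
  assumes "steps R Q" "steps R Q'" "R (last Q) (hd Q')"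
  shows "steps R (Q @ Q')"
  unfolding steps_def
proof (intro conjI allI impI)
  show "Q @ Q' \<noteq> []" using assms(1) by (simp add: steps_def)
  fix i assume i: "Suc i < length (Q @ Q')"
  consider "Suc i < length Q" | "Suc i = length Q" | "i \<ge> length Q" by linarith
  then show "R ((Q @ Q') ! i) ((Q @ Q') ! Suc i)"
  proof cases
    case 1
    then show ?thesis using assms(1) by (simp add: steps_def nth_append)
  next
    case 2
    then have "i = length Q - 1" by simp
    then have "Q ! i = last Q" "Q' ! 0 = hd Q'"
      using assms(1,2) by (simp_all add: steps_def last_conv_nth hd_conv_nth)
    then show ?thesis using 2 assms(3) by (simp add: nth_append)
  next
    case 3
    then have "Suc (i - length Q) < length Q'" "Suc i - length Q = Suc (i - length Q)" using i by auto
    then show ?thesis using assms(2) 3 by (simp add: steps_def nth_append)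
  qed
qed

lemma steps_snoc: "steps R Q \<Longrightarrow> R (last Q) v \<Longrightarrow> steps R (Q @ [v])"
  by (rule steps_append) (auto simp: steps_def)

text \<open>Positive weights make the potential strictly increasing, hence walks of tight edges
  never repeat a vertex.\<close>

lemma steps_tight_less:
  assumes "steps (tight D) Q" "i < j" "j < length Q"
  shows "D (Q ! i) < D (Q ! j)"
  using assms(2,3)
proof (induction j)
  case (Suc j)
  have "tight D (Q ! j) (Q ! Suc j)" using assms(1) Suc.prems by (simp add: steps_def)
  then have "D (Q ! j) < D (Q ! Suc j)" using W_pos by (simp add: tight_def)
  then show ?case using Suc by (cases "i = j") auto
qed simp

lemma steps_edges:
  assumes "\<And>u v. R u v \<Longrightarrow> eg u v \<in> edges G" "steps R Q" "hd Q \<in> verts G"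
  shows "set Q \<subseteq> verts G" "path_edges G Q \<subseteq> edges G"
proof -
  have "Q ! i \<in> verts G" if "i < length Q" for i
  proof (cases i)
    case 0
    then show ?thesis using assms(2,3) by (simp add: steps_def hd_conv_nth)
  next
    case (Suc k)
    then have "R (Q ! k) (Q ! i)" using assms(2) that by (simp add: steps_def)
    then show ?thesis using assms(1) edge_verts by blast
  qed
  then show "set Q \<subseteq> verts G" by (auto simp: in_set_conv_nth)
  show "path_edges G Q \<subseteq> edges G"
    using assms(1,2) by (auto simp: path_edges_def steps_def)
qed

lemma steps_tight_path:
  assumes "steps (tight D) Q" "hd Q \<in> verts G"
  shows "st_path G (hd Q) (last Q) Q"
proof -
  have "distinct Q"
    unfolding distinct_conv_nth
    using steps_tight_less[OF assms(1)] by (metis linorder_neqE_nat less_irrefl)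
  then show ?thesis
    using steps_edges[OF _ assms] assms(1) by (auto simp: st_path_def tight_def steps_def)
qed

lemma path_weight_W:
  assumes "distinct Q" "path_edges G Q \<subseteq> edges G"
  shows "real B * path_weight G w Q = (\<Sum>i<length Q - 1. real (W (eg (Q ! i) (Q ! Suc i))))"
proof -
  have "w (eg (Q ! i) (Q ! Suc i)) = real (W (eg (Q ! i) (Q ! Suc i))) / real B" if "i < length Q - 1" for i
    using that assms(2) path_edges_nth[of i Q G] by (intro wW) auto
  then show ?thesis using B by (simp add: path_weight_distinct[OF assms(1)] sum_distrib_left)
qed

lemma telescope:
  assumes "Q \<noteq> []"
  shows "(\<Sum>i<length Q - 1. real (D (Q ! Suc i)) - real (D (Q ! i))) = real (D (last Q)) - real (D (hd Q))"
  using sum_lessThan_telescope[of "\<lambda>i. real (D (Q ! i))" "length Q - 1"] assms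
  by (simp add: hd_conv_nth last_conv_nth)

lemma steps_tight_weight:
  assumes "steps (tight D) Q" "distinct Q" "path_edges G Q \<subseteq> edges G"
  shows "real B * path_weight G w Q = real (D (last Q)) - real (D (hd Q))"
proof -
  have "(\<Sum>i<length Q - 1. real (W (eg (Q ! i) (Q ! Suc i)))) =
      (\<Sum>i<length Q - 1. real (D (Q ! Suc i)) - real (D (Q ! i)))"
    by (rule sum.cong) (use assms(1) in \<open>auto simp: steps_def tight_def\<close>)
  then show ?thesis using path_weight_W[OF assms(2,3)] telescope[of Q D] assms(1) by (simp add: steps_def)
qed

text \<open>Weak duality with complementary slackness: feasibility bounds each potential difference
  by its weight, the differences telescope to \<open>D t\<close>, and equality holds only if every
  edge is tight.\<close>

lemma feasible_weight:
  assumes f: "feasible s D" and P: "st_path G s t P"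
  shows "real B * path_weight G w P \<ge> real (D t)"
    and "real B * path_weight G w P = real (D t) \<longleftrightarrow> steps (tight D) P"
proof -
  have P': "P \<noteq> []" "hd P = s" "last P = t" "distinct P" "path_edges G P \<subseteq> edges G"
    using P by (auto simp: st_path_def)
  let ?d = "\<lambda>i. real (D (P ! Suc i)) - real (D (P ! i))" and ?W = "\<lambda>i. real (W (eg (P ! i) (P ! Suc i)))"
  have E: "eg (P ! i) (P ! Suc i) \<in> edges G" if "i < length P - 1" for i
    using that P'(5) path_edges_nth[of i P G] by auto
  have le: "?d i \<le> ?W i" if "i < length P - 1" for i
  proof -
    have "D (P ! Suc i) \<le> D (P ! i) + W (eg (P ! i) (P ! Suc i))" using f E[OF that] by (simp add: feasible_def)
    then show ?thesis by linarith
  qed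
  have sum_d: "(\<Sum>i<length P - 1. ?d i) = real (D t)"
    using telescope[OF P'(1)] P'(2,3) f by (simp add: feasible_def)
  note pw = path_weight_W[OF P'(4,5)]
  show "real B * path_weight G w P \<ge> real (D t)"
    unfolding pw sum_d[symmetric] by (rule sum_mono) (use le in auto)
  show "real B * path_weight G w P = real (D t) \<longleftrightarrow> steps (tight D) P"
  proof
    assume "real B * path_weight G w P = real (D t)"
    then have "(\<Sum>i<length P - 1. ?W i - ?d i) = 0" unfolding pw by (subst sum_subtractf) (simp only: sum_d)
    then have "\<forall>i\<in>{..<length P - 1}. ?W i - ?d i = 0"
      by (subst (asm) sum_nonneg_eq_0_iff) (use le in auto)
    then have "tight D (P ! i) (P ! Suc i)" if "Suc i < length P" for i
    proof -
      have i: "i < length P - 1" using that by simp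
      then have "?W i - ?d i = 0" using \<open>\<forall>i\<in>{..<length P - 1}. ?W i - ?d i = 0\<close> by blast
      then have "D (P ! Suc i) = D (P ! i) + W (eg (P ! i) (P ! Suc i))" by linarith
      then show ?thesis using E[OF i] by (simp add: tight_def)
    qed
    then show "steps (tight D) P" using P'(1) by (simp add: steps_def)
  next
    assume "steps (tight D) P"
    from steps_tight_weight[OF this P'(4,5)] show "real B * path_weight G w P = real (D t)"
      using P' f by (simp add: feasible_def)
  qed
qed

lemma shortest_path_tight:
  assumes f: "feasible s D" and P0: "st_path G s t P0" "steps (tight D) P0"
  shows "shortest_path G w s t P \<longleftrightarrow> st_path G s t P \<and> steps (tight D) P"
proof -
  have 0: "real B * path_weight G w P0 = real (D t)" using feasible_weight(2)[OF f P0(1)] P0(2) by simp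
  have le: "path_weight G w P \<le> path_weight G w P' \<longleftrightarrow> real B * path_weight G w P \<le> real B * path_weight G w P'" for P P'
    using B by simp
  show ?thesis
  proof
    assume "shortest_path G w s t P"
    then have P: "st_path G s t P" "real B * path_weight G w P \<le> real B * path_weight G w P0"
      using P0(1) le by (auto simp: shortest_path_def)
    then have "real B * path_weight G w P = real (D t)" using feasible_weight(1)[OF f P(1)] 0 by linarith
    then show "st_path G s t P \<and> steps (tight D) P" using feasible_weight(2)[OF f P(1)] P(1) by simp
  next
    assume P: "st_path G s t P \<and> steps (tight D) P"
    then have "real B * path_weight G w P = real (D t)" using feasible_weight(2)[OF f] by blast
    then show "shortest_path G w s t P"
      using P feasible_weight(1)[OF f] unfolding shortest_path_def le by auto
  qed
qed

text \<open>
  A potential \<open>D\<close> certifies the shortest paths, and a set \<open>A\<close> of vertices containing all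
  vertices from which \<open>t\<close> can be reached by tight edges outside \<open>S\<close> certifies that \<open>P\<close> is unique.
\<close>

definition certifies :: "'v \<Rightarrow> 'v \<Rightarrow> 'v edge set \<Rightarrow> ('v \<Rightarrow> nat) \<Rightarrow> 'v set \<Rightarrow> 'v list \<Rightarrow> bool" where
  "certifies s t S D A P \<longleftrightarrow> feasible s D \<and> t \<in> A \<and>
     (\<forall>u v. tight D u v \<and> eg u v \<notin> S \<and> v \<in> A \<longrightarrow> u \<in> A) \<and>
     P \<noteq> [] \<and> hd P = s \<and> last P = t \<and>
     (\<forall>i. Suc i < length P \<longrightarrow> tight D (P ! i) (P ! Suc i) \<and> eg (P ! i) (P ! Suc i) \<notin> S \<and>
       (\<forall>v. tight D (P ! i) v \<and> eg (P ! i) v \<notin> S \<and> v \<in> A \<longrightarrow> v = P ! Suc i))"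

text \<open>A competing shortest path avoiding \<open>S\<close> consists of vertices of
  \<open>A\<close>. As long as it follows \<open>P\<close>, the next vertex is in \<open>A\<close>
  as well, so the certificate forces it to be the one on \<open>P\<close>.\<close>

theorem certifies_imp_anti_forcing:
  assumes c: "certifies s t S D A P" and s: "s \<in> verts G" and S: "S \<subseteq> edges G"
  shows "anti_forcing_set G w s t S"
proof -
  have f: "feasible s D" and P: "P \<noteq> []" "hd P = s" "last P = t" using c by (auto simp: certifies_def)
  have P_steps: "steps (tight D) P" using c by (simp add: certifies_def steps_def)
  have P_path: "st_path G s t P" using steps_tight_path[OF P_steps] P s by simp
  note sp = shortest_path_tight[OF f P_path P_steps]
  have "\<exists>!P. shortest_path G w s t P \<and> S \<inter> path_edges G P = {}"
  proof (rule ex1I[of _ P])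
    have "S \<inter> path_edges G P = {}" using c by (auto simp: certifies_def path_edges_def)
    then show "shortest_path G w s t P \<and> S \<inter> path_edges G P = {}" using sp P_path P_steps by simp
    fix P' assume P': "shortest_path G w s t P' \<and> S \<inter> path_edges G P' = {}"
    then have path': "st_path G s t P'" and steps': "steps (tight D) P'" using sp by auto
    have d': "P' \<noteq> []" "hd P' = s" "last P' = t" "distinct P'" using path' by (auto simp: st_path_def)
    have T': "tight D (P' ! i) (P' ! Suc i)" "eg (P' ! i) (P' ! Suc i) \<notin> S" if "Suc i < length P'" for i
      using steps' P' path_edges_nth[OF that, of G] that by (auto simp: steps_def)
    \<comment> \<open>The index counts from the end: closure of \<open>A\<close> under predecessors
      is applied backwards from \<open>t\<close>.\<close>
    have inA: "P' ! (length P' - 1 - i) \<in> A" if "i < length P'" for i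
      using that
    proof (induction i)
      case 0
      then show ?case using d' c by (simp add: certifies_def last_conv_nth)
    next
      case (Suc i)
      let ?j = "length P' - 1 - Suc i"
      have "Suc ?j = length P' - 1 - i" using Suc.prems by simp
      then have "P' ! Suc ?j \<in> A" "Suc ?j < length P'" using Suc by auto
      then show ?case using T'[of ?j] c unfolding certifies_def by blast
    qed
    have inA': "P' ! i \<in> A" if "i < length P'" for i
      using inA[of "length P' - 1 - i"] that by simp
    have same: "P' ! i = P ! i" if "i < length P'" "i < length P" for i
      using that
    proof (induction i)
      case 0
      then show ?case using P d' by (simp add: hd_conv_nth)
    next
      case (Suc i)
      then have e: "P' ! i = P ! i" by simp
      have "tight D (P ! i) (P' ! Suc i) \<and> eg (P ! i) (P' ! Suc i) \<notin> S \<and> P' ! Suc i \<in> A"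
        using T'[of i] inA'[of "Suc i"] Suc.prems e by simp
      then show ?case using c Suc.prems unfolding certifies_def by blast
    qed
    \<comment> \<open>If one path were a proper prefix of the other, the longer one would visit
      \<open>t\<close> twice.\<close>
    have len: "length P' = length P"
    proof (rule ccontr)
      assume ne: "length P' \<noteq> length P"
      have dP: "distinct P" using P_path by (simp add: st_path_def)
      show False
      proof (cases "length P' < length P")
        case True
        then have "P ! (length P' - 1) = P ! (length P - 1)"
          using same[of "length P' - 1"] d' P by (simp add: last_conv_nth)
        moreover have "length P' - 1 < length P" "length P - 1 < length P" "length P' > 0" using True d'(1) by auto
        ultimately have "length P' - 1 = length P - 1" using nth_eq_iff_index_eq[OF dP] by blast
        then show False using True \<open>length P' > 0\<close> by linarith
      next
        case False
        then have "P' ! (length P - 1) = P' ! (length P' - 1)"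
          using same[of "length P - 1"] d' P ne by (simp add: last_conv_nth)
        moreover have "length P - 1 < length P'" "length P' - 1 < length P'" "length P > 0" using False ne P(1) by auto
        ultimately have "length P - 1 = length P' - 1" using nth_eq_iff_index_eq[OF d'(4)] by blast
        then show False using False ne \<open>length P > 0\<close> by linarith
      qed
    qed
    show "P' = P" by (rule nth_equalityI) (use len same in auto)
  qed
  then show ?thesis using S by (simp add: anti_forcing_set_def)
qed

inductive reach :: "'v \<Rightarrow> 'v \<Rightarrow> nat \<Rightarrow> bool" for s where
  refl: "reach s s 0"
| step: "reach s u c \<Longrightarrow> eg u v \<in> edges G \<Longrightarrow> reach s v (c + W (eg u v))"

definition total :: nat where
  "total = (\<Sum>e\<in>edges G. W e)"

text \<open>Unreachable vertices get the value \<open>total\<close>, which no distance exceeds; so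
  edges leaving them respect feasibility and the potential keeps few bits.\<close>

definition dst :: "'v \<Rightarrow> 'v \<Rightarrow> nat" where
  "dst s v = (if \<exists>c. reach s v c then LEAST c. reach s v c else total)"

lemma reach_dst: "reach s v c \<Longrightarrow> reach s v (dst s v)" "reach s v c \<Longrightarrow> dst s v \<le> c"
  by (auto simp: dst_def intro: LeastI Least_le)

lemma dst_source: "dst s s = 0"
  using reach_dst(2)[OF reach.refl] by simp

lemma dst_pred:
  assumes "reach s v c" "v \<noteq> s"
  obtains u where "reach s u (dst s u)" "tight (dst s) u v"
proof -
  have "reach s v (dst s v)" using reach_dst(1)[OF assms(1)] .
  then show thesis
  proof cases
    case (step u c')
    have "dst s u \<le> c'" "reach s u (dst s u)" using reach_dst step(2) by blast+
    moreover have "dst s v \<le> dst s u + W (eg u v)"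
      by (rule reach_dst(2)[OF reach.step[OF \<open>reach s u (dst s u)\<close> step(3)]])
    ultimately show thesis using that[of u] step by (auto simp: tight_def)
  qed (use assms in simp)
qed

lemma reach_tight_steps:
  assumes "reach s v c"
  shows "\<exists>Q. steps (tight (dst s)) Q \<and> hd Q = s \<and> last Q = v"
  using assms
proof (induction "dst s v" arbitrary: v c rule: less_induct)
  case less
  show ?case
  proof (cases "v = s")
    case True
    then show ?thesis by (intro exI[of _ "[s]"]) (simp add: steps_def)
  next
    case False
    obtain u where u: "reach s u (dst s u)" "tight (dst s) u v" using dst_pred[OF less.prems False] .
    then have "dst s u < dst s v" using W_pos by (simp add: tight_def)
    then obtain Q where Q: "steps (tight (dst s)) Q" "hd Q = s" "last Q = u" using less.hyps u(1) by blast
    then have "steps (tight (dst s)) (Q @ [v])" using steps_snoc[OF Q(1)] u(2) by simp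
    moreover have "hd (Q @ [v]) = s" using Q by (simp add: steps_def)
    ultimately show ?thesis by (intro exI[of _ "Q @ [v]"]) simp
  qed
qed

text \<open>A tight walk to \<open>v\<close> is a simple path, so it uses each edge at most
  once.\<close>

lemma dst_le_total:
  assumes "s \<in> verts G"
  shows "dst s v \<le> total"
proof (cases "\<exists>c. reach s v c")
  case True
  then obtain Q where Q: "steps (tight (dst s)) Q" "hd Q = s" "last Q = v" using reach_tight_steps by blast
  then have p: "st_path G s v Q" using steps_tight_path[OF Q(1)] assms by simp
  then have dQ: "distinct Q" and pQ: "path_edges G Q \<subseteq> edges G" by (auto simp: st_path_def)
  have "real (dst s v) = real B * path_weight G w Q"
    using steps_tight_weight[OF Q(1) dQ pQ] Q dst_source by simp
  also have "\<dots> = (\<Sum>e\<in>path_edges G Q. real (W e))"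
    using B wW pQ by (auto simp: path_weight_def sum_distrib_left intro!: sum.cong)
  also have "\<dots> \<le> (\<Sum>e\<in>edges G. real (W e))"
    by (rule sum_mono2[OF finite_edges pQ]) simp
  finally show ?thesis unfolding total_def by (simp flip: of_nat_sum)
qed (simp add: dst_def)

lemma dst_feasible:
  assumes "s \<in> verts G"
  shows "feasible s (dst s)"
  unfolding feasible_def
proof (intro conjI allI impI)
  fix u v assume e: "eg u v \<in> edges G"
  show "dst s v \<le> dst s u + W (eg u v)"
  proof (cases "\<exists>c. reach s u c")
    case True
    then have "reach s u (dst s u)" using reach_dst by blast
    from reach_dst(2)[OF reach.step[OF this e]] show ?thesis .
  next
    case False
    then have "dst s u = total" by (simp add: dst_def)
    then show ?thesis using dst_le_total[OF assms, of v] by simp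
  qed
qed (rule dst_source)

text \<open>Distances are the potential. If \<open>P\<close> could branch into a vertex that still
  reaches \<open>t\<close>, the prefix of \<open>P\<close> and the continuation would form a second
  tight walk outside \<open>S\<close>, which is again a shortest path.\<close>

theorem anti_forcing_imp_certificate:
  assumes af: "anti_forcing_set G w s t S" and s: "s \<in> verts G"
  shows "\<exists>A P. certifies s t S (dst s) A P \<and> distinct P \<and> set P \<subseteq> verts G"
proof -
  define T where "T u v \<longleftrightarrow> tight (dst s) u v \<and> eg u v \<notin> S" for u v
  obtain P where sp: "shortest_path G w s t P" and avoid: "S \<inter> path_edges G P = {}"
    and uniq: "\<And>P'. shortest_path G w s t P' \<Longrightarrow> S \<inter> path_edges G P' = {} \<Longrightarrow> P' = P"
    using af unfolding anti_forcing_set_def by blast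
  have P: "st_path G s t P" using sp by (simp add: shortest_path_def)
  then have P': "P \<noteq> []" "hd P = s" "last P = t" "distinct P" "set P \<subseteq> verts G" "path_edges G P \<subseteq> edges G"
    by (auto simp: st_path_def)
  have "\<exists>c. reach s (P ! i) c" if "i < length P" for i
    using that
  proof (induction i)
    case 0
    then show ?case using P' reach.refl by (metis hd_conv_nth)
  next
    case (Suc i)
    then show ?case using path_edges_nth[of i P G] P'(6) reach.step by (meson Suc_lessD subsetD)
  qed
  from this[of "length P - 1"] obtain c where "reach s t c" using P' by (auto simp: last_conv_nth)
  then obtain Q where Q: "steps (tight (dst s)) Q" "hd Q = s" "last Q = t" using reach_tight_steps by blast
  have f: "feasible s (dst s)" by (rule dst_feasible[OF s])
  have "st_path G s t Q" using steps_tight_path[OF Q(1)] Q s by simp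
  note iff = shortest_path_tight[OF f this Q(1)]
  have P_tight: "steps (tight (dst s)) P" using iff sp by simp
  have P_T: "T (P ! i) (P ! Suc i)" if "Suc i < length P" for i
    using P_tight avoid path_edges_nth[OF that, of G] that by (auto simp: T_def steps_def)
  \<comment> \<open>The least set closed under predecessors that contains \<open>t\<close>; a larger
    one could allow spurious branches.\<close>
  define A where "A = {v. T\<^sup>*\<^sup>* v t}"
  have list: "\<exists>R. steps T R \<and> hd R = v \<and> last R = t" if "v \<in> A" for v
  proof -
    have "T\<^sup>*\<^sup>* v t" using that by (simp add: A_def)
    then show ?thesis
    proof (induction rule: converse_rtranclp_induct)
      case base
      show ?case by (intro exI[of _ "[t]"]) (simp add: steps_def)
    next
      case (step u v)
      then obtain R where R: "steps T R" "hd R = v" "last R = t" by blast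
      have "steps T ([u] @ R)" by (rule steps_append[OF _ R(1)]) (use step R in \<open>auto simp: steps_def\<close>)
      then show ?case using R by (intro exI[of _ "[u] @ R"]) (simp add: steps_def)
    qed
  qed
  have unique_arc: "v = P ! Suc i" if i: "Suc i < length P" and v: "T (P ! i) v" "v \<in> A" for i v
  proof -
    obtain R where R: "steps T R" "hd R = v" "last R = t" using list[OF v(2)] by blast
    have last: "last (take (Suc i) P) = P ! i" using i by (simp add: take_Suc_conv_app_nth)
    have "steps T (take (Suc i) P)" using P_T i by (auto simp: steps_def)
    then have st: "steps T (take (Suc i) P @ R)" using R v(1) last by (intro steps_append) auto
    then have "steps (tight (dst s)) (take (Suc i) P @ R)" by (auto simp: steps_def T_def)
    moreover have hl: "hd (take (Suc i) P @ R) = s" "last (take (Suc i) P @ R) = t"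
      using P' i R by (auto simp: steps_def hd_append)
    ultimately have "shortest_path G w s t (take (Suc i) P @ R)"
      using iff steps_tight_path s by metis
    moreover have "S \<inter> path_edges G (take (Suc i) P @ R) = {}"
      using st by (auto simp: path_edges_def steps_def T_def)
    ultimately have e: "take (Suc i) P @ R = P" using uniq by blast
    have "(take (Suc i) P @ R) ! Suc i = v" using i R by (simp add: nth_append steps_def hd_conv_nth min_def)
    then show ?thesis using e by simp
  qed
  have "certifies s t S (dst s) A P"
    unfolding certifies_def
  proof (intro conjI allI impI)
    show "t \<in> A" by (simp add: A_def)
    show "u \<in> A" if "tight (dst s) u v \<and> eg u v \<notin> S \<and> v \<in> A" for u v
      using that by (auto simp: A_def T_def intro: converse_rtranclp_into_rtranclp)
    show "tight (dst s) (P ! i) (P ! Suc i)" "eg (P ! i) (P ! Suc i) \<notin> S" if "Suc i < length P" for i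
      using P_T[OF that] by (auto simp: T_def)
    show "v = P ! Suc i" if "Suc i < length P" "tight (dst s) (P ! i) v \<and> eg (P ! i) v \<notin> S \<and> v \<in> A" for i v
      using unique_arc[OF that(1)] that(2) by (simp add: T_def)
  qed (use P' f in auto)
  then show ?thesis using P' by blast
qed

end

section \<open>Bit-list arithmetic, certificate codes and the polynomial-time verifier\<close>

section \<open>Binary arithmetic\<close>

fun val :: "bool list \<Rightarrow> nat" where
  "val [] = 0"
| "val (b # bs) = of_bool b + 2 * val bs"

text \<open>Bits are least significant first, so a redundant zero would stand at the end.
  Intermediate results may have such zeros; encoded numbers may not.\<close>

definition canon :: "bool list \<Rightarrow> bool" where
  "canon bs \<longleftrightarrow> bs = [] \<or> hdd False (rev bs)"

lemma val_append: "val (xs @ ys) = val xs + 2 ^ length xs * val ys"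
  by (induction xs) (auto simp: algebra_simps)

lemma val_less: "val xs < 2 ^ length xs"
  by (induction xs) auto

lemma val_binary [simp]: "val (binary n) = n"
proof (induction n rule: less_induct)
  case (less n)
  show ?case
  proof (cases "n = 0")
    case False
    then have "val (binary n) = of_bool (odd n) + 2 * (n div 2)"
      using less[of "n div 2"] by (simp add: binary.simps[of n])
    then show ?thesis by (cases "odd n") auto
  qed (simp add: binary.simps)
qed

lemma canon_Cons: "canon (b # bs) \<longleftrightarrow> (if bs = [] then b else canon bs)"
  by (cases bs rule: rev_cases) (auto simp: canon_def)

lemma val_pos: "canon bs \<Longrightarrow> bs \<noteq> [] \<Longrightarrow> val bs > 0"
  by (induction bs) (auto simp: canon_Cons split: if_splits)

lemma binary_val: "canon bs \<Longrightarrow> binary (val bs) = bs"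
proof (induction bs)
  case Nil
  then show ?case by (simp add: binary.simps)
next
  case (Cons b bs)
  show ?case
  proof (cases "bs = []")
    case True
    then show ?thesis using Cons.prems by (simp add: canon_Cons binary.simps)
  next
    case False
    then have c: "canon bs" using Cons.prems by (simp add: canon_Cons)
    then have "val bs > 0" using val_pos False by blast
    then show ?thesis using Cons.IH[OF c] by (subst binary.simps) auto
  qed
qed

lemma canon_binary: "canon (binary n)"
proof (induction n rule: less_induct)
  case (less n)
  show ?case
  proof (cases "n = 0")
    case False
    have "binary (n div 2) = [] \<longleftrightarrow> n div 2 = 0"
      by (subst binary.simps) auto
    then show ?thesis using less[of "n div 2"] False by (auto simp: binary.simps[of n] canon_Cons)
  qed (simp add: binary.simps canon_def)
qed

lemma length_binary_le: "n < 2 ^ L \<Longrightarrow> length (binary n) \<le> L"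
proof (induction n arbitrary: L rule: less_induct)
  case (less n)
  show ?case
  proof (cases "n = 0")
    case False
    then obtain L' where L: "L = Suc L'" using less.prems by (cases L) auto
    have "n div 2 < 2 ^ L'" using less.prems L by simp
    then show ?thesis using less.IH[of "n div 2" L'] False L by (simp add: binary.simps[of n])
  qed (simp add: binary.simps)
qed

lemma less_binary: "n < 2 ^ length (binary n)"
  using val_less[of "binary n"] by simp

lemma val_take_Suc: "val (take (Suc i) xs) = val (take i xs) + (if nthd False xs i then 2 ^ i else 0)"
proof (cases "i < length xs")
  case True
  then show ?thesis by (simp add: take_Suc_conv_app_nth val_append nthd_def)
qed (simp add: nthd_def)

text \<open>Scanning upwards, each differing position overrides the earlier verdict, so the highest
  one decides; the shorter list is padded with \<open>False\<close>.\<close>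

definition leqb :: "bool list \<Rightarrow> bool list \<Rightarrow> bool" where
  "leqb xs ys = fold (\<lambda>i r. if nthd False xs i = nthd False ys i then r else nthd False ys i)
     [0..<length xs + length ys] True"

lemma leqb_iff: "leqb xs ys \<longleftrightarrow> val xs \<le> val ys"
proof -
  have "fold (\<lambda>i r. if nthd False xs i = nthd False ys i then r else nthd False ys i) [0..<n] True
      \<longleftrightarrow> val (take n xs) \<le> val (take n ys)" for n
  proof (induction n)
    case (Suc n)
    have "val (take n zs) < 2 ^ n" for zs
    proof -
      have "(2 :: nat) ^ length (take n zs) \<le> 2 ^ n" by (rule power_increasing) auto
      then show ?thesis using val_less[of "take n zs"] by linarith
    qed
    from this[of xs] this[of ys] Suc show ?case by (auto simp: val_take_Suc)
  qed simp
  from this[of "length xs + length ys"] show ?thesis by (simp add: leqb_def)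
qed

lemma PT_leqb [pt]: "PT f \<Longrightarrow> PT g \<Longrightarrow> PT (\<lambda>x. leqb (f x) (g x))"
proof -
  have "PT (\<lambda>p. leqb (fst p) (snd p))"
    unfolding leqb_def by (rule PT_fold_inc[where P = "[:3:]"]) (intro pt | simp add: sz_bool)+
  then show "PT f \<Longrightarrow> PT g \<Longrightarrow> PT (\<lambda>x. leqb (f x) (g x))" by (rule PT_lift2)
qed

definition addb :: "bool list \<Rightarrow> bool list \<Rightarrow> bool list" where
  "addb xs ys = (let r = fold (\<lambda>i (r :: bool \<times> bool list).
       ((nthd False xs i \<and> nthd False ys i) \<or> (nthd False xs i \<and> fst r) \<or> (nthd False ys i \<and> fst r),
        ((nthd False xs i = nthd False ys i) = fst r) # snd r))
     [0..<max (length xs) (length ys)] (False, []) in rev (snd r) @ [fst r])"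

lemma addb:
  shows val_addb: "val (addb xs ys) = val xs + val ys"
    and length_addb: "length (addb xs ys) = Suc (max (length xs) (length ys))"
proof -
  define F where "F n = fold (\<lambda>i (r :: bool \<times> bool list).
       ((nthd False xs i \<and> nthd False ys i) \<or> (nthd False xs i \<and> fst r) \<or> (nthd False ys i \<and> fst r),
        ((nthd False xs i = nthd False ys i) = fst r) # snd r)) [0..<n] (False, [])" for n
  have F: "length (snd (F n)) = n \<and> val (rev (snd (F n))) + (if fst (F n) then 2 ^ n else 0) = val (take n xs) + val (take n ys)" for n
  proof (induction n)
    case (Suc n)
    have "F (Suc n) = ((nthd False xs n \<and> nthd False ys n) \<or> (nthd False xs n \<and> fst (F n)) \<or> (nthd False ys n \<and> fst (F n)),
        ((nthd False xs n = nthd False ys n) = fst (F n)) # snd (F n))"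
      by (simp add: F_def)
    then show ?case using Suc
      by (cases "nthd False xs n"; cases "nthd False ys n"; cases "fst (F n)") (auto simp: val_take_Suc val_append)
  qed (simp add: F_def)
  have e: "addb xs ys = rev (snd (F (max (length xs) (length ys)))) @ [fst (F (max (length xs) (length ys)))]"
    by (simp add: addb_def F_def Let_def)
  show "val (addb xs ys) = val xs + val ys" "length (addb xs ys) = Suc (max (length xs) (length ys))"
    using F[of "max (length xs) (length ys)"] by (auto simp: e val_append split: if_splits)
qed

lemma PT_addb [pt]: "PT f \<Longrightarrow> PT g \<Longrightarrow> PT (\<lambda>x. addb (f x) (g x))"
proof -
  have "PT (\<lambda>p. fold (\<lambda>i (r :: bool \<times> bool list).
       ((nthd False (fst p) i \<and> nthd False (snd p) i) \<or> (nthd False (fst p) i \<and> fst r) \<or> (nthd False (snd p) i \<and> fst r),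
        ((nthd False (fst p) i = nthd False (snd p) i) = fst r) # snd r))
     [0..<max (length (fst p)) (length (snd p))] (False, []))"
    unfolding max_def by (rule PT_fold_inc[where P = "[:6:]"]) (intro pt | simp add: sz_bool sz_prod)+
  then have "PT (\<lambda>p. addb (fst p) (snd p))"
    unfolding addb_def Let_def by (intro PT_append PT_rev PT_snd PT_Cons PT_fst PT_const)
  then show "PT f \<Longrightarrow> PT g \<Longrightarrow> PT (\<lambda>x. addb (f x) (g x))" by (rule PT_lift2)
qed

text \<open>Horner scheme from the most significant bit of \<open>xs\<close>: double, then add
  \<open>ys\<close> if the bit is set.\<close>

definition mulb :: "bool list \<Rightarrow> bool list \<Rightarrow> bool list" where
  "mulb xs ys = fold (\<lambda>b r. if b then addb ys (False # r) else False # r) (rev xs) []"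

lemma val_mulb: "val (mulb xs ys) = val xs * val ys"
  by (induction xs) (auto simp: mulb_def val_addb)

lemma PT_mulb [pt]: "PT f \<Longrightarrow> PT g \<Longrightarrow> PT (\<lambda>x. mulb (f x) (g x))"
proof -
  have "PT (\<lambda>p. mulb (fst p) (snd p))"
    unfolding mulb_def
  proof (rule PT_fold_measure[where m = length and K = "[:1, 4:]" and P = "[:2, 1:]"])
    fix p :: "bool list \<times> bool list" and b and r :: "bool list"
    have "length (snd p) \<le> sz p" using length_le_sz[of "snd p"] by (simp add: sz_prod)
    then show "length (if b then addb (snd p) (False # r) else False # r) \<le> length r + poly [:2, 1:] (sz p + sz b)"
      by (auto simp: length_addb)
  qed (intro pt sz_bits_length)+
  then show "PT f \<Longrightarrow> PT g \<Longrightarrow> PT (\<lambda>x. mulb (f x) (g x))" by (rule PT_lift2)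
qed

section \<open>Decoding of certificates\<close>

fun tlist :: "tree \<Rightarrow> tree list" where
  "tlist Lf = []"
| "tlist (Nd a b) = a # tlist b"

lemma PT_tlist [pt]: "PT f \<Longrightarrow> PT (\<lambda>x. tlist (f x))"
proof (rule PT_recode)
  have "tt (tlist t) = t" for t by (induction t) (auto simp: tt_tree)
  then show "tt (tlist (f x)) = tt (f x)" for x by (simp add: tt_tree)
qed

lemma PT_lf [pt]: "PT f \<Longrightarrow> PT (\<lambda>x. lf (f x))" and PT_rt [pt]: "PT f \<Longrightarrow> PT (\<lambda>x. rt (f x))"
proof -
  have "PT lf" "PT rt" by (rule PT_via_lf PT_via_rt, simp add: tt_tree)+
  then show "PT f \<Longrightarrow> PT (\<lambda>x. lf (f x))" "PT f \<Longrightarrow> PT (\<lambda>x. rt (f x))" by (auto intro: PT_comp)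
qed

lemma PT_Nd [pt]: "PT f \<Longrightarrow> PT g \<Longrightarrow> PT (\<lambda>x. Nd (f x) (g x))"
  by (rule PT_via_Nd[of f g]) (auto simp: tt_tree)

text \<open>This and the following decoders are total: every tree decodes to something, and
  rejecting nonsense is left to \<open>verify\<close>.\<close>

definition dbool :: "tree \<Rightarrow> bool" where "dbool t \<longleftrightarrow> t \<noteq> Lf"
definition dnat :: "tree \<Rightarrow> nat" where "dnat t = length (tlist t)"
definition dlst :: "(tree \<Rightarrow> 'a) \<Rightarrow> tree \<Rightarrow> 'a list" where "dlst f t = map f (tlist t)"
definition dprod :: "(tree \<Rightarrow> 'a) \<Rightarrow> (tree \<Rightarrow> 'b) \<Rightarrow> tree \<Rightarrow> 'a \<times> 'b" where "dprod f g t = (f (lf t), g (rt t))"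

lemma dbool_tt [simp]: "dbool (tt b) = b"
  by (simp add: dbool_def tt_bool)

lemma dnat_tt [simp]: "dnat (tt n) = n"
  unfolding dnat_def by (induction n) auto

lemma dlst_tt [simp]: "(\<And>x. f (tt x) = x) \<Longrightarrow> dlst f (tt xs) = xs"
  unfolding dlst_def by (induction xs) auto

lemma dprod_tt [simp]: "(\<And>x. f (tt x) = x) \<Longrightarrow> (\<And>y. g (tt y) = y) \<Longrightarrow> dprod f g (tt p) = p"
  by (simp add: dprod_def tt_prod)

text \<open>Postorder, in contrast to \<open>enc\<close>, so that one pass from left to right with a
  stack of trees recovers the tree.\<close>

fun rpn :: "tree \<Rightarrow> bool list" where
  "rpn Lf = [False]"
| "rpn (Nd a b) = rpn a @ rpn b @ [True]"

text \<open>The guard ignores a join without two operands; malformed strings thus parse to some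
  tree, and no step adds more than a constant to the size.\<close>

definition rpn_step :: "bool \<Rightarrow> tree list \<Rightarrow> tree list" where
  "rpn_step b r = (if b then if tl r = [] then r else Nd (hdd Lf (tl r)) (hdd Lf r) # tl (tl r) else Lf # r)"

definition rpn_parse :: "bool list \<Rightarrow> tree" where
  "rpn_parse u = hdd Lf (fold rpn_step u [])"

lemma rpn_parse_rpn: "rpn_parse (rpn t) = t"
proof -
  have "fold rpn_step (rpn t) r = t # r" for r
    by (induction t arbitrary: r) (auto simp: rpn_step_def)
  then show ?thesis by (simp add: rpn_parse_def)
qed

lemma length_rpn: "length (rpn t) = tsz t"
  by (induction t) auto

lemma PT_rpn_parse [pt]: "PT f \<Longrightarrow> PT (\<lambda>x. rpn_parse (f x))"
proof (rule PT_comp[of rpn_parse])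
  have "PT (\<lambda>u. fold (\<lambda>b r. rpn_step b r) u [])"
  proof (rule PT_fold_inc[where P = "[:2:]"])
    show "PT (\<lambda>p :: bool list \<times> bool \<times> tree list. rpn_step (fst (snd p)) (snd (snd p)))"
      unfolding rpn_step_def by (intro pt)
    show "sz (rpn_step b y) \<le> sz y + poly [:2:] (sz u + sz b)" for u :: "bool list" and b y
    proof (cases "b \<and> tl y \<noteq> []")
      case True
      then obtain a c r where "y = a # c # r" by (cases y; cases "tl y") auto
      then show ?thesis using True by (simp add: rpn_step_def tt_tree)
    qed (auto simp: rpn_step_def tt_tree)
  qed (intro pt)+
  then have "PT (\<lambda>u. hdd Lf (fold (\<lambda>b r. rpn_step b r) u []))" by (intro PT_hdd PT_const)
  then show "PT rpn_parse" unfolding rpn_parse_def by simp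
qed

text \<open>State 0 expects a flag, state 1 a bit of the first string, state 2 reads the second string.\<close>

definition unpair_step :: "bool \<Rightarrow> nat \<times> bool list \<times> bool list \<Rightarrow> nat \<times> bool list \<times> bool list" where
  "unpair_step b r = (if fst r = 0 then (if b then 1 else 2, snd r) else
     if fst r = 1 then (0, b # fst (snd r), snd (snd r)) else (2, fst (snd r), b # snd (snd r)))"

definition unpair :: "bool list \<Rightarrow> nat \<times> bool list \<times> bool list" where
  "unpair z = fold unpair_step z (0, [], [])"

lemma unpair_pair_str: "unpair (pair_str x u) = (2, rev x, rev u)"
proof -
  have 1: "fold unpair_step (self_delim x) (0, a, c) = (2, rev x @ a, c)" for a c
    by (induction x arbitrary: a) (auto simp: self_delim_def unpair_step_def)
  have 2: "fold unpair_step u (2, a, c) = (2, a, rev u @ c)" for a c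
    by (induction u arbitrary: c) (auto simp: unpair_step_def)
  show ?thesis by (simp add: unpair_def pair_str_def 1 2)
qed

lemma PT_unpair [pt]: "PT f \<Longrightarrow> PT (\<lambda>x. unpair (f x))"
proof (rule PT_comp[of unpair])
  have "PT (\<lambda>u. fold (\<lambda>b r. unpair_step b r) u (0, [], []))"
  proof (rule PT_fold_inc[where P = "[:10:]"])
    show "PT (\<lambda>p :: bool list \<times> bool \<times> nat \<times> bool list \<times> bool list. unpair_step (fst (snd p)) (snd (snd p)))"
      unfolding unpair_step_def by (intro pt)
  qed (intro pt | simp add: unpair_step_def sz_prod sz_nat sz_bool)+
  then show "PT unpair" unfolding unpair_def by simp
qed

section \<open>The verifier\<close>

type_synonym centry = "nat \<times> nat \<times> bool list \<times> bool list \<times> bool list \<times> bool"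
type_synonym carc = "nat \<times> nat \<times> bool list \<times> bool"
type_synonym cert = "(bool \<times> nat \<times> centry list \<times> nat \<times> nat \<times> bool list) \<times>
  (nat list \<times> bool list \<times> bool list list \<times> bool list)"

abbreviation eu :: "centry \<Rightarrow> nat" where "eu e \<equiv> fst e"
abbreviation ev :: "centry \<Rightarrow> nat" where "ev e \<equiv> fst (snd e)"
abbreviation ea :: "centry \<Rightarrow> bool list" where "ea e \<equiv> fst (snd (snd e))"
abbreviation eb :: "centry \<Rightarrow> bool list" where "eb e \<equiv> fst (snd (snd (snd e)))"
abbreviation eW :: "centry \<Rightarrow> bool list" where "eW e \<equiv> fst (snd (snd (snd (snd e))))"
abbreviation eS :: "centry \<Rightarrow> bool" where "eS e \<equiv> snd (snd (snd (snd (snd e))))"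

text \<open>Endpoints are below \<open>n\<close>, which is written in unary, and can be numbers;
  \<open>a\<close> and \<open>b\<close> can be exponentially large and stay bit lists.\<close>

definition cenc :: "centry \<Rightarrow> bool list" where
  "cenc e = enc_nat (eu e) @ enc_nat (ev e) @ self_delim (ea e) @ self_delim (eb e)"

text \<open>A normal form for edges: the ordered pair if directed, the sorted pair if undirected. It
  detects repeated edges.\<close>

definition ekey :: "bool \<Rightarrow> centry \<Rightarrow> nat \<times> nat" where
  "ekey d e = (if d \<or> eu e \<le> ev e then (eu e, ev e) else (ev e, eu e))"

definition arcs :: "bool \<Rightarrow> centry list \<Rightarrow> carc list" where
  "arcs d es = map (\<lambda>e. (eu e, ev e, eW e, eS e)) es @
     (if d then [] else map (\<lambda>e. (ev e, eu e, eW e, eS e)) es)"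

definition arc_le :: "bool list list \<Rightarrow> carc \<Rightarrow> bool" where
  "arc_le ds a \<longleftrightarrow> leqb (nthd [] ds (fst (snd a))) (addb (nthd [] ds (fst a)) (fst (snd (snd a))))"

text \<open>Only the reverse inequality is tested; combined with \<open>arc_le\<close> for all arcs
  it means tightness.\<close>

definition arc_free :: "bool list list \<Rightarrow> carc \<Rightarrow> bool" where
  "arc_free ds a \<longleftrightarrow> leqb (addb (nthd [] ds (fst a)) (fst (snd (snd a)))) (nthd [] ds (fst (snd a))) \<and> \<not> snd (snd (snd a))"

text \<open>
  The certificate repeats the instance, with all weights \<open>a / b\<close> rewritten as \<open>W / B\<close>, and lists
  the path \<open>P\<close>, the potentials \<open>ds\<close> in units of \<open>1 / B\<close> and the set \<open>As\<close> of vertices that can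
  still reach \<open>t\<close>. The flag \<open>r\<close> restricts the check to undirected graphs with unit weights.
\<close>

definition verify :: "bool \<Rightarrow> bool list \<Rightarrow> bool \<Rightarrow> nat \<Rightarrow> centry list \<Rightarrow> nat \<Rightarrow> nat \<Rightarrow> bool list \<Rightarrow>
    nat list \<Rightarrow> bool list \<Rightarrow> bool list list \<Rightarrow> bool list \<Rightarrow> bool" where
  "verify r x d n es s t kb P B ds As \<longleftrightarrow>
     x = d # replicate n True @ [False] @ enc_list cenc es @ enc_nat s @ enc_nat t @ self_delim kb \<and>
     s < n \<and> t < n \<and> canon kb \<and> \<not> leqb B [] \<and> (r \<longrightarrow> \<not> d) \<and>
     (\<forall>e\<in>set es. eu e < n \<and> ev e < n \<and> eu e \<noteq> ev e \<and> canon (ea e) \<and> canon (eb e) \<and> ea e \<noteq> [] \<and> eb e \<noteq> [] \<and>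
        leqb (mulb (eW e) (eb e)) (mulb (ea e) B) \<and> leqb (mulb (ea e) B) (mulb (eW e) (eb e)) \<and>
        (r \<longrightarrow> ea e = eb e)) \<and>
     distinct (map (ekey d) es) \<and>
     leqb (nthd [] ds s) [] \<and> nthd False As t \<and>
     (\<forall>a\<in>set (arcs d es). arc_le ds a \<and> (arc_free ds a \<and> nthd False As (fst (snd a)) \<longrightarrow> nthd False As (fst a))) \<and>
     P \<noteq> [] \<and> hdd 0 P = s \<and> hdd 0 (rev P) = t \<and>
     (\<forall>i\<in>set [0..<length P - 1].
        (\<exists>a\<in>set (arcs d es). fst a = nthd 0 P i \<and> fst (snd a) = nthd 0 P (Suc i) \<and> arc_free ds a) \<and>
        (\<forall>a\<in>set (arcs d es). fst a = nthd 0 P i \<and> arc_free ds a \<and> nthd False As (fst (snd a)) \<longrightarrow>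
           fst (snd a) = nthd 0 P (Suc i))) \<and>
     leqb (binary (length (filter (\<lambda>e. eS e) es))) kb"

definition vcheck :: "bool \<Rightarrow> bool list \<times> cert \<Rightarrow> bool" where
  "vcheck r z = verify r (fst z) (fst (fst (snd z))) (fst (snd (fst (snd z)))) (fst (snd (snd (fst (snd z)))))
     (fst (snd (snd (snd (fst (snd z)))))) (fst (snd (snd (snd (snd (fst (snd z)))))))
     (snd (snd (snd (snd (snd (fst (snd z)))))))
     (fst (snd (snd z))) (fst (snd (snd (snd z)))) (fst (snd (snd (snd (snd z))))) (snd (snd (snd (snd (snd z)))))"

lemma vcheck_simp: "vcheck r (x, ((d, n, es, s, t, kb), (P, B, ds, As))) = verify r x d n es s t kb P B ds As"
  by (simp add: vcheck_def)

definition dcert :: "tree \<Rightarrow> cert" where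
  "dcert = dprod (dprod dbool (dprod dnat (dprod
      (dlst (dprod dnat (dprod dnat (dprod (dlst dbool) (dprod (dlst dbool) (dprod (dlst dbool) dbool))))))
      (dprod dnat (dprod dnat (dlst dbool))))))
    (dprod (dlst dnat) (dprod (dlst dbool) (dprod (dlst (dlst dbool)) (dlst dbool))))"

lemma dcert_tt: "dcert (tt c) = c"
  unfolding dcert_def by simp

lemma PT_dcert [pt]: "PT f \<Longrightarrow> PT (\<lambda>x. dcert (f x))"
proof (rule PT_comp[of dcert])
  show "PT dcert"
    unfolding dcert_def dprod_def dlst_def dnat_def dbool_def by (intro pt)
qed

lemma PT_vcheck [pt]: "PT f \<Longrightarrow> PT (\<lambda>x. vcheck r (f x))"
proof (rule PT_comp[of "vcheck r"])
  show "PT (vcheck r)"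
    unfolding vcheck_def verify_def arcs_def arc_le_def arc_free_def cenc_def ekey_def canon_def by (intro pt)
qed

definition verifier :: "bool \<Rightarrow> language" where
  "verifier r = {z. fst (unpair z) = 2 \<and>
     vcheck r (rev (fst (snd (unpair z))), dcert (rpn_parse (rev (snd (snd (unpair z))))))}"

lemma in_P_verifier: "in_P (verifier r)"
proof -
  have "PT (\<lambda>z. [z \<in> verifier r])"
    unfolding verifier_def mem_Collect_eq by (intro pt)
  then show ?thesis unfolding in_P_def by (rule PT_poly_time)
qed

lemma verifier_pair_str: "pair_str x u \<in> verifier r \<longleftrightarrow> vcheck r (x, dcert (rpn_parse u))"
  by (simp add: verifier_def unpair_pair_str)

definition lang :: "bool \<Rightarrow> language" where
  "lang r = (if r then ANTI_FORCING_undirected_unit else ANTI_FORCING)"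

lemma lang_iff:
  "x \<in> lang r \<longleftrightarrow> (\<exists>G w s t k. encodes_instance x G w s t k \<and> valid_instance G w s t \<and>
     (r \<longrightarrow> \<not> is_directed G \<and> (\<forall>e\<in>edges G. w e = 1)) \<and> (\<exists>S. anti_forcing_set G w s t S \<and> card S \<le> k))"
  by (auto simp: lang_def ANTI_FORCING_def ANTI_FORCING_undirected_unit_def)

lemma eq_ekey_iff:
  "edge_of G (eu e) (ev e) = edge_of G (eu e') (ev e') \<longleftrightarrow> ekey (is_directed G) e = ekey (is_directed G) e'"
  by (auto simp: edge_of_eq_iff ekey_def)

lemma arcs_iff:
  "a \<in> set (arcs (is_directed G) es) \<longleftrightarrow>
     (\<exists>e\<in>set es. edge_of G (eu e) (ev e) = edge_of G (fst a) (fst (snd a)) \<and> snd (snd a) = (eW e, eS e))"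
proof -
  have "a \<in> set (arcs (is_directed G) es) \<longleftrightarrow>
      (\<exists>e\<in>set es. a = (eu e, ev e, eW e, eS e) \<or> \<not> is_directed G \<and> a = (ev e, eu e, eW e, eS e))"
    by (auto simp: arcs_def)
  also have "\<dots> \<longleftrightarrow> (\<exists>e\<in>set es. edge_of G (eu e) (ev e) = edge_of G (fst a) (fst (snd a)) \<and> snd (snd a) = (eW e, eS e))"
    by (rule bex_cong[OF refl]) (cases a, auto simp: edge_of_eq_iff)
  finally show ?thesis .
qed

locale arc_list = weighted G w W B
  for G :: "nat graph" and w :: "nat edge \<Rightarrow> real" and W :: "nat edge \<Rightarrow> nat" and B :: nat +
  fixes es :: "centry list" and S :: "nat edge set" and D :: "nat \<Rightarrow> nat" and ds :: "bool list list"
  assumes edges_es: "edges G = (\<lambda>e. edge_of G (eu e) (ev e)) ` set es"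
    and W_es: "\<And>e. e \<in> set es \<Longrightarrow> W (edge_of G (eu e) (ev e)) = val (eW e)"
    and S_es: "\<And>e. e \<in> set es \<Longrightarrow> edge_of G (eu e) (ev e) \<in> S \<longleftrightarrow> eS e"
    and D_ds: "\<And>v. v \<in> verts G \<Longrightarrow> val (nthd [] ds v) = D v"
begin

lemma arc_edge:
  assumes "a \<in> set (arcs (is_directed G) es)"
  shows "eg (fst a) (fst (snd a)) \<in> edges G" "W (eg (fst a) (fst (snd a))) = val (fst (snd (snd a)))"
    "eg (fst a) (fst (snd a)) \<in> S \<longleftrightarrow> snd (snd (snd a))"
proof -
  obtain e where e: "e \<in> set es" "eg (eu e) (ev e) = eg (fst a) (fst (snd a))" "snd (snd a) = (eW e, eS e)"
    using assms arcs_iff by blast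
  show "eg (fst a) (fst (snd a)) \<in> edges G"
    unfolding e(2)[symmetric] edges_es using e(1) by blast
  show "W (eg (fst a) (fst (snd a))) = val (fst (snd (snd a)))"
    unfolding e(2)[symmetric] using W_es[OF e(1)] e(3) by simp
  show "eg (fst a) (fst (snd a)) \<in> S \<longleftrightarrow> snd (snd (snd a))"
    unfolding e(2)[symmetric] using S_es[OF e(1)] e(3) by simp
qed

lemma edge_arc:
  assumes "eg u v \<in> edges G"
  shows "\<exists>a\<in>set (arcs (is_directed G) es). fst a = u \<and> fst (snd a) = v"
proof -
  obtain e where "e \<in> set es" "eg (eu e) (ev e) = eg u v" using assms by (auto simp: edges_es)
  then have "(u, v, eW e, eS e) \<in> set (arcs (is_directed G) es)" by (auto simp: arcs_iff)
  then show ?thesis by (rule bexI[rotated]) simp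
qed

lemma arc_conditions:
  assumes "a \<in> set (arcs (is_directed G) es)"
  shows "arc_le ds a \<longleftrightarrow> D (fst (snd a)) \<le> D (fst a) + W (eg (fst a) (fst (snd a)))"
    and "arc_free ds a \<longleftrightarrow> D (fst a) + W (eg (fst a) (fst (snd a))) \<le> D (fst (snd a)) \<and> eg (fst a) (fst (snd a)) \<notin> S"
  using arc_edge[OF assms] edge_verts D_ds by (auto simp: arc_le_def arc_free_def leqb_iff val_addb)

lemma all_arcs_le: "(\<forall>a\<in>set (arcs (is_directed G) es). arc_le ds a) \<longleftrightarrow>
    (\<forall>u v. eg u v \<in> edges G \<longrightarrow> D v \<le> D u + W (eg u v))"
  using arc_conditions(1) arc_edge(1) edge_arc by metis

lemma arc_free_tight:
  assumes "\<And>u v. eg u v \<in> edges G \<Longrightarrow> D v \<le> D u + W (eg u v)" "a \<in> set (arcs (is_directed G) es)"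
  shows "arc_free ds a \<longleftrightarrow> tight D (fst a) (fst (snd a)) \<and> eg (fst a) (fst (snd a)) \<notin> S"
  using arc_conditions(2)[OF assms(2)] arc_edge(1)[OF assms(2)] assms(1)[OF arc_edge(1)[OF assms(2)]]
  by (auto simp: tight_def)

lemma ex_arc_free:
  assumes "\<And>u v. eg u v \<in> edges G \<Longrightarrow> D v \<le> D u + W (eg u v)"
  shows "(\<exists>a\<in>set (arcs (is_directed G) es). fst a = u \<and> fst (snd a) = v \<and> arc_free ds a) \<longleftrightarrow>
    tight D u v \<and> eg u v \<notin> S"
  using arc_free_tight[OF assms] edge_arc[of u v] unfolding tight_def by metis

text \<open>An infeasible potential falsifies both sides through the test \<open>arc_le\<close>.
  Under feasibility, \<open>arc_free\<close> picks out the tight edges outside \<open>S\<close>, and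
  each edge appears in every admissible orientation among the arcs.\<close>

lemma certifies_iff:
  assumes A0: "\<forall>v\<in>verts G. nthd False As v \<longleftrightarrow> v \<in> A" and st: "s \<in> verts G" "t \<in> verts G"
  shows "certifies s t S D A P \<longleftrightarrow> leqb (nthd [] ds s) [] \<and> nthd False As t \<and>
     (\<forall>a\<in>set (arcs (is_directed G) es). arc_le ds a \<and>
        (arc_free ds a \<and> nthd False As (fst (snd a)) \<longrightarrow> nthd False As (fst a))) \<and>
     P \<noteq> [] \<and> hdd 0 P = s \<and> hdd 0 (rev P) = t \<and>
     (\<forall>i\<in>set [0..<length P - 1].
        (\<exists>a\<in>set (arcs (is_directed G) es). fst a = nthd 0 P i \<and> fst (snd a) = nthd 0 P (Suc i) \<and> arc_free ds a) \<and>
        (\<forall>a\<in>set (arcs (is_directed G) es). fst a = nthd 0 P i \<and> arc_free ds a \<and> nthd False As (fst (snd a)) \<longrightarrow>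
           fst (snd a) = nthd 0 P (Suc i)))"
    (is "?L \<longleftrightarrow> ?R")
proof (cases "\<forall>u v. eg u v \<in> edges G \<longrightarrow> D v \<le> D u + W (eg u v)")
  case False
  then show ?thesis using all_arcs_le by (auto simp: certifies_def feasible_def)
next
  case True
  have A: "nthd False As v \<longleftrightarrow> v \<in> A" if "v \<in> verts G" for v using A0 that by blast
  from True have le: "\<And>u v. eg u v \<in> edges G \<Longrightarrow> D v \<le> D u + W (eg u v)" by blast
  have hds: "P \<noteq> [] \<Longrightarrow> hdd 0 P = hd P" by (cases P) simp_all
  have lasts: "P \<noteq> [] \<Longrightarrow> hdd 0 (rev P) = last P" by (cases P rule: rev_cases) simp_all
  have closed: "(\<forall>a\<in>set (arcs (is_directed G) es). arc_free ds a \<and> nthd False As (fst (snd a)) \<longrightarrow> nthd False As (fst a))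
      \<longleftrightarrow> (\<forall>u v. tight D u v \<and> eg u v \<notin> S \<and> v \<in> A \<longrightarrow> u \<in> A)" (is "?C \<longleftrightarrow> ?C'")
  proof
    assume c: ?C
    show ?C'
    proof (intro allI impI)
      fix u v assume uv: "tight D u v \<and> eg u v \<notin> S \<and> v \<in> A"
      then obtain a where a: "a \<in> set (arcs (is_directed G) es)" "fst a = u" "fst (snd a) = v" "arc_free ds a"
        using ex_arc_free[OF le, of u v] by blast
      have "u \<in> verts G" "v \<in> verts G" using uv edge_verts unfolding tight_def by blast+
      then show "u \<in> A" using c a A uv by blast
    qed
  next
    assume c: ?C'
    show ?C
    proof (intro ballI impI)
      fix a assume a: "a \<in> set (arcs (is_directed G) es)" "arc_free ds a \<and> nthd False As (fst (snd a))"
      have "fst a \<in> verts G" "fst (snd a) \<in> verts G" using arc_edge(1)[OF a(1)] edge_verts by blast+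
      then show "nthd False As (fst a)" using c a A arc_free_tight[OF le a(1)] by blast
    qed
  qed
  have follow: "(\<forall>a\<in>set (arcs (is_directed G) es). fst a = u \<and> arc_free ds a \<and> nthd False As (fst (snd a)) \<longrightarrow> fst (snd a) = v')
      \<longleftrightarrow> (\<forall>v. tight D u v \<and> eg u v \<notin> S \<and> v \<in> A \<longrightarrow> v = v')" (is "?F \<longleftrightarrow> ?F'") for u v'
  proof
    assume c: ?F
    show ?F'
    proof (intro allI impI)
      fix v assume uv: "tight D u v \<and> eg u v \<notin> S \<and> v \<in> A"
      then obtain a where a: "a \<in> set (arcs (is_directed G) es)" "fst a = u" "fst (snd a) = v" "arc_free ds a"
        using ex_arc_free[OF le, of u v] by blast
      have "v \<in> verts G" using uv edge_verts unfolding tight_def by blast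
      then show "v = v'" using c a A uv by blast
    qed
  next
    assume c: ?F'
    show ?F
    proof (intro ballI impI)
      fix a assume a: "a \<in> set (arcs (is_directed G) es)" "fst a = u \<and> arc_free ds a \<and> nthd False As (fst (snd a))"
      have "fst (snd a) \<in> verts G" using arc_edge(1)[OF a(1)] edge_verts by blast
      then show "fst (snd a) = v'" using c a A arc_free_tight[OF le a(1)] by blast
    qed
  qed
  have nths: "(\<forall>i\<in>set [0..<length P - 1]. Q i (nthd 0 P i) (nthd 0 P (Suc i))) \<longleftrightarrow>
      (\<forall>i. Suc i < length P \<longrightarrow> Q i (P ! i) (P ! Suc i))" for Q
    by (auto simp: nthd_def less_diff_conv)
  have zero: "leqb (nthd [] ds s) [] \<longleftrightarrow> D s = 0" using D_ds[OF st(1)] by (simp add: leqb_iff)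
  have alle: "(\<forall>a\<in>set (arcs (is_directed G) es). arc_le ds a) = True" using all_arcs_le True by blast
  have "?R \<longleftrightarrow> leqb (nthd [] ds s) [] \<and> nthd False As t \<and>
     (\<forall>a\<in>set (arcs (is_directed G) es). arc_le ds a \<and>
        (arc_free ds a \<and> nthd False As (fst (snd a)) \<longrightarrow> nthd False As (fst a))) \<and>
     P \<noteq> [] \<and> hdd 0 P = s \<and> hdd 0 (rev P) = t \<and>
     (\<forall>i\<in>set [0..<length P - 1]. (tight D (nthd 0 P i) (nthd 0 P (Suc i)) \<and> eg (nthd 0 P i) (nthd 0 P (Suc i)) \<notin> S) \<and>
       (\<forall>v. tight D (nthd 0 P i) v \<and> eg (nthd 0 P i) v \<notin> S \<and> v \<in> A \<longrightarrow> v = nthd 0 P (Suc i)))"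
    by (simp only: ex_arc_free[OF le] follow)
  also have "\<dots> \<longleftrightarrow> D s = 0 \<and> t \<in> A \<and> (\<forall>u v. tight D u v \<and> eg u v \<notin> S \<and> v \<in> A \<longrightarrow> u \<in> A) \<and>
     P \<noteq> [] \<and> hd P = s \<and> last P = t \<and>
     (\<forall>i. Suc i < length P \<longrightarrow> (tight D (P ! i) (P ! Suc i) \<and> eg (P ! i) (P ! Suc i) \<notin> S) \<and>
       (\<forall>v. tight D (P ! i) v \<and> eg (P ! i) v \<notin> S \<and> v \<in> A \<longrightarrow> v = P ! Suc i))"
  proof (cases "P = []")
    case False
    show ?thesis
      unfolding zero ball_conj_distrib[of _ "arc_le ds"] closed hds[OF False] lasts[OF False] A[OF st(2)]
        nths[of "\<lambda>_ u v'. (tight D u v' \<and> eg u v' \<notin> S) \<and> (\<forall>v. tight D u v \<and> eg u v \<notin> S \<and> v \<in> A \<longrightarrow> v = v')"]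
      by (simp only: alle simp_thms)
  qed simp
  finally have "?R \<longleftrightarrow> D s = 0 \<and> t \<in> A \<and> (\<forall>u v. tight D u v \<and> eg u v \<notin> S \<and> v \<in> A \<longrightarrow> u \<in> A) \<and>
     P \<noteq> [] \<and> hd P = s \<and> last P = t \<and>
     (\<forall>i. Suc i < length P \<longrightarrow> (tight D (P ! i) (P ! Suc i) \<and> eg (P ! i) (P ! Suc i) \<notin> S) \<and>
       (\<forall>v. tight D (P ! i) v \<and> eg (P ! i) v \<notin> S \<and> v \<in> A \<longrightarrow> v = P ! Suc i))" .
  then show ?thesis using True by (simp add: certifies_def feasible_def)
qed

end

subsection \<open>Soundness\<close>

text \<open>The instance is rebuilt from the certificate. Since the numerals in it are canonical,
  encoding that instance again yields \<open>x\<close> itself.\<close>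

theorem verify_sound:
  assumes v: "verify r x d n es s t kb P B ds As"
  shows "x \<in> lang r"
proof -
  note ver = v[unfolded verify_def]
  have x: "x = d # replicate n True @ [False] @ enc_list cenc es @ enc_nat s @ enc_nat t @ self_delim kb"
    and st: "s < n" "t < n" and kb: "canon kb" and B0: "val B > 0" and r: "r \<longrightarrow> \<not> d"
    and es: "\<And>e. e \<in> set es \<Longrightarrow> eu e < n \<and> ev e < n \<and> eu e \<noteq> ev e \<and> canon (ea e) \<and> canon (eb e) \<and> ea e \<noteq> [] \<and> eb e \<noteq> [] \<and>
        val (eW e) * val (eb e) = val (ea e) * val B \<and> (r \<longrightarrow> ea e = eb e)"
    and dist: "distinct (map (ekey d) es)"
    and count: "length (filter (\<lambda>e. eS e) es) \<le> val kb"
    using ver by (auto simp: leqb_iff val_mulb intro: antisym)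
  define G where "G = \<lparr>is_directed = d, verts = {..<n},
    edges = (\<lambda>e. if d then Arc (eu e) (ev e) else Link {eu e, ev e}) ` set es\<rparr>"
  have Gd: "is_directed G = d" "verts G = {..<n}" by (simp_all add: G_def)
  let ?g = "\<lambda>e. edge_of G (eu e) (ev e)"
  have edges_G: "edges G = ?g ` set es" by (simp add: G_def edge_of_def)
  have inj: "inj_on ?g (set es)"
    using dist eq_ekey_iff[of G] unfolding Gd by (auto simp: inj_on_def distinct_map)
  \<comment> \<open>Distinct keys make an edge determine its entry, so weights and scaled weights
    become functions of edges.\<close>
  define ent where "ent = inv_into (set es) ?g"
  have ent: "ent (?g e) = e" if "e \<in> set es" for e
    unfolding ent_def by (rule inv_into_f_f[OF inj that])
  define w where "w E = real (val (ea (ent E))) / real (val (eb (ent E)))" for E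
  define W where "W E = val (eW (ent E))" for E
  define S where "S = ?g ` {e \<in> set es. eS e}"
  define A where "A = {v. nthd False As v}"
  have pos: "val (ea e) > 0" "val (eb e) > 0" if "e \<in> set es" for e
    using es[OF that] val_pos by auto
  interpret weighted G w W "val B"
  proof
    show "wf_graph G"
      unfolding wf_graph_def Gd edges_G using es by fastforce
    show "val B > 0" by (rule B0)
    fix E assume "E \<in> edges G"
    then obtain e where e: "e \<in> set es" "E = ?g e" by (auto simp: edges_G)
    have m: "real (val (eW e)) * real (val (eb e)) = real (val (ea e)) * real (val B)"
      using es[OF e(1)] by (simp flip: of_nat_mult)
    then show "w E = real (W E) / real (val B)"
      using pos[OF e(1)] B0 by (simp add: w_def W_def ent e frac_eq_eq)
    have "val (ea e) * val B > 0" using pos[OF e(1)] B0 by simp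
    then have "val (eW e) * val (eb e) > 0" using es[OF e(1)] by simp
    then show "W E > 0" by (simp add: W_def ent e)
  qed
  have S_iff: "?g e \<in> S \<longleftrightarrow> eS e" if "e \<in> set es" for e
    using that inj_onD[OF inj _ that] by (auto simp: S_def)
  interpret arc_list G w W "val B" es S "\<lambda>v. val (nthd [] ds v)" ds
    by standard (use edges_G S_iff in \<open>auto simp: W_def ent\<close>)
  have "certifies s t S (\<lambda>v. val (nthd [] ds v)) A P"
    by (subst certifies_iff[of As]) (use ver st in \<open>auto simp: A_def Gd\<close>)
  then have af: "anti_forcing_set G w s t S"
    by (rule certifies_imp_anti_forcing) (use st in \<open>auto simp: S_def edges_G Gd\<close>)
  have "card S \<le> card {e \<in> set es. eS e}" unfolding S_def by (rule card_image_le) simp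
  also have "\<dots> = card (set (filter (\<lambda>e. eS e) es))" by simp
  also have "\<dots> \<le> length (filter (\<lambda>e. eS e) es)" by (rule card_length)
  finally have card: "card S \<le> val kb" using count by simp
  define es' where "es' = map (\<lambda>e. (eu e, ev e, val (ea e), val (eb e))) es"
  have enc: "encodes_instance x G w s t (val kb)"
    unfolding encodes_instance_def
  proof (intro exI[of _ n] exI[of _ es'] conjI)
    have "map (\<lambda>x. True # enc_entry x) es' = map (\<lambda>x. True # cenc x) es"
      using es by (auto simp: es'_def cenc_def enc_nat_def binary_val)
    then have "enc_list enc_entry es' = enc_list cenc es" by (simp add: enc_list_def)
    then show "x = enc_data (is_directed G) n es' s t (val kb)"
      using x kb by (simp add: enc_data_def Gd enc_nat_def[of "val kb"] binary_val)
    show "verts G = {..<n}" by (rule Gd)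
    show "edges G = (\<lambda>(u, v, a, b). edge_of G u v) ` set es'" by (force simp: es'_def edges_G)
    have "map (\<lambda>(u, v, a, b). edge_of G u v) es' = map ?g es" by (simp add: es'_def)
    moreover have "distinct es" using dist by (simp add: distinct_map)
    ultimately show "distinct (map (\<lambda>(u, v, a, b). edge_of G u v) es')" using inj by (simp add: distinct_map)
    show "\<forall>(u, v, a, b)\<in>set es'. b \<noteq> 0 \<and> w (edge_of G u v) = real a / real b"
      unfolding es'_def set_map ball_simps(9)
    proof (intro ballI, unfold case_prod_conv)
      fix e assume e: "e \<in> set es"
      show "val (eb e) \<noteq> 0 \<and> w (?g e) = real (val (ea e)) / real (val (eb e))"
        using pos[OF e] by (simp add: w_def ent[OF e])
    qed
  qed
  have valid: "valid_instance G w s t"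
    unfolding valid_instance_def using wf st pos by (auto simp: Gd edges_G w_def ent)
  have "r \<longrightarrow> \<not> is_directed G \<and> (\<forall>E\<in>edges G. w E = 1)"
  proof (intro impI conjI ballI)
    fix E assume r: "r" and "E \<in> edges G"
    then obtain e where e: "e \<in> set es" "E = ?g e" by (auto simp: edges_G)
    then show "w E = 1" using es[OF e(1)] pos[OF e(1)] r by (simp add: w_def ent)
  qed (use r in \<open>simp add: Gd\<close>)
  then show ?thesis unfolding lang_iff using enc valid af card by blast
qed

subsection \<open>Completeness\<close>

lemma length_self_delim: "length (self_delim x) = 2 * length x + 1"
  by (induction x) (auto simp: self_delim_def)

lemma length_enc_nat: "length (enc_nat k) = 2 * length (binary k) + 1"
  by (simp add: enc_nat_def length_self_delim)

lemma length_enc_list: "length (enc_list f xs) = 1 + (\<Sum>x\<leftarrow>xs. 1 + length (f x))"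
  by (induction xs) (auto simp: enc_list_def)

lemma sum_list_member: "x \<in> set xs \<Longrightarrow> f x \<le> (\<Sum>x\<leftarrow>xs. f x :: nat)"
  by (rule member_le_sum_list) auto

lemma binary_eq_Nil: "binary a = [] \<Longrightarrow> a = 0"
  using val_binary[of a] by simp

lemma enc_data_length:
  assumes "Lx = length (enc_data d n es s t k)"
  shows "n \<le> Lx" "length es \<le> Lx" "(u, v, a, b) \<in> set es \<Longrightarrow> length (binary a) \<le> Lx \<and> length (binary b) \<le> Lx"
    "(\<Sum>e\<leftarrow>es. length (binary (snd (snd (snd e))))) \<le> Lx" "length (binary k) \<le> Lx" "Lx \<ge> 1"
proof -
  have Lx: "Lx = 2 + n + length (enc_list enc_entry es) + length (enc_nat s) + length (enc_nat t) + length (enc_nat k)"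
    by (simp add: assms enc_data_def)
  have L: "length (enc_list enc_entry es) = 1 + (\<Sum>e\<leftarrow>es. 1 + length (enc_entry e))" by (rule length_enc_list)
  show "n \<le> Lx" "length (binary k) \<le> Lx" "Lx \<ge> 1" using Lx by (simp_all add: length_enc_nat)
  have "length es = (\<Sum>e\<leftarrow>es. 1)" by (simp add: sum_list_triv)
  also have "\<dots> \<le> (\<Sum>e\<leftarrow>es. 1 + length (enc_entry e))" by (rule sum_list_mono) simp
  finally show "length es \<le> Lx" using Lx L by linarith
  have "(\<Sum>e\<leftarrow>es. length (binary (snd (snd (snd e))))) \<le> (\<Sum>e\<leftarrow>es. 1 + length (enc_entry e))"
    by (rule sum_list_mono) (simp add: enc_entry_eq length_enc_nat)
  then show "(\<Sum>e\<leftarrow>es. length (binary (snd (snd (snd e))))) \<le> Lx" using Lx L by linarith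
  show "length (binary a) \<le> Lx \<and> length (binary b) \<le> Lx" if "(u, v, a, b) \<in> set es"
    using sum_list_member[OF that, of "\<lambda>e. 1 + length (enc_entry e)"] Lx L by (simp add: length_enc_nat)
qed

text \<open>Bit lengths add up under multiplication, so the product of all denominators is no longer
  than the input.\<close>

lemma prod_list_le_power:
  "(\<Prod>e\<leftarrow>es. f e) \<le> (2 :: nat) ^ (\<Sum>e\<leftarrow>es. length (binary (f e)))"
proof (induction es)
  case (Cons e es)
  have "f e \<le> 2 ^ length (binary (f e))" using less_binary[of "f e"] by simp
  then show ?case using mult_mono[OF _ Cons] by (simp add: power_add)
qed simp

lemma dvd_prod_list: "x \<in> set xs \<Longrightarrow> f x dvd (\<Prod>x\<leftarrow>xs. f x :: nat)"
  by (induction xs) auto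

lemma prod_list_pos: "(\<And>x. x \<in> set xs \<Longrightarrow> f x > 0) \<Longrightarrow> (\<Prod>x\<leftarrow>xs. f x :: nat) > 0"
  by (induction xs) auto

lemma sz_bits_le: "length bs \<le> L \<Longrightarrow> sz (bs :: bool list) \<le> 1 + 4 * L"
  using sz_bits[of bs] by linarith

text \<open>The substance beyond checking the conditions is the size: unary numbers are bounded by
  the input length, and all bit lists in the certificate have linear length.\<close>

theorem verify_complete:
  assumes "x \<in> lang r"
  shows "\<exists>c. vcheck r (x, c) \<and> sz c \<le> 1000 * (length x * length x)"
proof -
  obtain G w s t k S where enc: "encodes_instance x G w s t k" and valid: "valid_instance G w s t"
    and r: "r \<longrightarrow> \<not> is_directed G \<and> (\<forall>e\<in>edges G. w e = 1)"
    and S: "anti_forcing_set G w s t S" "card S \<le> k"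
    using assms unfolding lang_iff by blast
  obtain n es0 where x: "x = enc_data (is_directed G) n es0 s t k" and Gv: "verts G = {..<n}"
    and edges0: "edges G = (\<lambda>(u, v, a, b). edge_of G u v) ` set es0"
    and dist0: "distinct (map (\<lambda>(u, v, a, b). edge_of G u v) es0)"
    and w0: "\<forall>(u, v, a, b) \<in> set es0. b \<noteq> 0 \<and> w (edge_of G u v) = real a / real b"
    using enc unfolding encodes_instance_def by blast
  define Lx where "Lx = length x"
  note len = enc_data_length[OF Lx_def[unfolded x]]
  have wf: "wf_graph G" and w_pos: "\<And>e. e \<in> edges G \<Longrightarrow> w e > 0" and st: "s < n" "t < n"
    using valid Gv by (auto simp: valid_instance_def)
  let ?g = "\<lambda>e. edge_of G (fst e) (fst (snd e))"
  let ?a = "\<lambda>e :: edge_entry. fst (snd (snd e))" and ?b = "\<lambda>e :: edge_entry. snd (snd (snd e))"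
  have gg: "(\<lambda>(u, v, a, b). edge_of G u v) = ?g" by (simp add: case_prod_beta')
  have edges_G: "edges G = ?g ` set es0" and dist: "distinct (map ?g es0)" using edges0 dist0 unfolding gg by auto
  have inj: "inj_on ?g (set es0)" using dist by (simp add: distinct_map)
  have wg: "?b e > 0" "w (?g e) = real (?a e) / real (?b e)" "?a e > 0" if "e \<in> set es0" for e
  proof -
    show 1: "?b e > 0" "w (?g e) = real (?a e) / real (?b e)" using bspec[OF w0 that] by (simp_all add: case_prod_beta)
    have "w (?g e) > 0" using w_pos that by (auto simp: edges_G)
    then show "?a e > 0" using 1 by (simp add: zero_less_divide_iff)
  qed
  have uv: "fst e < n" "fst (snd e) < n" "fst e \<noteq> fst (snd e)" if "e \<in> set es0" for e
  proof -
    have "?g e \<in> {edge_of G u v |u v. u \<in> verts G \<and> v \<in> verts G \<and> u \<noteq> v}"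
      using that wf unfolding wf_graph_def edges_G by blast
    then show "fst e < n" "fst (snd e) < n" "fst e \<noteq> fst (snd e)" by (auto simp: edge_of_eq_iff Gv)
  qed
  \<comment> \<open>The product serves as common denominator; unlike the least common multiple it
    needs no further computation, and its length is bounded by that of the input.\<close>
  define B where "B = (\<Prod>e\<leftarrow>es0. ?b e)"
  define We where "We e = ?a e * (B div ?b e)" for e
  have dvd: "?b e dvd B" if "e \<in> set es0" for e
    unfolding B_def by (rule dvd_prod_list[OF that])
  have B_pos: "B > 0"
    unfolding B_def by (rule prod_list_pos) (rule wg(1))
  define ent where "ent = inv_into (set es0) ?g"
  have ent: "ent (?g e) = e" if "e \<in> set es0" for e
    unfolding ent_def by (rule inv_into_f_f[OF inj that])
  define W where "W E = We (ent E)" for E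
  interpret weighted G w W B
  proof
    show "wf_graph G" "B > 0" by (rule wf B_pos)+
    fix E assume "E \<in> edges G"
    then obtain e where e: "e \<in> set es0" "E = ?g e" by (auto simp: edges_G)
    have "real (B div ?b e) = real B / real (?b e)" using dvd[OF e(1)] by (simp add: real_of_nat_div)
    then show "w E = real (W E) / real B" using wg[OF e(1)] B_pos by (simp add: W_def ent e We_def)
    have "B div ?b e > 0" using dvd[OF e(1)] wg(1)[OF e(1)] B_pos by (auto simp: dvd_imp_le div_greater_zero_iff)
    then show "W E > 0" using wg(3)[OF e(1)] by (simp add: W_def ent e We_def)
  qed
  obtain A P where cert: "certifies s t S (dst s) A P" and P: "distinct P" "set P \<subseteq> verts G"
    using anti_forcing_imp_certificate[OF S(1)] st Gv by auto
  define f where "f e = (fst e, fst (snd e), binary (?a e), binary (?b e), binary (We e), ?g e \<in> S)" for e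
  define es where "es = map f es0"
  define ds where "ds = map (\<lambda>v. binary (dst s v)) [0..<n]"
  define As where "As = map (\<lambda>v. v \<in> A) [0..<n]"
  have es_g: "map (\<lambda>e. edge_of G (eu e) (ev e)) es = map ?g es0" by (simp add: es_def f_def)
  interpret arc_list G w W B es S "dst s" ds
  proof
    show "edges G = (\<lambda>e. edge_of G (eu e) (ev e)) ` set es"
      unfolding edges_G using arg_cong[OF es_g, of set] by simp
    show "val (nthd [] ds v) = dst s v" if "v \<in> verts G" for v
      using that by (simp add: ds_def nthd_def Gv)
    fix e assume "e \<in> set es"
    then obtain e0 where e0: "e0 \<in> set es0" "e = f e0" unfolding es_def by (metis imageE set_map)
    show "W (edge_of G (eu e) (ev e)) = val (eW e)" "edge_of G (eu e) (ev e) \<in> S \<longleftrightarrow> eS e"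
      by (simp_all add: e0(2) f_def W_def ent[OF e0(1)])
  qed
  have A_iff: "\<forall>v\<in>verts G. nthd False As v \<longleftrightarrow> v \<in> A"
    by (simp add: As_def nthd_def Gv)
  have stV: "s \<in> verts G" "t \<in> verts G" using st by (simp_all add: Gv)
  note crt = iffD1[OF certifies_iff[OF A_iff stV] cert]
  have check: "verify r x (is_directed G) n es s t (binary k) P (binary B) ds As"
    unfolding verify_def
  proof (intro conjI)
    have "map (\<lambda>x. True # enc_entry x) es0 = map (\<lambda>x. True # cenc x) es"
      by (auto simp: es_def f_def cenc_def enc_nat_def enc_entry_eq)
    then show "x = is_directed G # replicate n True @ [False] @ enc_list cenc es @ enc_nat s @ enc_nat t @ self_delim (binary k)"
      by (simp add: x enc_data_def enc_list_def enc_nat_def[of k])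
    show "\<forall>e\<in>set es. eu e < n \<and> ev e < n \<and> eu e \<noteq> ev e \<and> canon (ea e) \<and> canon (eb e) \<and> ea e \<noteq> [] \<and> eb e \<noteq> [] \<and>
        leqb (mulb (eW e) (eb e)) (mulb (ea e) (binary B)) \<and> leqb (mulb (ea e) (binary B)) (mulb (eW e) (eb e)) \<and>
        (r \<longrightarrow> ea e = eb e)"
    proof
      fix e' assume "e' \<in> set es"
      then obtain e where e: "e \<in> set es0" "e' = f e" by (auto simp: es_def)
      have "We e * ?b e = ?a e * B" using dvd[OF e(1)] by (simp add: We_def)
      moreover have "r \<Longrightarrow> ?a e = ?b e"
        using r wg[OF e(1)] e(1) by (auto simp: edges_G)
      ultimately show "eu e' < n \<and> ev e' < n \<and> eu e' \<noteq> ev e' \<and> canon (ea e') \<and> canon (eb e') \<and> ea e' \<noteq> [] \<and> eb e' \<noteq> [] \<and>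
        leqb (mulb (eW e') (eb e')) (mulb (ea e') (binary B)) \<and> leqb (mulb (ea e') (binary B)) (mulb (eW e') (eb e')) \<and>
        (r \<longrightarrow> ea e' = eb e')"
        using uv[OF e(1)] wg[OF e(1)] binary_eq_Nil[of "?a e"] binary_eq_Nil[of "?b e"]
        by (auto simp: e(2) f_def canon_binary leqb_iff val_mulb)
    qed
    have "distinct (map (\<lambda>e. edge_of G (eu e) (ev e)) es)" unfolding es_g by (rule dist)
    then show "distinct (map (ekey (is_directed G)) es)"
      using eq_ekey_iff[of G] by (auto simp: distinct_map inj_on_def)
    have "length (filter (\<lambda>e. eS e) es) = length (filter (\<lambda>e. ?g e \<in> S) es0)"
      by (simp add: es_def f_def filter_map comp_def)
    also have "\<dots> = card (set (filter (\<lambda>e. ?g e \<in> S) es0))"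
      using dist by (intro distinct_card[symmetric]) (simp add: distinct_map)
    also have "\<dots> = card (?g ` set (filter (\<lambda>e. ?g e \<in> S) es0))"
      by (rule card_image[symmetric]) (rule inj_on_subset[OF inj], auto)
    also have "\<dots> \<le> card S"
      using S(1) finite_edges by (intro card_mono) (auto simp: anti_forcing_set_def intro: finite_subset)
    finally show "leqb (binary (length (filter (\<lambda>e. eS e) es))) (binary k)" using S(2) by (simp add: leqb_iff)
    show "s < n" "t < n" by (rule st)+
    show "canon (binary k)" by (rule canon_binary)
    show "\<not> leqb (binary B) []" using B_pos by (simp add: leqb_iff)
    show "r \<longrightarrow> \<not> is_directed G" using r by blast
  qed (use crt in blast)+
  define c where "c = ((is_directed G, n, es, s, t, binary k), (P, binary B, ds, As))"
  have "sz c \<le> 1000 * (Lx * Lx)"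
  proof -
    have XX: "Lx \<le> Lx * Lx" "1 \<le> Lx * Lx" using len(6) by auto
    have B_le: "B \<le> 2 ^ Lx"
    proof -
      have "B \<le> 2 ^ (\<Sum>e\<leftarrow>es0. length (binary (?b e)))" unfolding B_def by (rule prod_list_le_power)
      also have "\<dots> \<le> 2 ^ Lx" by (rule power_increasing) (use len(4) in auto)
      finally show ?thesis .
    qed
    \<comment> \<open>Numerator and scaling factor contribute at most \<open>Lx\<close> bits
      each.\<close>
    have We_less: "We e < 2 ^ (2 * Lx)" if "e \<in> set es0" for e
    proof -
      have "length (binary (?a e)) \<le> Lx" using len(3)[of "fst e" "fst (snd e)" "?a e" "?b e"] that by simp
      then have "(2 :: nat) ^ length (binary (?a e)) \<le> 2 ^ Lx" by (rule power_increasing) simp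
      then have "?a e < 2 ^ Lx" using less_binary[of "?a e"] by linarith
      moreover have "B div ?b e \<le> 2 ^ Lx" using B_le by (meson div_le_dividend order_trans)
      ultimately have "We e < 2 ^ Lx * 2 ^ Lx" unfolding We_def
        by (intro mult_less_le_imp_less) (use wg(1)[OF that] dvd[OF that] B_pos in \<open>auto simp: dvd_imp_le div_greater_zero_iff\<close>)
      then show ?thesis by (simp add: mult_2 power_add)
    qed
    \<comment> \<open>At most \<open>Lx\<close> edges of weight at most \<open>2 ^ (2 * Lx)\<close>,
      and \<open>Lx < 2 ^ Lx\<close>. This bounds all potentials, including the default for
      unreachable vertices.\<close>
    have total_less: "total < 2 ^ (3 * Lx)"
    proof -
      have "W E \<le> 2 ^ (2 * Lx)" if E: "E \<in> edges G" for E
      proof -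
        obtain e where "e \<in> set es0" "E = ?g e" using E by (auto simp: edges_G)
        then show ?thesis using We_less[of e] by (simp add: W_def ent)
      qed
      then have "total \<le> card (edges G) * 2 ^ (2 * Lx)"
        unfolding total_def using sum_bounded_above[of "edges G" W "2 ^ (2 * Lx)"] by simp
      also have "card (edges G) \<le> Lx" using len(2) card_length[of "map ?g es0"] by (simp add: edges_G)
      then have "card (edges G) * 2 ^ (2 * Lx) \<le> Lx * 2 ^ (2 * Lx)" by simp
      also have "\<dots> < 2 ^ Lx * 2 ^ (2 * Lx)" by simp
      also have "\<dots> = 2 ^ (3 * Lx)" by (simp flip: power_add)
      finally show ?thesis .
    qed
    have es_sz: "sz es \<le> 1 + Lx * (1 + (24 * Lx + 20))"
    proof -
      have "sz e' \<le> 24 * Lx + 20" if "e' \<in> set es" for e'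
      proof -
        obtain e where e: "e \<in> set es0" "e' = f e" using \<open>e' \<in> set es\<close> by (auto simp: es_def)
        have "length (binary (?a e)) \<le> Lx \<and> length (binary (?b e)) \<le> Lx"
          using len(3)[of "fst e" "fst (snd e)" "?a e" "?b e"] e by simp
        then have "sz (binary (?a e)) \<le> 1 + 4 * Lx" "sz (binary (?b e)) \<le> 1 + 4 * Lx"
          using sz_bits_le[of "binary (?a e)" Lx] sz_bits_le[of "binary (?b e)" Lx] by simp_all
        moreover have "sz (binary (We e)) \<le> 1 + 4 * (2 * Lx)"
          by (rule sz_bits_le[OF length_binary_le[OF We_less[OF e(1)]]])
        ultimately show ?thesis using uv[OF e(1)] len(1) by (simp add: e(2) f_def sz_prod sz_nat sz_bool)
      qed
      then have "sz es \<le> 1 + length es * (1 + (24 * Lx + 20))" by (rule sz_list_bound)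
      also have "\<dots> \<le> 1 + Lx * (1 + (24 * Lx + 20))" using len(2) by (intro add_left_mono mult_right_mono) (auto simp: es_def)
      finally show ?thesis .
    qed
    have P_sz: "sz P \<le> 1 + Lx * (1 + (2 * Lx + 1))"
    proof -
      have "sz P \<le> 1 + length P * (1 + (2 * Lx + 1))"
        by (rule sz_list_bound) (use P(2) len(1) in \<open>auto simp: sz_nat Gv\<close>)
      moreover have "length P \<le> Lx"
        using distinct_card[OF P(1)] card_mono[OF _ P(2)] len(1) by (simp add: Gv)
      then have "length P * (1 + (2 * Lx + 1)) \<le> Lx * (1 + (2 * Lx + 1))" by (rule mult_right_mono) simp
      ultimately show ?thesis by linarith
    qed
    have ds_sz: "sz ds \<le> 1 + Lx * (1 + (1 + 4 * (3 * Lx)))"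
    proof -
      have "dst s v < 2 ^ (3 * Lx)" for v using dst_le_total[of s v] total_less st by (simp add: Gv)
      then have "sz (binary (dst s v)) \<le> 1 + 4 * (3 * Lx)" for v by (intro sz_bits_le length_binary_le)
      then have "sz ds \<le> 1 + length ds * (1 + (1 + 4 * (3 * Lx)))"
        by (intro sz_list_bound) (auto simp: ds_def)
      also have "\<dots> \<le> 1 + Lx * (1 + (1 + 4 * (3 * Lx)))" using len(1) by (intro add_left_mono mult_right_mono) (auto simp: ds_def)
      finally show ?thesis .
    qed
    have As_sz: "sz As \<le> 1 + 4 * Lx" by (rule sz_bits_le) (use len(1) in \<open>simp add: As_def\<close>)
    have k_sz: "sz (binary k) \<le> 1 + 4 * Lx" by (rule sz_bits_le[OF len(5)])
    have "B < 2 ^ Suc Lx"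
    proof -
      have "(2 :: nat) ^ Lx < 2 ^ Suc Lx" by simp
      then show ?thesis using B_le by linarith
    qed
    then have B_sz: "sz (binary B) \<le> 1 + 4 * Suc Lx" by (intro sz_bits_le length_binary_le)
    have d_sz: "sz (is_directed G) \<le> 3" by (simp add: sz_bool)
    have nst: "sz n \<le> 2 * Lx + 1" "sz s \<le> 2 * Lx + 1" "sz t \<le> 2 * Lx + 1" using len(1) st by (auto simp: sz_nat)
    have "sz c = 9 + sz (is_directed G) + sz n + sz es + sz s + sz t + sz (binary k) + sz P + sz (binary B) + sz ds + sz As"
      by (simp add: c_def sz_prod)
    moreover define Q where "Q = Lx * Lx"
    have es_sz': "sz es \<le> 1 + 21 * Lx + 24 * Q" and P_sz': "sz P \<le> 1 + 2 * Lx + 2 * Q"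
      and ds_sz': "sz ds \<le> 1 + 2 * Lx + 12 * Q"
      using es_sz P_sz ds_sz by (simp_all add: Q_def algebra_simps)
    ultimately have "sz c \<le> 9 + 3 + (2 * Lx + 1) + (1 + 21 * Lx + 24 * Q) + (2 * Lx + 1) + (2 * Lx + 1) +
        (1 + 4 * Lx) + (1 + 2 * Lx + 2 * Q) + (1 + 4 * Suc Lx) + (1 + 2 * Lx + 12 * Q) + (1 + 4 * Lx)"
      by (simp only:) (intro add_mono order_refl es_sz' P_sz' ds_sz' As_sz k_sz B_sz d_sz nst)
    \<comment> \<open>From \<open>1 \<le> Lx\<close> both linear and constant terms are at most a
      multiple of \<open>Q\<close>; the constant 1000 is generous.\<close>
    also have "\<dots> \<le> 1000 * Q" using XX unfolding Q_def[symmetric] by simp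
    finally show ?thesis by (simp add: Q_def)
  qed
  moreover have "vcheck r (x, c)" unfolding c_def vcheck_simp by (rule check)
  ultimately show ?thesis unfolding Lx_def by blast
qed

lemma in_NP_lang: "in_NP (lang r)"
  unfolding in_NP_def
proof (intro exI[of _ "verifier r"] exI[of _ "[:0, 0, 1000:]"] conjI allI)
  show "in_P (verifier r)" by (rule in_P_verifier)
  show "x \<in> lang r \<longleftrightarrow> (\<exists>u. length u \<le> poly [:0, 0, 1000:] (length x) \<and> pair_str x u \<in> verifier r)" for x
  proof
    assume "x \<in> lang r"
    then obtain c where c: "vcheck r (x, c)" "sz c \<le> 1000 * (length x * length x)" using verify_complete by blast
    then have "length (rpn (tt c)) \<le> poly [:0, 0, 1000:] (length x)" by (simp add: length_rpn algebra_simps)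
    moreover have "pair_str x (rpn (tt c)) \<in> verifier r"
      using c(1) by (simp add: verifier_pair_str rpn_parse_rpn dcert_tt)
    ultimately show "\<exists>u. length u \<le> poly [:0, 0, 1000:] (length x) \<and> pair_str x u \<in> verifier r" by blast
  next
    assume "\<exists>u. length u \<le> poly [:0, 0, 1000:] (length x) \<and> pair_str x u \<in> verifier r"
    then show "x \<in> lang r" by (auto simp: verifier_pair_str vcheck_def intro: verify_sound)
  qed
qed

theorem theorem2:
  shows "NP_complete ANTI_FORCING \<and> NP_complete ANTI_FORCING_undirected_unit"
  using in_NP_lang[of False] in_NP_lang[of True] NP_hard_ANTI_FORCING
  by (simp add: NP_complete_def lang_def)

end
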